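(* Let $B^{(1)}_{X,\Lambda}$ and $B^{(2)}_{X,\Lambda}$ be the minimal operators in $\ell^2(\mathbb{N};\mathbb{C}^p)$ associated with the following two block Jacobi matrices (all blocks are $p\times p$). First matrix: the symmetric block tridiagonal matrix with diagonal blocks $$(2k-1,2k-1):\ \tfrac{1}{d_k}\Lambda_{k-1}\ \ (k\ge 2),\qquad (1,1):\ \mathbb{O}_p,\qquad (2k,2k):\ -\tfrac{1}{d_k^{2}}\mathrm{I}_p\ \ (k\ge1),$$ and off-diagonal blocks $$(2k-1,2k)\text{ and }(2k,2k-1):\ -\tfrac{1}{d_k^{2}}\mathrm{I}_p,\qquad (2k,2k+1)\text{ and }(2k+1,2k):\ d_k^{-3/2}d_{k+1}^{-1/2}\,\mathrm{I}_p\qquad(k\ge1).$$ Second matrix: the symmetric block tridiagonal matrix with diagonal blocks $$(k,k):\ \tfrac{1}{d_kd_{k+1}}\mathrm{I}_p+\tfrac{1}{d_k+d_{k+1}}\Lambda_k\qquad(k\ge 1),$$ and off-diagonal blocks $$(k,k+1)\text{ and }(k+1,k):\ -\tfrac{1}{r_kr_{k+1}d_{k+1}}\mathrm{I}_p\qquad(k\ge1).$$ Let $B_{X,\Lambda}$ be either of the operators $B^{(1)}_{X,\Lambda}$, $B^{(2)}_{X,\Lambda}$. Then $$n_\pm(H_{X,\Lambda})=n_\pm(B_{X,\Lambda})\le p .$$ In particular, the deficiency indices of $B^{(1)}_{X,\Lambda}$ and $B^{(2)}_{X,\Lambda}$ coincide.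
   Context: Let $p\in\mathbb{N}$, $\mathbb{R}_+=(0,\infty)$. Let $X=\{x_k\}_{k=0}^\infty$ be strictly increasing with $x_0=0$ and $\lim_{k\to\infty}x_k=\infty$. Put $d_k:=x_k-x_{k-1}$, $r_k:=\sqrt{d_k+d_{k+1}}$ for $k\in\mathbb{N}$, and assume $d^*:=\sup_k d_k<\infty$. Let $\Lambda=\{\Lambda_k\}_{k=1}^\infty\subset\mathbb{C}^{p\times p}$ with $\Lambda_k=\Lambda_k^*$ for all $k$. $\mathrm{I}_p$, $\mathbb{O}_p$ are the identity and zero $p\times p$ matrices. The operator $H^0_{X,\Lambda}$ in $L^2(\mathbb{R}_+;\mathbb{C}^p)$ acts as $f\mapsto -f''$ (on each interval $(x_{k-1},x_k)$) on the domain of all $f$ with compact support in $[0,\infty)$ whose restriction to each $[x_{k-1},x_k]$ lies in $W^{2,2}([x_{k-1},x_k];\mathbb{C}^p)$, and such that $f'(0)=0$, $f(x_k+)=f(x_k-)$, $f'(x_k+)-f'(x_k-)=\Lambda_kf(x_k)$ for all $k\in\mathbb{N}$. $H_{X,\Lambda}:=\overline{H^0_{X,\Lambda}}$ is its closure (the Schrödinger operator with $\delta$-interactions $-\frac{d^2}{dx^2}\otimes \mathrm{I}_p+\sum_k\Lambda_k\delta(x-x_k)$). The minimal operator associated with a block Jacobi matrix in $\ell^2(\mathbb{N};\mathbb{C}^p)$ is the closure of the operator given by the matrix on the set $\ell^2_0(\mathbb{N};\mathbb{C}^p)$ of finitely supported sequences. For a densely defined closed symmetric operator $T$, $n_\pm(T):=\dim\ker(T^*\mp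 \mathrm{i})$ are its deficiency indices; $n_\pm(H)=n_\pm(B)$ means $n_+(H)=n_+(B)$ and $n_-(H)=n_-(B)$. *)

theory Defs
  imports "HOL-Analysis.Analysis" "HOL-Library.Extended_Nat"
begin

text \<open>
  The Hilbert space L2(M; C^p) is represented by square-integrable functions, two functions being
  identified when they agree almost everywhere on M.  With \<open>M = lebesgue_on {0<..}\<close> it is
  L2((0, infinity); C^p), and with \<open>M = count_space {1..}\<close> it is l2(N; C^p) with N = {1, 2, ...}; values of
  functions outside of the space of M are irrelevant.
\<close>

definition L2 :: "'a measure \<Rightarrow> ('a \<Rightarrow> complex ^ 'p) set" where
  "L2 M = {f. f \<in> borel_measurable M \<and> integrable M (\<lambda>t. (norm (f t))\<^sup>2)}"

definition L2_norm :: "'a measure \<Rightarrow> ('a \<Rightarrow> complex ^ 'p) \<Rightarrow> real" where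
  "L2_norm M f = sqrt (\<integral>t. (norm (f t))\<^sup>2 \<partial>M)"

definition L2_inner :: "'a measure \<Rightarrow> ('a \<Rightarrow> complex ^ 'p) \<Rightarrow> ('a \<Rightarrow> complex ^ 'p) \<Rightarrow> complex" where
  "L2_inner M f g = (\<integral>t. (\<Sum>i\<in>UNIV. f t $ i * cnj (g t $ i)) \<partial>M)"

definition L2_independent :: "'a measure \<Rightarrow> ('a \<Rightarrow> complex ^ 'p) set \<Rightarrow> bool" where
  "L2_independent M S \<longleftrightarrow>
     (\<forall>c. (AE t in M. (\<Sum>f\<in>S. c f *s f t) = 0) \<longrightarrow> (\<forall>f\<in>S. c f = (0::complex)))"

text \<open>
  Complex dimension of a subspace V of L2(M; C^p), almost-everywhere equal functions being
  identified; it is infinity exactly when V is not finite-dimensional.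
\<close>

definition L2_dim :: "'a measure \<Rightarrow> ('a \<Rightarrow> complex ^ 'p) set \<Rightarrow> enat" where
  "L2_dim M V = (SUP S\<in>{S. finite S \<and> S \<subseteq> V \<and> L2_independent M S}. enat (card S))"

text \<open>Operators are represented by their graphs.\<close>

type_synonym ('a, 'p) L2_op = "(('a \<Rightarrow> complex ^ 'p) \<times> ('a \<Rightarrow> complex ^ 'p)) set"

definition op_closure :: "'a measure \<Rightarrow> ('a, 'p::finite) L2_op \<Rightarrow> ('a, 'p) L2_op" where
  "op_closure M T = {(f, g). f \<in> L2 M \<and> g \<in> L2 M \<and>
     (\<exists>F G. (\<forall>n::nat. (F n, G n) \<in> T) \<and>
        (\<lambda>n. L2_norm M (\<lambda>t. F n t - f t)) \<longlonglongrightarrow> 0 \<and>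
        (\<lambda>n. L2_norm M (\<lambda>t. G n t - g t)) \<longlonglongrightarrow> 0)}"

definition op_adjoint :: "'a measure \<Rightarrow> ('a, 'p::finite) L2_op \<Rightarrow> ('a, 'p) L2_op" where
  "op_adjoint M T = {(u, v). u \<in> L2 M \<and> v \<in> L2 M \<and>
     (\<forall>(f, g)\<in>T. L2_inner M g u = L2_inner M f v)}"

text \<open>The kernel of T - z.\<close>

definition op_eigenspace :: "('a, 'p::finite) L2_op \<Rightarrow> complex \<Rightarrow> ('a \<Rightarrow> complex ^ 'p) set" where
  "op_eigenspace T z = {u. (u, \<lambda>t. z *s u t) \<in> T}"

definition n_plus :: "'a measure \<Rightarrow> ('a, 'p::finite) L2_op \<Rightarrow> enat" where
  "n_plus M T = L2_dim M (op_eigenspace (op_adjoint M T) \<i>)"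

definition n_minus :: "'a measure \<Rightarrow> ('a, 'p::finite) L2_op \<Rightarrow> enat" where
  "n_minus M T = L2_dim M (op_eigenspace (op_adjoint M T) (- \<i>))"

text \<open>
  u is absolutely continuous on [a, b] with derivative v almost everywhere.  Only the values of u
  on the open interval are used (they determine the continuous extension to [a, b]), so that the
  restrictions of one function to adjacent intervals do not interfere.
\<close>

definition ac_derivative ::
    "real \<Rightarrow> real \<Rightarrow> (real \<Rightarrow> complex ^ 'p) \<Rightarrow> (real \<Rightarrow> complex ^ 'p) \<Rightarrow> bool" where
  "ac_derivative a b u v \<longleftrightarrow> set_integrable lebesgue {a<..<b} v \<and>
     (\<forall>s t. a < s \<and> s \<le> t \<and> t < b \<longrightarrow>
        u t - u s = set_lebesgue_integral lebesgue {s..t} v)"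

text \<open>
  The Sobolev space W^{2,2}([a, b]; C^p) over a bounded interval, in its one-dimensional
  description: f and f' are absolutely continuous and f'' is square-integrable.
  The function f is the continuously differentiable representative of its class.
\<close>

definition W22 :: "real \<Rightarrow> real \<Rightarrow> (real \<Rightarrow> complex ^ 'p) set" where
  "W22 a b = {f. \<exists>f1 f2. ac_derivative a b f f1 \<and> ac_derivative a b f1 f2 \<and>
                 f2 \<in> L2 (lebesgue_on {a<..<b})}"

abbreviation vderiv :: "(real \<Rightarrow> complex ^ 'p::finite) \<Rightarrow> real \<Rightarrow> complex ^ 'p" where
  "vderiv f \<equiv> (\<lambda>t. vector_derivative f (at t))"

abbreviation half_line :: "real measure" where
  "half_line \<equiv> lebesgue_on {0<..}"

definition dom_H0 ::
    "(nat \<Rightarrow> real) \<Rightarrow> (nat \<Rightarrow> complex ^ 'p ^ 'p) \<Rightarrow> (real \<Rightarrow> complex ^ 'p::finite) set" where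
  "dom_H0 X \<Lambda> = {f.
     compact (closure {t. 0 < t \<and> f t \<noteq> 0}) \<and>
     (\<forall>k\<ge>1. f \<in> W22 (X (k - 1)) (X k)) \<and>
     Lim (at_right 0) (vderiv f) = 0 \<and>
     (\<forall>k\<ge>1. (f \<longlongrightarrow> f (X k)) (at_left (X k)) \<and> (f \<longlongrightarrow> f (X k)) (at_right (X k)) \<and>
        Lim (at_right (X k)) (vderiv f) - Lim (at_left (X k)) (vderiv f) = \<Lambda> k *v f (X k))}"

text \<open>The pair (f, g) is in the graph iff f is in the domain and g = -f'' almost everywhere.\<close>

definition H0 :: "(nat \<Rightarrow> real) \<Rightarrow> (nat \<Rightarrow> complex ^ 'p ^ 'p) \<Rightarrow> (real, 'p::finite) L2_op" where
  "H0 X \<Lambda> = {(f, g). f \<in> dom_H0 X \<Lambda> \<and> g \<in> L2 half_line \<and>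
     (\<forall>k\<ge>1. ac_derivative (X (k - 1)) (X k) (vderiv f) (\<lambda>t. - g t))}"

definition H_op :: "(nat \<Rightarrow> real) \<Rightarrow> (nat \<Rightarrow> complex ^ 'p ^ 'p) \<Rightarrow> (real, 'p::finite) L2_op" where
  "H_op X \<Lambda> = op_closure half_line (H0 X \<Lambda>)"

abbreviation pos_nats :: "nat measure" where
  "pos_nats \<equiv> count_space {1..}"

definition minimal_op :: "(nat \<Rightarrow> nat \<Rightarrow> complex ^ 'p ^ 'p) \<Rightarrow> (nat, 'p::finite) L2_op" where
  "minimal_op J = op_closure pos_nats
     {(u, v). finite {n. 1 \<le> n \<and> u n \<noteq> 0} \<and> v \<in> L2 pos_nats \<and>
        (\<forall>m\<ge>1. v m = (\<Sum>n | 1 \<le> n \<and> u n \<noteq> 0. J m n *v u n))}"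

text \<open>Diagonal blocks a n at (n, n), off-diagonal blocks b n at (n, n+1) and (n+1, n).\<close>

definition block_jacobi ::
    "(nat \<Rightarrow> complex ^ 'p ^ 'p) \<Rightarrow> (nat \<Rightarrow> complex ^ 'p ^ 'p) \<Rightarrow> nat \<Rightarrow> nat \<Rightarrow> complex ^ 'p ^ 'p" where
  "block_jacobi a b m n =
     (if n = m then a m else if n = m + 1 then b m else if m = n + 1 then b n else 0)"

definition gap :: "(nat \<Rightarrow> real) \<Rightarrow> nat \<Rightarrow> real" where
  "gap X k = X k - X (k - 1)"

definition rad :: "(nat \<Rightarrow> real) \<Rightarrow> nat \<Rightarrow> real" where
  "rad X k = sqrt (gap X k + gap X (k + 1))"

text \<open>In row n = 2k-1 or n = 2k the index k equals (n+1) div 2.\<close>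

definition J1 :: "(nat \<Rightarrow> real) \<Rightarrow> (nat \<Rightarrow> complex ^ 'p ^ 'p) \<Rightarrow> nat \<Rightarrow> nat \<Rightarrow> complex ^ 'p ^ 'p" where
  "J1 X \<Lambda> = block_jacobi
     (\<lambda>n. let k = (n + 1) div 2 in
        if n = 1 then 0
        else if odd n then (1 / gap X k) *\<^sub>R \<Lambda> (k - 1)
        else (- 1 / (gap X k)\<^sup>2) *\<^sub>R mat 1)
     (\<lambda>n. let k = (n + 1) div 2 in
        if odd n then (- 1 / (gap X k)\<^sup>2) *\<^sub>R mat 1
        else (gap X k powr (- 3 / 2) * gap X (k + 1) powr (- 1 / 2)) *\<^sub>R mat 1)"

definition J2 :: "(nat \<Rightarrow> real) \<Rightarrow> (nat \<Rightarrow> complex ^ 'p ^ 'p) \<Rightarrow> nat \<Rightarrow> nat \<Rightarrow> complex ^ 'p ^ 'p" where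
  "J2 X \<Lambda> = block_jacobi
     (\<lambda>k. (1 / (gap X k * gap X (k + 1))) *\<^sub>R mat 1 + (1 / (gap X k + gap X (k + 1))) *\<^sub>R \<Lambda> k)
     (\<lambda>k. (- 1 / (rad X k * rad X (k + 1) * gap X (k + 1))) *\<^sub>R mat 1)"

definition B1 :: "(nat \<Rightarrow> real) \<Rightarrow> (nat \<Rightarrow> complex ^ 'p ^ 'p) \<Rightarrow> (nat, 'p::finite) L2_op" where
  "B1 X \<Lambda> = minimal_op (J1 X \<Lambda>)"

definition B2 :: "(nat \<Rightarrow> real) \<Rightarrow> (nat \<Rightarrow> complex ^ 'p ^ 'p) \<Rightarrow> (nat, 'p::finite) L2_op" where
  "B2 X \<Lambda> = minimal_op (J2 X \<Lambda>)"

end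

theory Submission
  imports Defs
begin

text \<open>
  For \<open>z = \<i>\<close> and \<open>z = - \<i>\<close> the deficiency space of each of the three operators consists of the
  square-summable solutions of a recurrence or differential equation that are determined by a
  vector \<open>c\<close> in \<open>\<complex>\<^sup>p\<close>, so its dimension is that of the subspace of those \<open>c\<close> whose solution has bounded
  energy.  These subspaces are compared by Weyl's argument: if a space \<open>S\<close> of boundary
  data, coming from elements of the maximal domain, has positive boundary form at infinity, then
  \<open>dim S\<close> is at most the dimension of the deficiency space.  Indeed, otherwise some nonzero element
  of \<open>S\<close> is asymptotically orthogonal to all square-summable solutions; decomposing its state at each
  \<open>N\<close> into solutions for \<open>z\<close> and for \<open>cnj z\<close>, a limit point of the first components is a
  square-summable solution, and the orthogonality contradicts the positivity.

  It remains to map the deficiency spaces to elements of the maximal domain of the next operator,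
  with the same boundary form at infinity, along the cycle from \<open>H\<close> to the first matrix, to the second matrix and back to \<open>H\<close>.
  The maps are given by the boundary triplet \<open>\<Gamma>\<^sub>0 f = (\<surd>d f(x\<^sub>k\<^sub>-\<^sub>1), \<surd>d\<^sup>3 f'(x\<^sub>k-))\<close>,
  \<open>\<Gamma>\<^sub>1 f = ((f'(x\<^sub>k\<^sub>-\<^sub>1+) - f'(x\<^sub>k-)) / \<surd>d, (f(x\<^sub>k) - f(x\<^sub>k\<^sub>-\<^sub>1) - d f'(x\<^sub>k-)) / \<surd>d\<^sup>3)\<close> on the intervals of
  length \<open>d\<close>, for which the interface conditions become \<open>\<Gamma>\<^sub>1 f = J \<Gamma>\<^sub>0 f\<close> with the first matrix \<open>J\<close>.
\<close>

subsection \<open>The Hermitian product on \<open>\<complex>\<^sup>p\<close>\<close>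

text \<open>A transported solution does not solve the next equation, and the gaps may tend to 0 at
  any rate. Weyl's argument tolerates both: it asks only for a square-summable residual and for a
  boundary form that is eventually bounded below by a positive number. In return it gives only an
  inequality between dimensions. This is why the comparison runs around a cycle: three inequalities
  force equality, and no transport has to be inverted or shown to be onto.

  The weights in the boundary triplet are chosen by scaling: with them each of the four components,
  for a solution on a cell of length d, is bounded by its L2 norm on that cell, with a constant that
  depends only on an upper bound for d. This is where finiteness of the supremum of the gaps is
  used. The boundary form is reproduced exactly by the first transport; the other two lose a term at
  the last node, which is absorbed by the energy.\<close>

definition hdot :: "complex ^ 'p \<Rightarrow> complex ^ 'p \<Rightarrow> complex" where
  "hdot x y = (\<Sum>i\<in>UNIV. x $ i * cnj (y $ i))"

abbreviation clin :: "(complex ^ 'p \<Rightarrow> complex ^ 'q) \<Rightarrow> bool" where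
  "clin f \<equiv> Vector_Spaces.linear (*s) (*s) f"

lemma hdot_add: "hdot (x + x') y = hdot x y + hdot x' y" "hdot x (y + y') = hdot x y + hdot x y'"
  by (simp_all add: hdot_def algebra_simps sum.distrib)

lemma hdot_diff: "hdot (x - x') y = hdot x y - hdot x' y" "hdot x (y - y') = hdot x y - hdot x y'"
  by (simp_all add: hdot_def algebra_simps sum_subtractf)

lemma hdot_minus: "hdot (- x) y = - hdot x y" "hdot x (- y) = - hdot x y"
  by (simp_all add: hdot_def sum_negf)

lemma hdot_zero [simp]: "hdot 0 y = 0" "hdot x 0 = 0"
  by (simp_all add: hdot_def)

lemma hdot_scale: "hdot (k *s x) y = k * hdot x y" "hdot x (k *s y) = cnj k * hdot x y"
  by (simp_all add: hdot_def sum_distrib_left mult_ac)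

lemma scaleR_eq_scale: "r *\<^sub>R (x :: complex ^ 'p) = complex_of_real r *s x"
  by (simp add: vec_eq_iff) (simp add: scaleR_conv_of_real)

lemma hdot_scaleR: "hdot (r *\<^sub>R x) y = r *\<^sub>R hdot x y" "hdot x (r *\<^sub>R y) = r *\<^sub>R hdot x y"
  by (simp_all add: scaleR_eq_scale hdot_scale scaleR_conv_of_real)

lemma hdot_sum: "hdot x (sum f A) = (\<Sum>a\<in>A. hdot x (f a))"
  by (induction A rule: infinite_finite_induct) (simp_all add: hdot_add)

lemma hdot_commute: "hdot y x = cnj (hdot x y)"
  by (simp add: hdot_def mult.commute)

lemma hdot_self: "hdot x x = of_real ((norm x)\<^sup>2)"
  by (simp add: hdot_def norm_vec_def L2_set_def sum_nonneg complex_norm_square[symmetric])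

lemma norm_hdot_le: "norm (hdot x y) \<le> norm x * norm y"
proof -
  have "norm (hdot x y) \<le> (\<Sum>i\<in>UNIV. \<bar>norm (x $ i)\<bar> * \<bar>norm (y $ i)\<bar>)"
    unfolding hdot_def by (rule order.trans[OF norm_sum]) (simp add: norm_mult)
  also have "\<dots> \<le> norm x * norm y"
    unfolding norm_vec_def by (rule L2_set_mult_ineq)
  finally show ?thesis .
qed

lemma bounded_bilinear_hdot: "bounded_bilinear hdot"
  by (rule bounded_bilinear.intro)
    (auto simp: hdot_add hdot_scaleR intro!: exI[of _ 1] norm_hdot_le)

lemma hdot_axis: "hdot (axis i 1) y = cnj (y $ i)"
  by (simp add: hdot_def axis_def if_distrib[of "\<lambda>t. t * _"] sum.delta cong: if_cong)

lemma hdot_matrix: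
  assumes "A = map_matrix cnj (transpose A)"
  shows "hdot (A *v x) y = hdot x (A *v y)"
proof -
  have *: "A $ i $ j = cnj (A $ j $ i)" for i j
    using arg_cong[OF assms, of "\<lambda>B. B $ i $ j"] by (simp add: map_matrix_def transpose_def)
  have "hdot (A *v x) y = (\<Sum>i\<in>UNIV. \<Sum>j\<in>UNIV. A $ i $ j * x $ j * cnj (y $ i))"
    by (simp add: hdot_def matrix_vector_mult_def sum_distrib_right)
  also have "\<dots> = (\<Sum>j\<in>UNIV. \<Sum>i\<in>UNIV. A $ i $ j * x $ j * cnj (y $ i))"
    by (rule sum.swap)
  also have "\<dots> = hdot x (A *v y)"
    unfolding hdot_def matrix_vector_mult_def
    by (simp add: sum_distrib_left) (intro sum.cong refl, subst *, simp)
  finally show ?thesis .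
qed

lemma norm_vscale: "norm (k *s (x :: complex ^ 'p)) = norm k * norm x"
  by (simp add: norm_vec_def norm_mult L2_set_right_distrib)

lemma bounded_bilinear_vscale: "bounded_bilinear ((*s) :: complex \<Rightarrow> complex ^ 'p \<Rightarrow> complex ^ 'p)"
  by (rule bounded_bilinear.intro)
    (auto simp: vec.scale_right_distrib vec.scale_left_distrib norm_vscale scaleR_eq_scale
      scaleR_conv_of_real mult.commute intro!: exI[of _ 1])

lemma clinI:
  assumes "\<And>x y. f (x + y) = f x + f y" "\<And>k x. f (k *s x) = k *s f x"
  shows "clin f"
  using assms by (simp add: Vector_Spaces.linear_iff vec.vector_space_axioms)

lemma clin_id: "clin (\<lambda>x. x)"
  and clin_zero: "clin (\<lambda>x. 0)"
  and clin_add: "clin f \<Longrightarrow> clin g \<Longrightarrow> clin (\<lambda>x. f x + g x)"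
  and clin_diff: "clin f \<Longrightarrow> clin g \<Longrightarrow> clin (\<lambda>x. f x - g x)"
  and clin_minus: "clin f \<Longrightarrow> clin (\<lambda>x. - f x)"
  and clin_scale: "clin f \<Longrightarrow> clin (\<lambda>x. k *s f x)"
  and clin_scaleR: "clin f \<Longrightarrow> clin (\<lambda>x. r *\<^sub>R f x)"
  and clin_matrix: "clin f \<Longrightarrow> clin (\<lambda>x. A *v f x)"
  by (auto intro!: clinI simp: vec.linear_add vec.linear_scale vec.scale_right_distrib
      vec.scale_right_diff_distrib scaleR_eq_scale mult.commute vec.add vec.scale)

lemmas clin_intros = clin_id clin_zero clin_add clin_diff clin_minus clin_scale clin_scaleR clin_matrix

lemma clin_imp_linear: "clin f \<Longrightarrow> linear f"
  by (rule linearI) (simp_all add: vec.linear_add vec.linear_scale scaleR_eq_scale)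

lemma clin_continuous: "clin f \<Longrightarrow> continuous_on S f"
  by (intro linear_continuous_on) (simp add: clin_imp_linear linear_conv_bounded_linear[symmetric])

subsection \<open>Operators in \<open>L\<^sup>2\<close>\<close>

lemma L2_inner_hdot: "L2_inner M f g = (\<integral>t. hdot (f t) (g t) \<partial>M)"
  by (simp add: L2_inner_def hdot_def)

lemma hdot_measurable [measurable]:
  assumes [measurable]: "f \<in> borel_measurable M" "g \<in> borel_measurable M"
  shows "(\<lambda>t. hdot (f t) (g t)) \<in> borel_measurable M"
proof -
  have "continuous_on UNIV (\<lambda>p. hdot (fst p) (snd p) :: complex)"
    by (intro bounded_bilinear.continuous_on[OF bounded_bilinear_hdot] continuous_intros)
  then have "(\<lambda>p. hdot (fst p) (snd p)) \<in> borel_measurable borel"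
    by (rule borel_measurable_continuous_onI)
  from measurable_compose[OF _ this, of "\<lambda>t. (f t, g t)" M] show ?thesis
    by (simp add: borel_prod[symmetric])
qed

lemma vscale_measurable [measurable]:
  fixes f :: "'a \<Rightarrow> complex ^ 'p"
  assumes [measurable]: "f \<in> borel_measurable M"
  shows "(\<lambda>t. k *s f t) \<in> borel_measurable M"
proof -
  have "continuous_on UNIV (\<lambda>x :: complex ^ 'p. k *s x)"
    by (intro clin_continuous clin_intros)
  from measurable_compose[OF assms borel_measurable_continuous_onI[OF this]] show ?thesis .
qed

lemma L2_hdot_integrable:
  assumes "f \<in> L2 M" "g \<in> L2 M"
  shows "integrable M (\<lambda>t. norm (f t) * norm (g t))" "integrable M (\<lambda>t. hdot (f t) (g t))"
proof -
  have [measurable]: "f \<in> borel_measurable M" "g \<in> borel_measurable M"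
    and i: "integrable M (\<lambda>t. (norm (f t))\<^sup>2)" "integrable M (\<lambda>t. (norm (g t))\<^sup>2)"
    using assms by (auto simp: L2_def)
  have "norm (f t) * norm (g t) \<le> (norm (f t))\<^sup>2 + (norm (g t))\<^sup>2" for t
    using sum_squares_bound[of "norm (f t)" "norm (g t)"] by (simp add: mult.assoc)
      (smt (verit) mult_nonneg_nonneg norm_ge_zero)
  then show 1: "integrable M (\<lambda>t. norm (f t) * norm (g t))"
    by (intro Bochner_Integration.integrable_bound[OF Bochner_Integration.integrable_add[OF i]]) auto
  show "integrable M (\<lambda>t. hdot (f t) (g t))"
    by (rule Bochner_Integration.integrable_bound[OF 1])
      (auto simp: abs_mult intro!: AE_I2 norm_hdot_le hdot_measurable)
qed

lemma L2_inner_le: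
  assumes "f \<in> L2 M" "g \<in> L2 M"
  shows "norm (L2_inner M f g) \<le> L2_norm M f * L2_norm M g"
proof -
  have [measurable]: "f \<in> borel_measurable M" "g \<in> borel_measurable M"
    and i: "integrable M (\<lambda>t. (norm (f t))\<^sup>2)" "integrable M (\<lambda>t. (norm (g t))\<^sup>2)"
    using assms by (auto simp: L2_def)
  define F where "F = (\<integral>t. (norm (f t))\<^sup>2 \<partial>M)"
  define G where "G = (\<integral>t. (norm (g t))\<^sup>2 \<partial>M)"
  define I where "I = (\<integral>t. norm (f t) * norm (g t) \<partial>M)"
  have nn: "F \<ge> 0" "G \<ge> 0" "I \<ge> 0"
    by (simp_all add: F_def G_def I_def)
  note fg = L2_hdot_integrable[OF assms]
  have "(\<integral>\<^sup>+t. ennreal (norm (f t)) * ennreal (norm (g t)) \<partial>M)\<^sup>2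
      \<le> (\<integral>\<^sup>+t. (ennreal (norm (f t)))\<^sup>2 \<partial>M) * (\<integral>\<^sup>+t. (ennreal (norm (g t)))\<^sup>2 \<partial>M)"
    by (rule Cauchy_Schwarz_nn_integral) auto
  also have "(\<integral>\<^sup>+t. ennreal (norm (f t)) * ennreal (norm (g t)) \<partial>M) = ennreal I"
    unfolding I_def by (subst nn_integral_eq_integral[symmetric, OF fg(1)]) (auto simp: ennreal_mult)
  also have "(\<integral>\<^sup>+t. (ennreal (norm (f t)))\<^sup>2 \<partial>M) = ennreal F"
    unfolding F_def by (subst nn_integral_eq_integral[symmetric, OF i(1)]) (auto simp: ennreal_power)
  also have "(\<integral>\<^sup>+t. (ennreal (norm (g t)))\<^sup>2 \<partial>M) = ennreal G"
    unfolding G_def by (subst nn_integral_eq_integral[symmetric, OF i(2)]) (auto simp: ennreal_power)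
  finally have "I\<^sup>2 \<le> F * G"
    using nn by (simp add: ennreal_power ennreal_mult[symmetric])
  then have "I \<le> sqrt F * sqrt G"
    by (metis real_le_rsqrt real_sqrt_mult)
  moreover have "norm (L2_inner M f g) \<le> I"
    unfolding L2_inner_hdot I_def
    by (rule order.trans[OF integral_norm_bound]) (auto intro!: integral_mono integrable_norm fg norm_hdot_le)
  ultimately show ?thesis
    by (simp add: L2_norm_def F_def G_def)
qed

lemma L2_diff:
  assumes "f \<in> L2 M" "g \<in> L2 M"
  shows "(\<lambda>t. f t - g t) \<in> L2 M"
proof -
  have [measurable]: "f \<in> borel_measurable M" "g \<in> borel_measurable M"
    and i: "integrable M (\<lambda>t. (norm (f t))\<^sup>2)" "integrable M (\<lambda>t. (norm (g t))\<^sup>2)"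
    using assms by (auto simp: L2_def)
  have *: "(norm (f t - g t))\<^sup>2 \<le> 2 * (norm (f t))\<^sup>2 + 2 * (norm (g t))\<^sup>2" for t
  proof -
    have "(norm (f t - g t))\<^sup>2 \<le> (norm (f t) + norm (g t))\<^sup>2"
      by (intro power_mono norm_triangle_ineq4) auto
    also have "\<dots> \<le> 2 * (norm (f t))\<^sup>2 + 2 * (norm (g t))\<^sup>2"
      using sum_squares_bound[of "norm (f t)" "norm (g t)"] by (simp add: power2_sum)
    finally show ?thesis .
  qed
  have "integrable M (\<lambda>t. (norm (f t - g t))\<^sup>2)"
    by (rule Bochner_Integration.integrable_bound
        [of M "\<lambda>t. 2 * (norm (f t))\<^sup>2 + 2 * (norm (g t))\<^sup>2"]) (use i * in auto)
  then show ?thesis by (simp add: L2_def)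
qed

lemma L2_scale:
  assumes "f \<in> L2 M"
  shows "(\<lambda>t. k *s f t) \<in> L2 M"
proof -
  have [measurable]: "f \<in> borel_measurable M" using assms by (simp add: L2_def)
  have "(\<lambda>t. k *s f t) \<in> borel_measurable M" by measurable
  then show ?thesis
    using assms by (simp add: L2_def norm_vscale power_mult_distrib)
qed

text \<open>By Cauchy-Schwarz the defining relation of the adjoint is continuous in the pair (f, g),
  so it passes to limits. Deficiency spaces can therefore be computed by testing against the
  explicit domains alone.\<close>

lemma op_adjoint_closure:
  assumes "T \<subseteq> L2 M \<times> L2 M"
  shows "op_adjoint M (op_closure M T) = op_adjoint M T"
proof -
  have sub: "T \<subseteq> op_closure M T"
  proof clarify
    fix f g assume "(f, g) \<in> T"
    moreover have "L2_norm M (\<lambda>t. h t - h t :: complex ^ 'b) = 0" for h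
      by (simp add: L2_norm_def)
    ultimately show "(f, g) \<in> op_closure M T"
      using assms unfolding op_closure_def
      by (intro CollectI case_prodI conjI exI[of _ "\<lambda>_. f"] exI[of _ "\<lambda>_. g"]) auto
  qed
  have "L2_inner M g u = L2_inner M f v"
    if uv: "u \<in> L2 M" "v \<in> L2 M" and adj: "\<forall>(f, g)\<in>T. L2_inner M g u = L2_inner M f v"
      and fg: "(f, g) \<in> op_closure M T" for u v f g
  proof -
    obtain F G where FG: "\<And>n::nat. (F n, G n) \<in> T" and f: "f \<in> L2 M" and g: "g \<in> L2 M"
      and limF: "(\<lambda>n. L2_norm M (\<lambda>t. F n t - f t)) \<longlonglongrightarrow> 0"
      and limG: "(\<lambda>n. L2_norm M (\<lambda>t. G n t - g t)) \<longlonglongrightarrow> 0"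
      using fg by (auto simp: op_closure_def)
    have FL: "F n \<in> L2 M" "G n \<in> L2 M" for n using FG assms by auto
    have lim: "(\<lambda>n. L2_inner M (K n) w) \<longlonglongrightarrow> L2_inner M k w"
      if K: "\<And>n. K n \<in> L2 M" and k: "k \<in> L2 M" and w: "w \<in> L2 M"
        and lim: "(\<lambda>n. L2_norm M (\<lambda>t. K n t - k t)) \<longlonglongrightarrow> 0" for K k w
    proof -
      have "norm (L2_inner M (K n) w - L2_inner M k w) \<le> L2_norm M (\<lambda>t. K n t - k t) * L2_norm M w" for n
      proof -
        have "L2_inner M (K n) w - L2_inner M k w = L2_inner M (\<lambda>t. K n t - k t) w"
          by (simp add: L2_inner_hdot hdot_diff L2_hdot_integrable K k w)
        then show ?thesis
          using L2_inner_le[OF L2_diff[OF K k] w] by simp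
      qed
      moreover have "(\<lambda>n. L2_norm M (\<lambda>t. K n t - k t) * L2_norm M w) \<longlonglongrightarrow> 0"
        using tendsto_mult_right[OF lim] by simp
      ultimately have "(\<lambda>n. L2_inner M (K n) w - L2_inner M k w) \<longlonglongrightarrow> 0"
        by (rule Lim_null_comparison[OF always_eventually, OF allI])
      then show ?thesis by (simp add: LIM_zero_iff)
    qed
    have eq: "L2_inner M (G n) u = L2_inner M (F n) v" for n using adj FG by blast
    show ?thesis
      using lim[of G g u] lim[of F f v] FL f g uv limF limG by (simp add: eq LIMSEQ_unique)
  qed
  then show ?thesis
    using sub unfolding op_adjoint_def by fast
qed

text \<open>The parametrization of solutions by \<open>c\<close> is linear and injective up to null
  sets, so it carries independence in both directions. Every deficiency index thus becomes the
  dimension of a subspace of the space of initial values, which also gives the bound by p.\<close>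

lemma L2_dim_solutions:
  fixes U :: "complex ^ 'p \<Rightarrow> 'a \<Rightarrow> complex ^ 'p"
  assumes lin: "\<And>t. clin (\<lambda>c. U c t)" and meas: "\<And>c. U c \<in> borel_measurable M"
    and inj: "\<And>c. (AE t in M. U c t = 0) \<Longrightarrow> c = 0"
    and V: "V = {u \<in> L2 M. \<exists>c. AE t in M. u t = U c t}"
  shows "L2_dim M V = enat (vec.dim {c. U c \<in> L2 M})"
proof (rule antisym)
  let ?S = "{c. U c \<in> L2 M}"
  have Usum: "U (\<Sum>a\<in>A. k a *s f a) t = (\<Sum>a\<in>A. k a *s U (f a) t)" for A k f t
    by (simp add: vec.linear_sum[OF lin] vec.linear_scale[OF lin])
  have inj': "c = c'" if "AE t in M. U c t = U c' t" for c c'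
  proof -
    have "AE t in M. U (c - c') t = 0"
      using that by eventually_elim (simp add: vec.linear_diff[OF lin])
    then show ?thesis using inj[of "c - c'"] by simp
  qed
  show "L2_dim M V \<le> enat (vec.dim ?S)"
    unfolding L2_dim_def
  proof (rule SUP_least, clarify)
    fix T assume T: "finite T" "T \<subseteq> V" "L2_independent M T"
    have "\<forall>f\<in>T. \<exists>c. AE t in M. f t = U c t" using T V by auto
    then obtain c where c: "\<And>f. f \<in> T \<Longrightarrow> AE t in M. f t = U (c f) t" by metis
    have cS: "c f \<in> ?S" if "f \<in> T" for f
    proof -
      have "f \<in> L2 M" using T V that by auto
      moreover have "integrable M (\<lambda>t. (norm (f t))\<^sup>2) = integrable M (\<lambda>t. (norm (U (c f) t))\<^sup>2)"
        using \<open>f \<in> L2 M\<close> meas by (intro integrable_cong_AE) (use c[OF that] in \<open>auto simp: L2_def\<close>)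
      ultimately show ?thesis using meas by (auto simp: L2_def)
    qed
    have key: "\<forall>f\<in>T. k f = 0" if "(\<Sum>f\<in>T. k f *s c f) = 0" for k
    proof -
      have "AE t in M. \<forall>f\<in>T. f t = U (c f) t" using T(1) c by (simp add: AE_finite_all)
      then have "AE t in M. (\<Sum>f\<in>T. k f *s f t) = 0"
      proof eventually_elim
        case (elim t)
        have "(\<Sum>f\<in>T. k f *s f t) = (\<Sum>f\<in>T. k f *s U (c f) t)" using elim by (intro sum.cong) auto
        also have "\<dots> = 0" using Usum[of k c T t] that by (simp add: vec.linear_0[OF lin])
        finally show ?case .
      qed
      then show ?thesis using T(3) unfolding L2_independent_def by blast
    qed
    have injc: "inj_on c T"
    proof (rule inj_onI, rule ccontr)
      fix f g assume fg: "f \<in> T" "g \<in> T" "c f = c g" "f \<noteq> g"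
      \<comment> \<open>Two elements with the same parameter agree almost everywhere, and the
        coefficients 1 and -1 would relate them.\<close>
      have "(\<Sum>h\<in>T. (if h = f then 1 else if h = g then -1 else 0) *s c h)
          = (\<Sum>h\<in>{f, g}. (if h = f then 1 else if h = g then -1 else 0) *s c h)"
        by (rule sum.mono_neutral_right) (use T fg in auto)
      also have "\<dots> = 0" using fg by simp
      finally show False using key fg(1) by fastforce
    qed
    have "vec.independent (c ` T)"
    proof (rule vec.independent_if_scalars_zero)
      fix k x assume 0: "(\<Sum>x\<in>c ` T. k x *s x) = 0" and x: "x \<in> c ` T"
      have "(\<Sum>f\<in>T. k (c f) *s c f) = 0" using 0 by (simp add: sum.reindex[OF injc])
      then show "k x = 0" using key[of "\<lambda>f. k (c f)"] x by auto
    qed (use T in simp)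
    then have "card (c ` T) \<le> vec.dim ?S"
      by (intro vec.independent_card_le_dim) (use cS in auto)
    then show "enat (card T) \<le> enat (vec.dim ?S)" by (simp add: card_image[OF injc])
  qed
  show "enat (vec.dim ?S) \<le> L2_dim M V"
  proof -
    obtain B where B: "B \<subseteq> ?S" "vec.independent B" "card B = vec.dim ?S"
      by (metis vec.basis_exists)
    have finB: "finite B" using B(2) by (rule vec.finiteI_independent)
    have "inj U" by (rule injI, rule inj') auto
    then have injU: "inj_on U B" by (rule inj_on_subset) simp
    have "L2_independent M (U ` B)"
      unfolding L2_independent_def
    proof (intro allI impI ballI)
      fix k f assume "AE t in M. (\<Sum>f\<in>U ` B. k f *s f t) = 0" and f: "f \<in> U ` B"
      then have "AE t in M. U (\<Sum>b\<in>B. k (U b) *s b) t = 0"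
        by (simp add: sum.reindex[OF injU] Usum)
      then have "(\<Sum>b\<in>B. k (U b) *s b) = 0" by (rule inj)
      then have "\<forall>b\<in>B. k (U b) = 0"
        using vec.independentD[OF B(2) finB order.refl, of "\<lambda>b. k (U b)"] by blast
      then show "k f = 0" using f by auto
    qed
    moreover have "U ` B \<subseteq> V" using B(1) V by auto
    ultimately have "enat (card (U ` B)) \<le> L2_dim M V"
      unfolding L2_dim_def using finB by (intro SUP_upper) auto
    then show ?thesis using B(3) by (simp add: card_image[OF injU])
  qed
qed

subsection \<open>Weyl's limit-point argument\<close>

text \<open>The Lagrange bracket of two boundary states (value, slope). It is linear in the first
  state and antilinear in the second, like \<open>L2_inner\<close>, and skew-Hermitian, hence purely
  imaginary on the diagonal.\<close>

definition omega :: "complex ^ 'p \<Rightarrow> complex ^ 'p \<Rightarrow> complex ^ 'p \<Rightarrow> complex ^ 'p \<Rightarrow> complex" where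
  "omega a b a' b' = hdot a b' - hdot b a'"

lemma omega_add:
  "omega (a1 + a2) (b1 + b2) a' b' = omega a1 b1 a' b' + omega a2 b2 a' b'"
  "omega a b (a1' + a2') (b1' + b2') = omega a b a1' b1' + omega a b a2' b2'"
  by (simp_all add: omega_def hdot_add)

lemma omega_scale:
  "omega (k *s a) (k *s b) a' b' = k * omega a b a' b'"
  "omega a b (k *s a') (k *s b') = cnj k * omega a b a' b'"
  by (simp_all add: omega_def hdot_scale right_diff_distrib)

lemma omega_sum: "omega (\<Sum>i\<in>I. f i) (\<Sum>i\<in>I. g i) a' b' = (\<Sum>i\<in>I. omega (f i) (g i) a' b')"
  by (induction I rule: infinite_finite_induct) (simp_all add: omega_add, simp_all add: omega_def)

lemma omega_self: "omega a b a b = 2 * \<i> * of_real (Im (hdot a b))"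
  unfolding omega_def by (subst hdot_commute[of b a]) (simp add: complex_diff_cnj)

lemma omega_commute: "omega a' b' a b = - cnj (omega a b a' b')"
  unfolding omega_def by (simp add: hdot_commute[of a' b] hdot_commute[of b' a])

lemma norm_omega_le: "norm (omega a b a' b') \<le> (norm a + norm b) * (norm a' + norm b')"
proof -
  have "norm (omega a b a' b') \<le> norm a * norm b' + norm b * norm a'"
    unfolding omega_def by (intro order.trans[OF norm_triangle_ineq4] add_mono norm_hdot_le)
  also have "\<dots> \<le> (norm a + norm b) * (norm a' + norm b')"
    by (simp add: algebra_simps)
  finally show ?thesis .
qed

lemma tendsto_hdot: "(f \<longlongrightarrow> a) F \<Longrightarrow> (g \<longlongrightarrow> b) F \<Longrightarrow> ((\<lambda>x. hdot (f x) (g x)) \<longlongrightarrow> hdot a b) F"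
  by (rule bounded_bilinear.tendsto[OF bounded_bilinear_hdot])

lemma tendsto_omega:
  assumes "(a \<longlongrightarrow> A) F" "(b \<longlongrightarrow> B) F" "(a' \<longlongrightarrow> A') F" "(b' \<longlongrightarrow> B') F"
  shows "((\<lambda>x. omega (a x) (b x) (a' x) (b' x)) \<longlongrightarrow> omega A B A' B') F"
  unfolding omega_def by (intro tendsto_intros tendsto_hdot assms)

lemma clin_tendsto: "clin f \<Longrightarrow> (g \<longlongrightarrow> a) F \<Longrightarrow> ((\<lambda>x. f (g x)) \<longlongrightarrow> f a) F"
  using clin_continuous[of f UNIV] by (simp add: continuous_on_eq_continuous_at isCont_tendsto_compose)

text \<open>A homogeneous system with more unknowns than equations, solved by Gaussian elimination.
  It later produces a combination of boundary data whose brackets with all square-summable solutions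
  tend to 0.\<close>

lemma nontrivial_relation:
  fixes m :: "'a \<Rightarrow> 'b \<Rightarrow> 'c :: field"
  assumes "finite B" "finite A" "card B < card A"
  shows "\<exists>r. (\<exists>a\<in>A. r a \<noteq> 0) \<and> (\<forall>b\<in>B. (\<Sum>a\<in>A. r a * m a b) = 0)"
  using assms
proof (induction B arbitrary: A m rule: finite_induct)
  case empty
  then have "A \<noteq> {}" by auto
  then show ?case by (intro exI[of _ "\<lambda>_. 1"]) auto
next
  case (insert b0 B)
  show ?case
  proof (cases "\<forall>a\<in>A. m a b0 = 0")
    case True
    have "card B < card A" using insert.prems insert.hyps by simp
    from insert.IH[OF insert.prems(1) this, of m]
    obtain r where "\<exists>a\<in>A. r a \<noteq> 0" "\<forall>b\<in>B. (\<Sum>a\<in>A. r a * m a b) = 0" by blast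
    moreover have "(\<Sum>a\<in>A. r a * m a b0) = 0" by (rule sum.neutral) (use True in simp)
    ultimately show ?thesis by blast
  next
    case False
    then obtain a0 where a0: "a0 \<in> A" "m a0 b0 \<noteq> 0" by auto
    define q where "q a = m a b0 / m a0 b0" for a
    have "card B < card (A - {a0})" using insert a0 by simp
    from insert.IH[OF _ this, of "\<lambda>a b. m a b - q a * m a0 b"] insert.prems(1)
    obtain r where r: "\<exists>a\<in>A - {a0}. r a \<noteq> 0"
      "\<And>b. b \<in> B \<Longrightarrow> (\<Sum>a\<in>A - {a0}. r a * (m a b - q a * m a0 b)) = 0" by blast
    \<comment> \<open>This value of the pivot unknown turns every equation into its reduced form,
      and the reduced form of equation \<open>b0\<close> is trivial.\<close>
    define r0 where "r0 = - (\<Sum>a\<in>A - {a0}. r a * q a)"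
    let ?r = "r(a0 := r0)"
    have split: "(\<Sum>a\<in>A. ?r a * m a b) = (\<Sum>a\<in>A - {a0}. r a * (m a b - q a * m a0 b))" for b
    proof -
      have "(\<Sum>a\<in>A. ?r a * m a b) = ?r a0 * m a0 b + (\<Sum>a\<in>A - {a0}. ?r a * m a b)"
        using insert.prems(1) a0(1) by (rule sum.remove)
      also have "(\<Sum>a\<in>A - {a0}. ?r a * m a b) = (\<Sum>a\<in>A - {a0}. r a * m a b)"
        by (rule sum.cong) auto
      finally show ?thesis
        by (simp add: r0_def algebra_simps sum_subtractf sum_distrib_right sum_distrib_left)
    qed
    have "(\<Sum>a\<in>A. ?r a * m a b) = 0" if "b \<in> insert b0 B" for b
    proof (cases "b = b0")
      case True
      have "q a * m a0 b0 = m a b0" for a using a0 by (simp add: q_def)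
      then show ?thesis unfolding split True by simp
    next
      case False
      then show ?thesis unfolding split using that r(2) by auto
    qed
    moreover have "\<exists>a\<in>A. ?r a \<noteq> 0" using r(1) by auto
    ultimately show ?thesis by blast
  qed
qed

text \<open>
  \<open>(P N c, Q N c)\<close> is the boundary state at \<open>N\<close> of the solution with spectral parameter \<open>\<i> s\<close> and
  initial value \<open>c\<close>, and \<open>e k c\<close> is its norm on the \<open>k\<close>-th cell; primes refer to the parameter \<open>- \<i> s\<close>.
\<close>

locale weyl_system =
  fixes s :: real
    and P Q P' Q' :: "nat \<Rightarrow> complex ^ 'p \<Rightarrow> complex ^ 'p"
    and e e' :: "nat \<Rightarrow> complex ^ 'p \<Rightarrow> real"
  assumes s: "s = 1 \<or> s = - 1"
    and lin: "clin (P N)" "clin (Q N)" "clin (P' N)" "clin (Q' N)"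
    and form: "omega (P N c) (Q N c) (P N c) (Q N c) = 2 * \<i> * s * (\<Sum>k\<in>{1..N}. (e k c)\<^sup>2)"
    and form': "omega (P' N c) (Q' N c) (P' N c) (Q' N c) = - 2 * \<i> * s * (\<Sum>k\<in>{1..N}. (e' k c)\<^sup>2)"
    and orth: "omega (P N c) (Q N c) (P' N c') (Q' N c') = 0"
    and e_nonneg: "e k c \<ge> 0"
    and e_definite: "e 1 c = 0 \<Longrightarrow> c = 0" "e' 1 c = 0 \<Longrightarrow> c = 0"
begin

definition E :: "nat \<Rightarrow> complex ^ 'p \<Rightarrow> real" where "E N c = (\<Sum>k\<in>{1..N}. (e k c)\<^sup>2)"

definition E' :: "nat \<Rightarrow> complex ^ 'p \<Rightarrow> real" where "E' N c = (\<Sum>k\<in>{1..N}. (e' k c)\<^sup>2)"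

definition solutions :: "(complex ^ 'p) set" where "solutions = {c. \<exists>C. \<forall>N. E N c \<le> C}"

lemma s_mult: "s * s = 1" "s * (s * x) = x" "\<bar>s\<bar> = 1" "s \<noteq> 0"
  using s by auto

text \<open>Green's identity makes the energy up to \<open>N\<close> a quadratic form in the state
  at \<open>N\<close>. Scaling, the parallelogram law and continuity of \<open>E\<close> are all
  read off from this.\<close>

lemma E_eq: "E N c = s * Im (hdot (P N c) (Q N c))"
proof -
  have "2 * \<i> * of_real (Im (hdot (P N c) (Q N c))) = 2 * \<i> * s * (\<Sum>k\<in>{1..N}. (e k c)\<^sup>2)"
    using form[of N c] by (simp add: omega_self)
  then have "Im (hdot (P N c) (Q N c)) = s * E N c"
    by (simp add: E_def complex_eq_iff)
  then show ?thesis by (simp add: s_mult)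
qed

lemma E'_eq: "E' N c = - s * Im (hdot (P' N c) (Q' N c))"
proof -
  have "2 * \<i> * of_real (Im (hdot (P' N c) (Q' N c))) = - 2 * \<i> * s * (\<Sum>k\<in>{1..N}. (e' k c)\<^sup>2)"
    using form'[of N c] by (simp add: omega_self)
  then have "Im (hdot (P' N c) (Q' N c)) = - s * E' N c"
    by (simp add: E'_def complex_eq_iff)
  then show ?thesis by (simp add: s_mult)
qed

lemma E_nonneg: "E N c \<ge> 0" "E' N c \<ge> 0"
  by (simp_all add: E_def E'_def sum_nonneg)

lemma E_mono: "M \<le> N \<Longrightarrow> E M c \<le> E N c"
  unfolding E_def by (rule sum_mono2) auto

lemma E_definite: "N \<ge> 1 \<Longrightarrow> E N c \<le> 0 \<Longrightarrow> c = 0" "N \<ge> 1 \<Longrightarrow> E' N c \<le> 0 \<Longrightarrow> c = 0"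
proof -
  assume N: "N \<ge> 1"
  have "(e 1 c)\<^sup>2 \<le> E N c" "(e' 1 c)\<^sup>2 \<le> E' N c"
    unfolding E_def E'_def by (rule member_le_sum; use N in auto)+
  then show "E N c \<le> 0 \<Longrightarrow> c = 0" "E' N c \<le> 0 \<Longrightarrow> c = 0"
    using e_definite[of c] by (meson order.trans power2_less_eq_zero_iff)+
qed

lemma E_scale: "E N (k *s c) = (norm k)\<^sup>2 * E N c"
proof -
  have "hdot (P N (k *s c)) (Q N (k *s c)) = of_real ((norm k)\<^sup>2) * hdot (P N c) (Q N c)"
    by (simp add: vec.linear_scale[OF lin(1)] vec.linear_scale[OF lin(2)] hdot_scale mult.assoc[symmetric]
        complex_norm_square mult.commute[of "cnj k"] del: of_real_power)
  then show ?thesis by (simp add: E_eq)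
qed

text \<open>Parallelogram law, with the nonnegative energy of the difference dropped.\<close>

lemma E_add_le: "E N (c + c') \<le> 2 * E N c + 2 * E N c'"
proof -
  have "E N (c + c') + E N (c - c') = 2 * E N c + 2 * E N c'"
    by (simp add: E_eq vec.linear_add[OF lin(1)] vec.linear_add[OF lin(2)] vec.linear_diff[OF lin(1)]
        vec.linear_diff[OF lin(2)] hdot_add hdot_diff algebra_simps)
  then show ?thesis using E_nonneg(1)[of N "c - c'"] by linarith
qed

lemma subspace_solutions: "vec.subspace solutions"
proof (rule vec.subspaceI)
  have "E N 0 = 0" for N using E_scale[of N 0 0] by simp
  then show "0 \<in> solutions" unfolding solutions_def by (intro CollectI exI[of _ 0]) simp
  show "x + y \<in> solutions" if xy: "x \<in> solutions" "y \<in> solutions" for x y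
  proof -
    obtain C D where "\<And>N. E N x \<le> C" "\<And>N. E N y \<le> D" using xy unfolding solutions_def by blast
    then have "E N (x + y) \<le> 2 * C + 2 * D" for N
      using E_add_le[of N x y] by (smt (verit))
    then show ?thesis by (auto simp: solutions_def)
  qed
  show "k *s x \<in> solutions" if x: "x \<in> solutions" for x k
  proof -
    obtain C where "\<And>N. E N x \<le> C" using x by (auto simp: solutions_def)
    then have "E N (k *s x) \<le> (norm k)\<^sup>2 * C" for N
      by (simp add: E_scale mult_left_mono)
    then show ?thesis by (auto simp: solutions_def)
  qed
qed

text \<open>The energy of the first cell attains a positive minimum on the compact unit sphere. This
  is what bounds initial values in terms of energies in the limit argument below.\<close>

lemma E_coercive: "\<exists>\<kappa>>0. \<forall>c. \<kappa> * norm c \<le> sqrt (E 1 c)"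
proof -
  have cont: "continuous_on (sphere 0 1) (E 1)"
    unfolding E_eq[abs_def]
    by (intro continuous_intros bounded_bilinear.continuous_on[OF bounded_bilinear_hdot] clin_continuous lin)
  have "sphere (0 :: complex ^ 'p) 1 \<noteq> {}" by simp
  then obtain c0 where c0: "norm c0 = 1" and min: "\<And>c. norm c = 1 \<Longrightarrow> E 1 c0 \<le> E 1 c"
    using continuous_attains_inf[OF compact_sphere _ cont] by auto
  have "E 1 c0 > 0" using E_definite(1)[of 1 c0] c0 by fastforce
  moreover have "sqrt (E 1 c0) * norm c \<le> sqrt (E 1 c)" for c
  proof (cases "c = 0")
    case False
    have "norm (of_real (1 / norm c) *s c) = 1" using False by (simp add: norm_vscale norm_divide)
    then have "E 1 c0 \<le> (1 / norm c)\<^sup>2 * E 1 c"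
      using min[of "of_real (1 / norm c) *s c"] unfolding E_scale by (simp add: norm_divide)
    then have "E 1 c0 * (norm c)\<^sup>2 \<le> E 1 c" using False by (simp add: field_simps)
    then have "sqrt (E 1 c0 * (norm c)\<^sup>2) \<le> sqrt (E 1 c)" by simp
    then show ?thesis by (simp add: real_sqrt_mult)
  qed (simp add: E_nonneg)
  ultimately show ?thesis by (intro exI[of _ "sqrt (E 1 c0)"]) simp
qed

text \<open>
  The boundary form is definite of opposite signs on the states of the two families of solutions,
  so these \<open>p\<close>-dimensional subspaces of the \<open>2 p\<close>-dimensional space of states are complementary.
\<close>

lemma state_decomposition:
  assumes "N \<ge> 1"
  shows "\<exists>c c'. a = P N c + P' N c' \<and> b = Q N c + Q' N c'"
proof -
  define \<phi> where "\<phi> x = (P N (fst x) + P' N (snd x), Q N (fst x) + Q' N (snd x))" for x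
  have "linear \<phi>"
  proof (rule linearI)
    show "\<phi> (x + y) = \<phi> x + \<phi> y" for x y
      by (simp add: \<phi>_def vec.linear_add[OF lin(1)] vec.linear_add[OF lin(2)]
          vec.linear_add[OF lin(3)] vec.linear_add[OF lin(4)])
    show "\<phi> (r *\<^sub>R x) = r *\<^sub>R \<phi> x" for r x
      by (simp add: \<phi>_def vec.linear_scale[OF lin(1)] vec.linear_scale[OF lin(2)] scaleR_eq_scale
          vec.linear_scale[OF lin(3)] vec.linear_scale[OF lin(4)] vec.scale_right_distrib)
  qed
  moreover have "inj \<phi>"
    unfolding linear_injective_0[OF \<open>linear \<phi>\<close>]
  proof (intro allI impI)
    fix x assume "\<phi> x = 0"
    then have eq: "P N (fst x) = - P' N (snd x)" "Q N (fst x) = - Q' N (snd x)"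
      by (simp_all add: \<phi>_def prod_eq_iff eq_neg_iff_add_eq_0)
    \<comment> \<open>Opposite states have the same quadratic form, but up to the sign
      \<open>s\<close> it is \<open>E\<close> for one family and minus \<open>E'\<close> for the
      other, so both energies vanish.\<close>
    have "hdot (P N (fst x)) (Q N (fst x)) = hdot (P' N (snd x)) (Q' N (snd x))"
      unfolding eq by (simp add: hdot_minus)
    then have "E N (fst x) + E' N (snd x) = 0"
      by (simp add: E_eq E'_eq)
    then have "fst x = 0" "snd x = 0"
      using E_nonneg[of N "fst x"] E_nonneg[of N "snd x"] E_definite assms
      by (smt (verit))+
    then show "x = 0" by (simp add: prod_eq_iff)
  qed
  ultimately have "surj \<phi>" by (intro linear_injective_imp_surjective refl)
  then obtain x where "(a, b) = \<phi> x" by (meson surj_def)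
  then show ?thesis by (auto simp: \<phi>_def)
qed

text \<open>\<open>incr\<close> is what Green's identity leaves of membership in the maximal domain:
  over each cell the bracket with a solution changes by at most a square-summable amount times the
  norm of the solution on the cell. \<open>pos\<close> is the positivity of the boundary form at
  infinity.\<close>

theorem dim_le_dim_solutions:
  fixes R T :: "nat \<Rightarrow> complex ^ 'p \<Rightarrow> complex ^ 'p"
  assumes S: "vec.subspace S"
    and linW: "\<And>N. clin (R N)" "\<And>N. clin (T N)"
    and incr: "\<And>c. c \<in> S \<Longrightarrow> \<exists>A. summable (\<lambda>k. (A k)\<^sup>2) \<and> (\<forall>k c'.
        norm (omega (R (Suc k) c) (T (Suc k) c) (P (Suc k) c') (Q (Suc k) c')
          - omega (R k c) (T k c) (P k c') (Q k c')) \<le> A (Suc k) * e (Suc k) c')"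
    and pos: "\<And>c. c \<in> S \<Longrightarrow> c \<noteq> 0 \<Longrightarrow>
        \<exists>L>0. \<forall>\<^sub>F N in sequentially. s * Im (hdot (R N c) (T N c)) \<ge> L"
  shows "vec.dim S \<le> vec.dim solutions"
proof (rule ccontr)
  assume less: "\<not> vec.dim S \<le> vec.dim solutions"
  define \<Omega> where "\<Omega> w N c = omega (R N w) (T N w) (P N c) (Q N c)" for w N c
  have \<Omega>_bound: "\<exists>\<tau>. (\<tau> \<longlonglongrightarrow> 0) \<and> (\<forall>M. \<tau> M \<ge> 0) \<and>
      (\<forall>M N c. M \<le> N \<longrightarrow> norm (\<Omega> w N c - \<Omega> w M c) \<le> \<tau> M * sqrt (E N c))" if w: "w \<in> S" for w
  proof -
    obtain A where A: "summable (\<lambda>k. (A k)\<^sup>2)"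
      "\<And>k c. norm (\<Omega> w (Suc k) c - \<Omega> w k c) \<le> A (Suc k) * e (Suc k) c"
      using incr[OF w] by (auto simp: \<Omega>_def)
    \<comment> \<open>The square root of the tail of the sum of squares of \<open>A\<close>. By
      Cauchy-Schwarz over the cells between \<open>M\<close> and \<open>N\<close> it bounds the
      change of the bracket uniformly in \<open>N\<close>.\<close>
    define \<tau> where "\<tau> M = sqrt (\<Sum>k. (A (k + Suc M))\<^sup>2)" for M
    have sumA: "summable (\<lambda>k. (A (k + Suc M))\<^sup>2)" for M
      by (rule summable_ignore_initial_segment[OF A(1)])
    have "\<tau> \<longlonglongrightarrow> sqrt 0"
      unfolding \<tau>_def using suminf_exist_split2[OF A(1)]
      by (intro tendsto_real_sqrt LIMSEQ_Suc[of "\<lambda>M. (\<Sum>k. (A (k + M))\<^sup>2)"]) simp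
    moreover have "norm (\<Omega> w N c - \<Omega> w M c) \<le> \<tau> M * sqrt (E N c)" if "M \<le> N" for M N c
    proof -
      have "norm (\<Omega> w N c - \<Omega> w M c) = norm (\<Sum>k\<in>{M..<N}. \<Omega> w (Suc k) c - \<Omega> w k c)"
        using that by (simp add: sum_Suc_diff'[of M N "\<lambda>k. \<Omega> w k c"])
      also have "\<dots> \<le> (\<Sum>k\<in>{M..<N}. \<bar>A (Suc k)\<bar> * \<bar>e (Suc k) c\<bar>)"
        by (intro sum_norm_le order.trans[OF A(2)]) (metis abs_ge_self abs_mult)
      also have "\<dots> \<le> L2_set (\<lambda>k. A (Suc k)) {M..<N} * L2_set (\<lambda>k. e (Suc k) c) {M..<N}"
        by (rule L2_set_mult_ineq)
      also have "\<dots> \<le> \<tau> M * sqrt (E N c)"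
      proof (rule mult_mono)
        have "(\<Sum>k\<in>{M..<N}. (A (Suc k))\<^sup>2) = (\<Sum>k<N - M. (A (k + Suc M))\<^sup>2)"
          by (rule sum.reindex_bij_witness[of _ "\<lambda>k. k + M" "\<lambda>k. k - M"]) auto
        also have "\<dots> \<le> (\<Sum>k. (A (k + Suc M))\<^sup>2)"
          by (intro sum_le_suminf sumA) auto
        finally show "L2_set (\<lambda>k. A (Suc k)) {M..<N} \<le> \<tau> M" by (simp add: L2_set_def \<tau>_def)
        have "(\<Sum>k\<in>{M..<N}. (e (Suc k) c)\<^sup>2) = (\<Sum>k\<in>{Suc M..N}. (e k c)\<^sup>2)"
          by (rule sum.reindex_bij_witness[of _ "\<lambda>k. k - 1" Suc]) auto
        also have "\<dots> \<le> E N c" unfolding E_def by (rule sum_mono2) auto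
        finally show "L2_set (\<lambda>k. e (Suc k) c) {M..<N} \<le> sqrt (E N c)" by (simp add: L2_set_def)
      qed (use suminf_nonneg[OF sumA] in \<open>simp_all add: \<tau>_def\<close>)
      finally show ?thesis .
    qed
    moreover have "\<tau> M \<ge> 0" for M
      using suminf_nonneg[OF sumA, of M] by (simp add: \<tau>_def)
    ultimately show ?thesis by auto
  qed
  have conv: "convergent (\<lambda>N. \<Omega> w N c)" if w: "w \<in> S" and c: "c \<in> solutions" for w c
  proof -
    obtain \<tau> where \<tau>: "\<tau> \<longlonglongrightarrow> 0" "\<And>M. \<tau> M \<ge> 0"
      "\<And>M N c. M \<le> N \<Longrightarrow> norm (\<Omega> w N c - \<Omega> w M c) \<le> \<tau> M * sqrt (E N c)"
      using \<Omega>_bound[OF w] by blast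
    obtain C where C: "\<And>N. E N c \<le> C" using c by (auto simp: solutions_def)
    have "(\<lambda>M. \<tau> M * sqrt C) \<longlonglongrightarrow> 0" using tendsto_mult_right[OF \<tau>(1)] by simp
    have "Cauchy (\<lambda>N. \<Omega> w N c)"
    proof (rule CauchyI')
      fix \<epsilon> :: real assume "\<epsilon> > 0"
      then obtain M0 where "\<And>M. M \<ge> M0 \<Longrightarrow> \<tau> M * sqrt C < \<epsilon>"
        using order_tendstoD(2)[OF \<open>(\<lambda>M. \<tau> M * sqrt C) \<longlonglongrightarrow> 0\<close>] by (auto simp: eventually_sequentially)
      then have "norm (\<Omega> w N c - \<Omega> w M c) < \<epsilon>" if "M0 \<le> M" "M < N" for M N
        using \<tau>(3)[of M N c] that C[of N] \<tau>(2)[of M]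
        by (smt (verit) mult_left_mono real_sqrt_le_mono less_imp_le)
      then show "\<exists>M0. \<forall>M\<ge>M0. \<forall>N>M. dist (\<Omega> w M c) (\<Omega> w N c) < \<epsilon>"
        by (metis dist_norm norm_minus_commute)
    qed
    then show ?thesis by (simp add: Cauchy_convergent_iff)
  qed
  obtain B where B: "B \<subseteq> S" "vec.independent B" "card B = vec.dim S"
    by (metis vec.basis_exists)
  obtain D where D: "D \<subseteq> solutions" "vec.independent D" "solutions \<subseteq> vec.span D"
    "card D = vec.dim solutions"
    by (metis vec.basis_exists)
  have fin: "finite B" "finite D" using B D by (auto intro: vec.finiteI_independent)
  have "card D < card B" using less B(3) D(4) by simp
  \<comment> \<open>The unknowns are indexed by a basis of \<open>S\<close>, the equations by a
    basis of the solutions; the matrix consists of the limits of the brackets.\<close>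
  from nontrivial_relation[OF fin(2,1) this, of "\<lambda>b d. lim (\<lambda>N. \<Omega> b N d)"]
  obtain r where r: "\<exists>b\<in>B. r b \<noteq> 0" "\<And>d. d \<in> D \<Longrightarrow> (\<Sum>b\<in>B. r b * lim (\<lambda>N. \<Omega> b N d)) = 0"
    by blast
  define w where "w = (\<Sum>b\<in>B. r b *s b)"
  have wS: "w \<in> S" unfolding w_def using B(1) by (intro vec.subspace_sum vec.subspace_scale S) auto
  have w0: "w \<noteq> 0"
    using vec.independentD[OF B(2) fin(1) order.refl, of r] r(1) by (auto simp: w_def)
  have "(\<lambda>N. \<Omega> w N d) \<longlonglongrightarrow> 0" if d: "d \<in> D" for d
  proof -
    have "\<Omega> w N d = (\<Sum>b\<in>B. r b * \<Omega> b N d)" for N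
      by (simp add: \<Omega>_def w_def vec.linear_sum[OF linW(1)] vec.linear_sum[OF linW(2)]
          vec.linear_scale[OF linW(1)] vec.linear_scale[OF linW(2)] omega_sum omega_scale)
    moreover have "(\<lambda>N. \<Sum>b\<in>B. r b * \<Omega> b N d) \<longlonglongrightarrow> (\<Sum>b\<in>B. r b * lim (\<lambda>N. \<Omega> b N d))"
      using conv B(1) D(1) d by (intro tendsto_intros) (auto simp: convergent_LIMSEQ_iff)
    ultimately show ?thesis using r(2)[OF d] by simp
  qed
  have lim0: "(\<lambda>N. \<Omega> w N c) \<longlonglongrightarrow> 0" if c: "c \<in> solutions" for c
  proof -
    have "c \<in> vec.span D" using c D(3) by auto
    then show ?thesis
    proof (induction rule: vec.span_induct_alt)
      case base
      show ?case by (simp add: \<Omega>_def omega_def vec.linear_0[OF lin(1)] vec.linear_0[OF lin(2)])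
    next
      case (step k x y)
      have "\<Omega> w N (k *s x + y) = cnj k * \<Omega> w N x + \<Omega> w N y" for N
        by (simp add: \<Omega>_def vec.linear_add[OF lin(1)] vec.linear_add[OF lin(2)]
            vec.linear_scale[OF lin(1)] vec.linear_scale[OF lin(2)] omega_scale omega_add)
      moreover have "(\<lambda>N. cnj k * \<Omega> w N x + \<Omega> w N y) \<longlonglongrightarrow> cnj k * 0 + 0"
        using step \<open>\<And>d. d \<in> D \<Longrightarrow> (\<lambda>N. \<Omega> w N d) \<longlonglongrightarrow> 0\<close> by (intro tendsto_intros) auto
      ultimately show ?case by simp
    qed
  qed
  obtain \<tau> where \<tau>: "\<tau> \<longlonglongrightarrow> 0" "\<And>M. \<tau> M \<ge> 0"
    "\<And>M N c. M \<le> N \<Longrightarrow> norm (\<Omega> w N c - \<Omega> w M c) \<le> \<tau> M * sqrt (E N c)"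
    using \<Omega>_bound[OF wS] by blast
  obtain L N0 where L: "L > 0" and N0: "\<And>N. N \<ge> N0 \<Longrightarrow> s * Im (hdot (R N w) (T N w)) \<ge> L"
    using pos[OF wS w0] by (auto simp: eventually_sequentially)
  have "\<forall>N. \<exists>c c'. N \<ge> 1 \<longrightarrow> R N w = P N c + P' N c' \<and> T N w = Q N c + Q' N c'"
    using state_decomposition by blast
  then obtain c c' where dec: "\<And>N. N \<ge> 1 \<Longrightarrow> R N w = P N (c N) + P' N (c' N)"
      "\<And>N. N \<ge> 1 \<Longrightarrow> T N w = Q N (c N) + Q' N (c' N)"
    by metis
  have orth': "omega (P' N x') (Q' N x') (P N x) (Q N x) = 0" for N x x'
    using orth[of N x x'] by (subst omega_commute) simp
  \<comment> \<open>The component in the other family is orthogonal to \<open>c N\<close>, so only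
    the first component contributes.\<close>
  have \<Omega>c: "norm (\<Omega> w N (c N)) = 2 * E N (c N)" if "N \<ge> 1" for N
  proof -
    have "\<Omega> w N (c N) = 2 * \<i> * s * E N (c N)"
      unfolding \<Omega>_def dec[OF that] omega_add orth' form E_def by simp
    then show ?thesis using E_nonneg(1)[of N "c N"] s_mult(3) by (simp add: norm_mult)
  qed
  \<comment> \<open>The boundary form of the state is the difference of the two energies, so its
    positivity keeps the first one away from 0.\<close>
  have EL: "L \<le> E N (c N)" if "N \<ge> 1" "N \<ge> N0" for N
  proof -
    have "omega (R N w) (T N w) (R N w) (T N w) = 2 * \<i> * s * (E N (c N) - E' N (c' N))"
      unfolding dec[OF that(1)] omega_add orth orth' form form' E_def E'_def by (simp add: algebra_simps)
    then have "Im (hdot (R N w) (T N w)) = s * (E N (c N) - E' N (c' N))"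
      unfolding omega_self by (simp add: complex_eq_iff)
    then have "s * Im (hdot (R N w) (T N w)) = E N (c N) - E' N (c' N)" by (simp add: s_mult)
    then show ?thesis using N0[OF that(2)] E_nonneg(2)[of N "c' N"] by linarith
  qed
  obtain \<kappa> where \<kappa>: "\<kappa> > 0" "\<And>c. \<kappa> * norm c \<le> sqrt (E 1 c)" using E_coercive by auto
  have "linear (P 1)" "linear (Q 1)" using lin by (auto intro: clin_imp_linear)
  then obtain p q where pq: "\<And>x. norm (P 1 x) \<le> norm x * p" "\<And>x. norm (Q 1 x) \<le> norm x * q" "p > 0" "q > 0"
    by (metis bounded_linear.pos_bounded linear_conv_bounded_linear)
  \<comment> \<open>Here \<open>p\<close> and \<open>q\<close> bound the maps \<open>P 1\<close> and
    \<open>Q 1\<close>, and \<kappa> converts the norm of the initial value into an energy.\<close>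
  define K where "K = (norm (R 1 w) + norm (T 1 w)) * (p + q) / \<kappa>"
  have "K \<ge> 0" using pq \<kappa> by (simp add: K_def)
  have \<Omega>1: "norm (\<Omega> w 1 x) \<le> K * sqrt (E N x)" if "N \<ge> 1" for x N
  proof -
    have "norm (\<Omega> w 1 x) \<le> (norm (R 1 w) + norm (T 1 w)) * (norm (P 1 x) + norm (Q 1 x))"
      unfolding \<Omega>_def by (rule norm_omega_le)
    also have "\<dots> \<le> (norm (R 1 w) + norm (T 1 w)) * ((p + q) * norm x)"
      using pq(1,2)[of x] by (intro mult_left_mono) (simp_all add: algebra_simps)
    also have "\<dots> = K * (\<kappa> * norm x)" using \<kappa> by (simp add: K_def)
    also have "\<kappa> * norm x \<le> sqrt (E N x)"
      using \<kappa>(2)[of x] E_mono[OF that, of x] by (meson order.trans real_sqrt_le_mono)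
    finally show ?thesis using \<open>K \<ge> 0\<close> by (simp add: mult_left_mono)
  qed
  \<comment> \<open>With x the square root of the energy of \<open>c N\<close>, the bracket
    satisfies 2 x x \<le> (\<open>K\<close> + \<open>\<tau> 1\<close>) x; dividing by x gives
    \<open>C\<close>.\<close>
  define C where "C = (K + \<tau> 1) / 2"
  have sqrtE: "sqrt (E N (c N)) \<le> C" if "N \<ge> 1" for N
  proof (cases "sqrt (E N (c N)) = 0")
    case True
    then show ?thesis using \<open>K \<ge> 0\<close> \<tau>(2)[of 1] by (simp add: C_def)
  next
    case False
    define x where "x = sqrt (E N (c N))"
    have x: "x > 0" "E N (c N) = x * x" using False E_nonneg(1)[of N "c N"] by (auto simp: x_def)
    have "2 * (x * x) \<le> norm (\<Omega> w 1 (c N)) + norm (\<Omega> w N (c N) - \<Omega> w 1 (c N))"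
      using \<Omega>c[OF that] norm_triangle_sub[of "\<Omega> w N (c N)" "\<Omega> w 1 (c N)"] x by simp
    also have "\<dots> \<le> K * x + \<tau> 1 * x"
      using \<Omega>1[OF that, of "c N"] \<tau>(3)[OF that, of "c N"] by (simp add: x_def)
    finally have "(2 * x) * x \<le> (K + \<tau> 1) * x" by (simp only: distrib_right mult.assoc)
    then have "2 * x \<le> K + \<tau> 1" using x(1) by (rule mult_right_le_imp_le)
    then show ?thesis by (simp add: C_def x_def)
  qed
  have E_le: "E M (c N) \<le> C\<^sup>2" if "M \<le> N" "N \<ge> 1" for M N
    using sqrtE[OF that(2)] E_mono[OF that(1), of "c N"] E_nonneg(1)[of N "c N"]
    by (metis order.trans real_sqrt_ge_zero real_sqrt_pow2 power_mono)
  have "norm (c (Suc n)) \<le> C / \<kappa>" for n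
    using \<kappa>(2)[of "c (Suc n)"] sqrtE[of "Suc n"] E_mono[of 1 "Suc n" "c (Suc n)"] \<kappa>(1)
    by (simp add: field_simps) (meson order.trans real_sqrt_le_mono)
  then have "bounded (range (\<lambda>n. c (Suc n)))" by (auto simp: bounded_iff)
  then obtain c0 \<phi> where \<phi>: "strict_mono \<phi>" and lim_c: "((\<lambda>n. c (Suc n)) \<circ> \<phi>) \<longlonglongrightarrow> c0"
    using bounded_imp_convergent_subsequence by blast
  \<comment> \<open>Shifted by one because the decomposition is available only from
    \<open>N = 1\<close> on.\<close>
  define \<psi> where "\<psi> n = Suc (\<phi> n)" for n
  have lim_c: "(\<lambda>n. c (\<psi> n)) \<longlonglongrightarrow> c0" using lim_c by (simp add: \<psi>_def o_def)
  have \<psi>: "\<psi> n \<ge> n" "\<psi> n \<ge> 1" for n using strict_mono_imp_increasing[OF \<phi>, of n] by (auto simp: \<psi>_def)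
  have limPQ: "(\<lambda>n. P M (c (\<psi> n))) \<longlonglongrightarrow> P M c0" "(\<lambda>n. Q M (c (\<psi> n))) \<longlonglongrightarrow> Q M c0" for M
    by (rule clin_tendsto[OF lin(1) lim_c], rule clin_tendsto[OF lin(2) lim_c])
  have "E M c0 \<le> C\<^sup>2" for M
  proof (rule LIMSEQ_le_const2)
    show "(\<lambda>n. E M (c (\<psi> n))) \<longlonglongrightarrow> E M c0"
      unfolding E_eq by (intro tendsto_intros tendsto_hdot limPQ)
    show "\<exists>n0. \<forall>n\<ge>n0. E M (c (\<psi> n)) \<le> C\<^sup>2"
      using E_le \<psi> by (intro exI[of _ M]) (meson order.trans)
  qed
  then have "c0 \<in> solutions" by (auto simp: solutions_def)
  \<comment> \<open>For fixed \<open>M\<close> the lower bound at the moving index is carried back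
    to \<open>M\<close> at the price \<open>\<tau> M * C\<close> and survives the passage to the
    limit point. Letting \<open>M\<close> grow then contradicts \<open>lim0\<close>.\<close>
  have "2 * L \<le> norm (\<Omega> w M c0) + \<tau> M * C" for M
  proof (rule LIMSEQ_le_const)
    show "(\<lambda>n. norm (\<Omega> w M (c (\<psi> n))) + \<tau> M * C) \<longlonglongrightarrow> norm (\<Omega> w M c0) + \<tau> M * C"
      unfolding \<Omega>_def by (intro tendsto_intros tendsto_omega limPQ)
    have "2 * L \<le> norm (\<Omega> w M (c (\<psi> n))) + \<tau> M * C" if n: "n \<ge> M + N0" for n
    proof -
      have "M \<le> \<psi> n" "N0 \<le> \<psi> n" using \<psi>(1)[of n] n by auto
      have "2 * L \<le> norm (\<Omega> w (\<psi> n) (c (\<psi> n)))"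
        using \<Omega>c[OF \<psi>(2)] EL[OF \<psi>(2) \<open>N0 \<le> \<psi> n\<close>] by simp
      also have "\<dots> \<le> norm (\<Omega> w M (c (\<psi> n))) + \<tau> M * sqrt (E (\<psi> n) (c (\<psi> n)))"
        using \<tau>(3)[OF \<open>M \<le> \<psi> n\<close>, of "c (\<psi> n)"]
          norm_triangle_sub[of "\<Omega> w (\<psi> n) (c (\<psi> n))" "\<Omega> w M (c (\<psi> n))"] by simp
      also have "\<dots> \<le> norm (\<Omega> w M (c (\<psi> n))) + \<tau> M * C"
        using sqrtE[OF \<psi>(2)] \<tau>(2) by (simp add: mult_left_mono)
      finally show ?thesis .
    qed
    then show "\<exists>n0. \<forall>n\<ge>n0. 2 * L \<le> norm (\<Omega> w M (c (\<psi> n))) + \<tau> M * C" by blast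
  qed
  moreover have "(\<lambda>M. norm (\<Omega> w M c0) + \<tau> M * C) \<longlonglongrightarrow> norm (0 :: complex) + 0 * C"
    by (intro tendsto_intros lim0 \<open>c0 \<in> solutions\<close> \<tau>)
  ultimately have "2 * L \<le> 0"
    using LIMSEQ_le_const[of "\<lambda>M. norm (\<Omega> w M c0) + \<tau> M * C" 0 "2 * L"] by simp
  then show False using L by simp
qed

end

subsection \<open>Block Jacobi operators\<close>

text \<open>Index 0 is a ghost site: with \<open>u 0 = 0\<close> the first row loses its left
  neighbour, whatever the value of \<open>\<beta> 0\<close>, and one formula serves all
  rows.\<close>

definition jac_apply ::
    "(nat \<Rightarrow> complex ^ 'p ^ 'p) \<Rightarrow> (nat \<Rightarrow> real) \<Rightarrow> (nat \<Rightarrow> complex ^ 'p) \<Rightarrow> nat \<Rightarrow> complex ^ 'p" where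
  "jac_apply a \<beta> u m = \<beta> (m - 1) *\<^sub>R u (m - 1) + a m *v u m + \<beta> m *\<^sub>R u (Suc m)"

fun jac_sol ::
    "(nat \<Rightarrow> complex ^ 'p ^ 'p) \<Rightarrow> (nat \<Rightarrow> real) \<Rightarrow> complex \<Rightarrow> complex ^ 'p \<Rightarrow> nat \<Rightarrow> complex ^ 'p" where
  "jac_sol a \<beta> z c 0 = 0"
| "jac_sol a \<beta> z c (Suc 0) = c"
| "jac_sol a \<beta> z c (Suc (Suc n)) = (1 / \<beta> (Suc n)) *\<^sub>R
     (z *s jac_sol a \<beta> z c (Suc n) - a (Suc n) *v jac_sol a \<beta> z c (Suc n) - \<beta> n *\<^sub>R jac_sol a \<beta> z c n)"

lemma clin_jac_sol: "clin (\<lambda>c. jac_sol a \<beta> z c n)"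
  by (induction n rule: induct_nat_012) (auto intro!: clin_intros)

lemma scaled_identity_mult: "(r *\<^sub>R mat 1) *v x = r *\<^sub>R (x :: complex ^ 'p)"
proof -
  have "(\<Sum>j\<in>UNIV. (r *\<^sub>R (if i = j then 1 else 0 :: complex)) * x $ j) = r *\<^sub>R x $ i" for i
    by (subst sum.mono_neutral_right[of UNIV "{i}"]) auto
  then show ?thesis by (simp add: vec_eq_iff matrix_vector_mult_def mat_def)
qed

lemma L2_pos_nats: "u \<in> L2 pos_nats \<longleftrightarrow> (\<exists>C. \<forall>N. (\<Sum>n\<in>{1..N}. (norm (u n))\<^sup>2) \<le> C)"
proof -
  define f where "f n = (if n \<in> {1..} then norm ((norm (u n))\<^sup>2) else 0)" for n
  have sum_f: "(\<Sum>n\<in>{1..N}. (norm (u n))\<^sup>2) = (\<Sum>n<Suc N. f n)" for N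
  proof -
    have "(\<Sum>n\<in>{1..N}. (norm (u n))\<^sup>2) = (\<Sum>n\<in>{1..N}. f n)"
      by (rule sum.cong) (auto simp: f_def)
    also have "\<dots> = (\<Sum>n<Suc N. f n)"
      by (rule sum.mono_neutral_left) (auto simp: f_def)
    finally show ?thesis .
  qed
  have "u \<in> L2 pos_nats \<longleftrightarrow> summable f"
    unfolding L2_def f_def abs_summable_on_nat_iff[symmetric] by (simp add: abs_summable_on_def)
  also have "\<dots> \<longleftrightarrow> (\<exists>C. \<forall>N. (\<Sum>n<Suc N. f n) \<le> C)"
  proof
    assume "summable f"
    then have "(\<Sum>n<Suc N. f n) \<le> suminf f" for N
      by (rule sum_le_suminf) (auto simp: f_def)
    then show "\<exists>C. \<forall>N. (\<Sum>n<Suc N. f n) \<le> C" by blast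
  next
    assume "\<exists>C. \<forall>N. (\<Sum>n<Suc N. f n) \<le> C"
    then obtain C where C: "\<And>N. (\<Sum>n<Suc N. f n) \<le> C" by blast
    have "(\<Sum>n<N. f n) \<le> C" for N
      using C[of N] by (rule order.trans[rotated]) (simp add: f_def)
    then show "summable f"
      by (intro summableI_nonneg_bounded[of f C]) (auto simp: f_def)
  qed
  finally show ?thesis unfolding sum_f .
qed

lemma L2_pos_nats_finite: "finite {n. 1 \<le> n \<and> u n \<noteq> 0} \<Longrightarrow> u \<in> L2 pos_nats"
proof -
  assume fin: "finite {n. 1 \<le> n \<and> u n \<noteq> 0}"
  have "(\<Sum>n\<in>{1..N}. (norm (u n))\<^sup>2) \<le> (\<Sum>n | 1 \<le> n \<and> u n \<noteq> 0. (norm (u n))\<^sup>2)" for N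
  proof -
    have "(\<Sum>n\<in>{1..N}. (norm (u n))\<^sup>2) = (\<Sum>n\<in>{n\<in>{1..N}. u n \<noteq> 0}. (norm (u n))\<^sup>2)"
      by (rule sum.mono_neutral_right) auto
    also have "\<dots> \<le> (\<Sum>n | 1 \<le> n \<and> u n \<noteq> 0. (norm (u n))\<^sup>2)"
      by (rule sum_mono2) (use fin in auto)
    finally show ?thesis .
  qed
  then show ?thesis unfolding L2_pos_nats by blast
qed

lemma sum_strides:
  fixes f :: "nat \<Rightarrow> 'a :: comm_monoid_add"
  shows "(\<Sum>k\<in>{1..N}. \<Sum>n\<in>{r * (k - 1) + 1..r * k}. f n) = (\<Sum>n\<in>{1..r * N}. f n)"
proof (induction N)
  case (Suc N)
  have "{1..r * Suc N} = {1..r * N} \<union> {r * N + 1..r * Suc N}" by auto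
  moreover have "{1..r * N} \<inter> {r * N + 1..r * Suc N} = {}" by auto
  ultimately have "(\<Sum>n\<in>{1..r * Suc N}. f n)
      = (\<Sum>n\<in>{1..r * N}. f n) + (\<Sum>n\<in>{r * N + 1..r * Suc N}. f n)"
    by (metis finite_atLeastAtMost sum.union_disjoint)
  then show ?case using Suc by simp
qed simp

locale jacobi =
  fixes a :: "nat \<Rightarrow> complex ^ 'p ^ 'p" and \<beta> :: "nat \<Rightarrow> real"
  assumes hermitian: "n \<ge> 1 \<Longrightarrow> a n = map_matrix cnj (transpose (a n))"
    and \<beta>_nz: "n \<ge> 1 \<Longrightarrow> \<beta> n \<noteq> 0"
begin

abbreviation "J \<equiv> block_jacobi a (\<lambda>n. \<beta> n *\<^sub>R mat 1)"

abbreviation "sol \<equiv> jac_sol a \<beta>"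

text \<open>The minus sign makes \<open>- (\<beta> n *\<^sub>R w (Suc n))\<close> play the role of
  the slope: the increments of the bracket get the same sign as in Green's identity for the operator
  - f''.\<close>

abbreviation "wronskian w y n \<equiv>
  omega (w n) (- (\<beta> n *\<^sub>R w (Suc n))) (y n) (- (\<beta> n *\<^sub>R y (Suc n)))"

lemma jac_apply_sol: "m \<ge> 1 \<Longrightarrow> jac_apply a \<beta> (sol z c) m = z *s sol z c m"
  using \<beta>_nz[of m] by (cases m) (auto simp: jac_apply_def)

lemma sol_unique:
  assumes "u 0 = 0" "\<And>m. m \<ge> 1 \<Longrightarrow> jac_apply a \<beta> u m = z *s u m"
  shows "u n = sol z (u 1) n"
proof (induction n rule: induct_nat_012)
  case (ge2 n)
  have "\<beta> (Suc n) *\<^sub>R u (Suc (Suc n)) = z *s u (Suc n) - a (Suc n) *v u (Suc n) - \<beta> n *\<^sub>R u n"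
    using assms(2)[of "Suc n"] by (simp add: jac_apply_def algebra_simps)
  then have "(1 / \<beta> (Suc n)) *\<^sub>R (\<beta> (Suc n) *\<^sub>R u (Suc (Suc n)))
      = (1 / \<beta> (Suc n)) *\<^sub>R (z *s u (Suc n) - a (Suc n) *v u (Suc n) - \<beta> n *\<^sub>R u n)"
    by simp
  then show ?case using \<beta>_nz[of "Suc n"] ge2 by simp
qed (use assms in auto)

lemma wronskian_Suc:
  "wronskian w y (Suc n) - wronskian w y n
    = hdot (jac_apply a \<beta> w (Suc n)) (y (Suc n)) - hdot (w (Suc n)) (jac_apply a \<beta> y (Suc n))"
proof -
  have "hdot (a (Suc n) *v w (Suc n)) (y (Suc n)) = hdot (w (Suc n)) (a (Suc n) *v y (Suc n))"
    by (rule hdot_matrix[OF hermitian]) simp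
  then show ?thesis
    by (simp add: omega_def jac_apply_def hdot_add hdot_scaleR hdot_minus algebra_simps)
qed

lemma wronskian_sum:
  assumes "w 0 = 0" "y 0 = 0"
  shows "wronskian w y N
    = (\<Sum>n\<in>{1..N}. hdot (jac_apply a \<beta> w n) (y n) - hdot (w n) (jac_apply a \<beta> y n))"
proof (induction N)
  case 0
  then show ?case using assms by (simp add: omega_def)
next
  case (Suc N)
  show ?case using Suc wronskian_Suc[of w N y] by (simp add: algebra_simps)
qed

text \<open>The factor vanishes when \<zeta> is the conjugate of \<open>z\<close>, which is the
  orthogonality of the two families, and it is twice the imaginary unit times the imaginary part of
  \<open>z\<close> when \<zeta> = \<open>z\<close>, which is the energy identity.\<close>

lemma wronskian_sol:
  "wronskian (sol z c) (sol \<zeta> c') N = (z - cnj \<zeta>) * (\<Sum>n\<in>{1..N}. hdot (sol z c n) (sol \<zeta> c' n))"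
  unfolding wronskian_sum[of "sol z c" "sol \<zeta> c'", OF jac_sol.simps(1) jac_sol.simps(1)] sum_distrib_left
  by (rule sum.cong) (simp_all add: jac_apply_sol hdot_scale algebra_simps)

text \<open>Index 0 lies outside the space of \<open>pos_nats\<close>, where values are arbitrary;
  the update at 0 restores the ghost value that \<open>jac_apply\<close> expects.\<close>

lemma block_jacobi_row:
  assumes fin: "finite {n. 1 \<le> n \<and> u n \<noteq> 0}" and m: "m \<ge> 1"
  shows "(\<Sum>n | 1 \<le> n \<and> u n \<noteq> 0. J m n *v u n) = jac_apply a \<beta> (u(0 := 0)) m"
proof -
  let ?u = "u(0 := 0)"
  let ?B = "{m - 1, m, Suc m}"
  have 0: "J m n = 0" if "n \<notin> ?B" for n
    using that m by (auto simp: block_jacobi_def)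
  have "(\<Sum>n | 1 \<le> n \<and> u n \<noteq> 0. J m n *v u n) = (\<Sum>n | 1 \<le> n \<and> u n \<noteq> 0. J m n *v ?u n)"
    by (rule sum.cong) auto
  also have "\<dots> = (\<Sum>n\<in>{n. 1 \<le> n \<and> u n \<noteq> 0} \<union> ?B. J m n *v ?u n)"
    by (rule sum.mono_neutral_left) (use fin in auto)
  also have "\<dots> = (\<Sum>n\<in>?B. J m n *v ?u n)"
    by (rule sum.mono_neutral_right) (use fin 0 in auto)
  also have "\<dots> = J m (m - 1) *v ?u (m - 1) + (J m m *v ?u m + J m (Suc m) *v ?u (Suc m))"
    using m by (cases m) simp_all
  also have "\<dots> = jac_apply a \<beta> ?u m"
    using m by (auto simp: block_jacobi_def jac_apply_def scaled_identity_mult)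
  finally show ?thesis .
qed

abbreviation "minimal_graph \<equiv>
  {(u, v). finite {n. 1 \<le> n \<and> u n \<noteq> 0} \<and> v \<in> L2 pos_nats \<and>
     (\<forall>m\<ge>1. v m = (\<Sum>n | 1 \<le> n \<and> u n \<noteq> 0. J m n *v u n))}"

lemma L2_inner_finite:
  assumes "\<And>n. n > N \<Longrightarrow> f n = 0"
  shows "L2_inner pos_nats f u = (\<Sum>n\<in>{1..N}. hdot (f n) (u n))"
proof -
  have fin: "finite {n \<in> {1..}. hdot (f n) (u n) \<noteq> 0}"
    by (rule finite_subset[of _ "{..N}"]) (use assms in \<open>auto simp: not_less[symmetric]\<close>)
  have "L2_inner pos_nats f u = (\<Sum>n | n \<in> {1..} \<and> hdot (f n) (u n) \<noteq> 0. hdot (f n) (u n))"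
    unfolding L2_inner_hdot by (rule lebesgue_integral_count_space_finite_support[OF fin])
  also have "\<dots> = (\<Sum>n\<in>{1..N}. hdot (f n) (u n))"
    by (rule sum.mono_neutral_left) (use assms in \<open>auto simp: not_less[symmetric]\<close>)
  finally show ?thesis .
qed

text \<open>Summation by parts. The bracket at \<open>Suc N\<close> vanishes with \<open>f\<close>;
  the range goes one past \<open>N\<close> because a row reaches one site beyond the
  support.\<close>

lemma minimal_graph_inner:
  assumes fg: "(f, g) \<in> minimal_graph" and f: "\<And>n. n > N \<Longrightarrow> f n = 0"
  shows "L2_inner pos_nats g u = (\<Sum>n\<in>{1..Suc N}. hdot (f n) (jac_apply a \<beta> (u(0 := 0)) n))"
proof -
  have g: "g m = jac_apply a \<beta> (f(0 := 0)) m" if "m \<ge> 1" for m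
    using fg block_jacobi_row[OF _ that, of f] that by simp
  have "g n = 0" if "n > Suc N" for n
    using that f by (simp add: g jac_apply_def)
  then have "L2_inner pos_nats g u = (\<Sum>n\<in>{1..Suc N}. hdot (g n) (u n))"
    by (rule L2_inner_finite)
  also have "\<dots> = (\<Sum>n\<in>{1..Suc N}. hdot (jac_apply a \<beta> (f(0 := 0)) n) ((u(0 := 0)) n))"
    by (rule sum.cong) (auto simp: g)
  also have "\<dots> = (\<Sum>n\<in>{1..Suc N}. hdot ((f(0 := 0)) n) (jac_apply a \<beta> (u(0 := 0)) n))"
    using wronskian_sum[of "f(0 := 0)" "u(0 := 0)" "Suc N"] f[of "Suc N"] f[of "Suc (Suc N)"]
    by (simp add: sum_subtractf omega_def del: sum.cl_ivl_Suc)
  also have "\<dots> = (\<Sum>n\<in>{1..Suc N}. hdot (f n) (jac_apply a \<beta> (u(0 := 0)) n))"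
    by (rule sum.cong) auto
  finally show ?thesis .
qed

lemma minimal_graph_subset: "minimal_graph \<subseteq> L2 pos_nats \<times> L2 pos_nats"
  using L2_pos_nats_finite by blast

text \<open>Testing the adjoint relation with a coordinate vector at site \<open>m\<close> yields
  row \<open>m\<close> of the recurrence, and the rows determine \<open>u\<close> from its first
  entry. The converse is summation by parts.\<close>

lemma eigenspace_adjoint:
  "op_eigenspace (op_adjoint pos_nats (minimal_op J)) z
    = {u \<in> L2 pos_nats. \<exists>c. AE n in pos_nats. u n = sol z c n}" (is "?E = ?S")
proof -
  have adj: "op_adjoint pos_nats (minimal_op J) = op_adjoint pos_nats minimal_graph"
    unfolding minimal_op_def by (rule op_adjoint_closure[OF minimal_graph_subset])
  have "u \<in> ?S" if "u \<in> ?E" for u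
  proof -
    have u: "u \<in> L2 pos_nats"
      and inner: "\<And>f g. (f, g) \<in> minimal_graph \<Longrightarrow>
        L2_inner pos_nats g u = L2_inner pos_nats f (\<lambda>n. z *s u n)"
      using that unfolding adj unfolding op_eigenspace_def op_adjoint_def by auto
    have rec: "jac_apply a \<beta> (u(0 := 0)) m = z *s u m" if m: "m \<ge> 1" for m
    proof -
      have "jac_apply a \<beta> (u(0 := 0)) m $ i = (z *s u m) $ i" for i
      proof -
        define f :: "nat \<Rightarrow> complex ^ 'p" where "f n = (if n = m then axis i 1 else 0)" for n
        define g where "g = jac_apply a \<beta> (f(0 := 0))"
        have fin: "finite {n. 1 \<le> n \<and> f n \<noteq> 0}"
          by (rule finite_subset[of _ "{m}"]) (auto simp: f_def)
        have "g n = 0" if "n > Suc m" for n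
          using that by (auto simp: g_def jac_apply_def f_def)
        then have "{n. 1 \<le> n \<and> g n \<noteq> 0} \<subseteq> {..Suc m}"
          by (auto simp: not_less[symmetric])
        then have "g \<in> L2 pos_nats"
          by (intro L2_pos_nats_finite) (rule finite_subset, auto)
        then have fg: "(f, g) \<in> minimal_graph"
          using fin block_jacobi_row[OF fin] by (simp add: g_def)
        have f0: "f n = 0" if "n > m" for n using that by (simp add: f_def)
        have eq: "(\<Sum>n\<in>{1..Suc m}. hdot (f n) (v n)) = cnj (v m $ i)" for v
        proof -
          have "(\<Sum>n\<in>{1..Suc m}. hdot (f n) (v n)) = (\<Sum>n\<in>{m}. hdot (f n) (v n))"
            by (rule sum.mono_neutral_right) (use m in \<open>auto simp: f_def\<close>)
          then show ?thesis by (simp add: f_def hdot_axis)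
        qed
        have "cnj (jac_apply a \<beta> (u(0 := 0)) m $ i) = L2_inner pos_nats g u"
          by (simp only: minimal_graph_inner[OF fg f0] eq)
        also have "\<dots> = L2_inner pos_nats f (\<lambda>n. z *s u n)" by (rule inner[OF fg])
        also have "\<dots> = (\<Sum>n\<in>{1..Suc m}. hdot (f n) (z *s u n))"
          by (rule L2_inner_finite) (simp add: f0)
        also have "\<dots> = cnj ((z *s u m) $ i)" by (rule eq)
        finally show ?thesis by (simp only: complex_cnj_cancel_iff)
      qed
      then show ?thesis by (simp add: vec_eq_iff)
    qed
    have "(u(0 := 0)) n = sol z ((u(0 := 0)) 1) n" for n
    proof (rule sol_unique)
      show "(u(0 := 0)) 0 = 0" by simp
      show "jac_apply a \<beta> (u(0 := 0)) m = z *s (u(0 := 0)) m" if "m \<ge> 1" for m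
        using that by (subst rec) auto
    qed
    then have "AE n in pos_nats. u n = sol z (u 1) n"
      unfolding AE_count_space by (metis atLeast_iff fun_upd_other not_one_le_zero zero_neq_one)
    then show ?thesis using u by blast
  qed
  moreover have "u \<in> ?E" if uS: "u \<in> ?S" for u
  proof -
    obtain c where u: "u \<in> L2 pos_nats" and c: "\<And>n. n \<ge> 1 \<Longrightarrow> u n = sol z c n"
      using uS by (auto simp: AE_count_space)
    have eq: "u(0 := 0) = sol z c" using c by (auto simp: fun_eq_iff)
    have "L2_inner pos_nats g u = L2_inner pos_nats f (\<lambda>n. z *s u n)" if fg: "(f, g) \<in> minimal_graph" for f g
    proof -
      have "finite {n. 1 \<le> n \<and> f n \<noteq> 0}" using fg by auto
      then obtain N where N': "\<And>n. 1 \<le> n \<Longrightarrow> f n \<noteq> 0 \<Longrightarrow> n \<le> N"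
        by (auto simp: finite_nat_set_iff_bounded_le)
      have N: "f n = 0" if "n > N" for n using N'[of n] that by linarith
      have "L2_inner pos_nats f (\<lambda>n. z *s u n) = (\<Sum>n\<in>{1..Suc N}. hdot (f n) (z *s u n))"
        by (rule L2_inner_finite) (simp add: N)
      also have "\<dots> = (\<Sum>n\<in>{1..Suc N}. hdot (f n) (jac_apply a \<beta> (sol z c) n))"
        by (rule sum.cong) (simp_all add: jac_apply_sol c)
      also have "\<dots> = L2_inner pos_nats g u"
        unfolding eq[symmetric] by (rule minimal_graph_inner[OF fg, symmetric]) (rule N)
      finally show ?thesis by (rule sym)
    qed
    then show ?thesis
      unfolding adj unfolding op_eigenspace_def op_adjoint_def using u L2_scale[OF u, of z] by auto
  qed
  ultimately show ?thesis by blast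
qed

lemma L2_dim_eigenspace:
  "L2_dim pos_nats (op_eigenspace (op_adjoint pos_nats (minimal_op J)) z)
    = enat (vec.dim {c. sol z c \<in> L2 pos_nats})"
proof (rule L2_dim_solutions[OF clin_jac_sol _ _ eigenspace_adjoint])
  show "c = 0" if "AE n in pos_nats. sol z c n = 0" for c
    using that by (auto simp: AE_count_space dest!: bspec[of _ _ 1])
qed simp

text \<open>For the first Jacobi matrix two rows belong to one interval, so it is used with stride \<open>r = 2\<close>.\<close>

definition cell_norm :: "nat \<Rightarrow> complex \<Rightarrow> nat \<Rightarrow> complex ^ 'p \<Rightarrow> real" where
  "cell_norm r z k c = L2_set (\<lambda>n. norm (sol z c n)) {r * (k - 1) + 1..r * k}"

lemma sum_cell_norm: "(\<Sum>k\<in>{1..N}. (cell_norm r z k c)\<^sup>2) = (\<Sum>n\<in>{1..r * N}. (norm (sol z c n))\<^sup>2)"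
  by (subst sum_strides[symmetric]) (simp add: cell_norm_def L2_set_def sum_nonneg)

lemma weyl:
  fixes s :: real
  assumes "s = 1 \<or> s = - 1" and r: "r \<ge> 1"
  shows "weyl_system s
    (\<lambda>N c. sol (\<i> * s) c (r * N)) (\<lambda>N c. - (\<beta> (r * N) *\<^sub>R sol (\<i> * s) c (Suc (r * N))))
    (\<lambda>N c. sol (- \<i> * s) c (r * N)) (\<lambda>N c. - (\<beta> (r * N) *\<^sub>R sol (- \<i> * s) c (Suc (r * N))))
    (cell_norm r (\<i> * s)) (cell_norm r (- \<i> * s))"
proof (rule weyl_system.intro)
  show "s = 1 \<or> s = - 1" by fact
  show "clin (\<lambda>c. sol (\<i> * s) c (r * N))" "clin (\<lambda>c. - (\<beta> (r * N) *\<^sub>R sol (\<i> * s) c (Suc (r * N))))"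
    "clin (\<lambda>c. sol (- \<i> * s) c (r * N))" "clin (\<lambda>c. - (\<beta> (r * N) *\<^sub>R sol (- \<i> * s) c (Suc (r * N))))" for N
    by (intro clin_intros clin_jac_sol)+
  have self: "(\<Sum>n\<in>{1..r * N}. hdot (sol z c n) (sol z c n)) = of_real (\<Sum>k\<in>{1..N}. (cell_norm r z k c)\<^sup>2)"
    for z c N unfolding sum_cell_norm by (simp add: hdot_self)
  show "wronskian (sol (\<i> * s) c) (sol (\<i> * s) c) (r * N)
      = 2 * \<i> * s * (\<Sum>k\<in>{1..N}. (cell_norm r (\<i> * s) k c)\<^sup>2)" for N c
    unfolding wronskian_sol self by simp
  show "wronskian (sol (- \<i> * s) c) (sol (- \<i> * s) c) (r * N)
      = - 2 * \<i> * s * (\<Sum>k\<in>{1..N}. (cell_norm r (- \<i> * s) k c)\<^sup>2)" for N c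
    unfolding wronskian_sol self by simp
  show "wronskian (sol (\<i> * s) c) (sol (- \<i> * s) c') (r * N) = 0" for N c c'
    unfolding wronskian_sol by simp
  show "cell_norm r (\<i> * s) k c \<ge> 0" for k c by (simp add: cell_norm_def)
  have "c = 0" if "cell_norm r z 1 c = 0" for z c
    using that r by (auto simp: cell_norm_def L2_set_eq_0_iff dest!: bspec[of _ _ 1])
  then show "c = 0" if "cell_norm r (\<i> * s) 1 c = 0" for c using that by blast
  show "c = 0" if "cell_norm r (- \<i> * s) 1 c = 0" for c
    using that \<open>\<And>z c. cell_norm r z 1 c = 0 \<Longrightarrow> c = 0\<close> by blast
qed

lemma solutions_eq:
  fixes s :: real
  assumes "s = 1 \<or> s = - 1" and r: "r \<ge> 1"
  shows "weyl_system.solutions (cell_norm r (\<i> * s)) = {c. sol (\<i> * s) c \<in> L2 pos_nats}"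
proof -
  interpret weyl_system s
    "\<lambda>N c. sol (\<i> * s) c (r * N)" "\<lambda>N c. - (\<beta> (r * N) *\<^sub>R sol (\<i> * s) c (Suc (r * N)))"
    "\<lambda>N c. sol (- \<i> * s) c (r * N)" "\<lambda>N c. - (\<beta> (r * N) *\<^sub>R sol (- \<i> * s) c (Suc (r * N)))"
    "cell_norm r (\<i> * s)" "cell_norm r (- \<i> * s)"
    by (rule weyl[OF assms])
  let ?f = "\<lambda>c n. (norm (sol (\<i> * s) c n))\<^sup>2"
  have "(\<exists>C. \<forall>N. (\<Sum>n\<in>{1..r * N}. ?f c n) \<le> C) \<longleftrightarrow> (\<exists>C. \<forall>N. (\<Sum>n\<in>{1..N}. ?f c n) \<le> C)" for c
  proof -
    have "(\<Sum>n\<in>{1..N}. ?f c n) \<le> (\<Sum>n\<in>{1..r * N}. ?f c n)" for N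
      by (rule sum_mono2) (use r in \<open>auto intro: order.trans\<close>)
    then show ?thesis by (meson order.trans)
  qed
  then show ?thesis unfolding solutions_def E_def sum_cell_norm L2_pos_nats by simp
qed

lemma subspace_L2_solutions:
  fixes s :: real
  assumes "s = 1 \<or> s = - 1"
  shows "vec.subspace {c. sol (\<i> * s) c \<in> L2 pos_nats}"
  using weyl_system.subspace_solutions[OF weyl[OF assms, of 1]] solutions_eq[OF assms, of 1] by simp

text \<open>Against a solution for \<i> \<open>s\<close>, Green's identity sees only the matrix
  minus the conjugate parameter - \<i> \<open>s\<close>, applied to \<open>w\<close>. This residual
  is what \<open>L2\<close> requires to be square-summable.\<close>

theorem dim_le:
  fixes s :: real and w :: "complex ^ 'p \<Rightarrow> nat \<Rightarrow> complex ^ 'p"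
  assumes s: "s = 1 \<or> s = - 1" and r: "r \<ge> 1"
    and S: "vec.subspace S" and lin: "\<And>n. clin (\<lambda>c. w c n)"
    and L2: "\<And>c. c \<in> S \<Longrightarrow> (\<lambda>n. jac_apply a \<beta> (w c) n + (\<i> * s) *s w c n) \<in> L2 pos_nats"
    and pos: "\<And>c. c \<in> S \<Longrightarrow> c \<noteq> 0 \<Longrightarrow> \<exists>L>0. \<forall>\<^sub>F N in sequentially.
        s * Im (hdot (w c (r * N)) (- (\<beta> (r * N) *\<^sub>R w c (Suc (r * N))))) \<ge> L"
  shows "vec.dim S \<le> vec.dim {c. sol (\<i> * s) c \<in> L2 pos_nats}"
  unfolding solutions_eq[OF s r, symmetric]
proof (rule weyl_system.dim_le_dim_solutions[OF weyl[OF s r] S, of "\<lambda>N c. w c (r * N)"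
      "\<lambda>N c. - (\<beta> (r * N) *\<^sub>R w c (Suc (r * N)))"])
  show "clin (\<lambda>c. w c (r * N))" "clin (\<lambda>c. - (\<beta> (r * N) *\<^sub>R w c (Suc (r * N))))" for N
    by (intro clin_intros lin)+
next
  fix c assume c: "c \<in> S"
  \<comment> \<open>The residual, grouped into cells by \<open>A\<close>; each step of the Wronskian
    with a solution adds its product with that solution.\<close>
  define d where "d n = jac_apply a \<beta> (w c) n + (\<i> * s) *s w c n" for n
  define A where "A k = L2_set (\<lambda>n. norm (d n)) {r * (k - 1) + 1..r * k}" for k
  obtain C where C: "\<And>N. (\<Sum>n\<in>{1..N}. (norm (d n))\<^sup>2) \<le> C"
    using L2[OF c] unfolding L2_pos_nats d_def by blast
  have "(\<Sum>k<N. (A (Suc k))\<^sup>2) \<le> C" for N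
  proof -
    have "(\<Sum>k<N. (A (Suc k))\<^sup>2) = (\<Sum>k\<in>{1..N}. (A k)\<^sup>2)"
      by (rule sum.reindex_bij_witness[of _ "\<lambda>k. k - 1" Suc]) auto
    also have "\<dots> = (\<Sum>n\<in>{1..r * N}. (norm (d n))\<^sup>2)"
      by (subst sum_strides[symmetric]) (simp add: A_def L2_set_def sum_nonneg)
    finally show ?thesis using C by simp
  qed
  then have "summable (\<lambda>k. (A (Suc k))\<^sup>2)"
    by (intro summableI_nonneg_bounded) auto
  then have "summable (\<lambda>k. (A k)\<^sup>2)" by (rule summable_Suc_iff[THEN iffD1])
  moreover have "norm (wronskian (w c) (sol (\<i> * s) c') (r * Suc k)
      - wronskian (w c) (sol (\<i> * s) c') (r * k)) \<le> A (Suc k) * cell_norm r (\<i> * s) (Suc k) c'" for k c'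
  proof -
    let ?y = "sol (\<i> * s) c'"
    let ?W = "wronskian (w c) ?y"
    have "?W (r * k + m) - ?W (r * k) = (\<Sum>n\<in>{r * k + 1..r * k + m}. hdot (d n) (?y n))" for m
    proof (induction m)
      case (Suc m)
      have "hdot (jac_apply a \<beta> (w c) (Suc n)) (?y (Suc n)) - hdot (w c (Suc n)) (jac_apply a \<beta> ?y (Suc n))
          = hdot (d (Suc n)) (?y (Suc n))" for n
        by (simp add: jac_apply_sol d_def hdot_add hdot_scale)
      then have "?W (Suc (r * k + m)) - ?W (r * k + m) = hdot (d (Suc (r * k + m))) (?y (Suc (r * k + m)))"
        by (rule trans[OF wronskian_Suc])
      then show ?case using Suc by (simp add: algebra_simps del: jac_sol.simps)
    qed simp
    from this[of r] have "norm (?W (r * Suc k) - ?W (r * k))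
        = norm (\<Sum>n\<in>{r * k + 1..r * Suc k}. hdot (d n) (?y n))"
      by (simp add: add.commute)
    also have "\<dots> \<le> (\<Sum>n\<in>{r * k + 1..r * Suc k}. \<bar>norm (d n)\<bar> * \<bar>norm (?y n)\<bar>)"
      by (intro sum_norm_le) (simp add: norm_hdot_le)
    also have "\<dots> \<le> A (Suc k) * cell_norm r (\<i> * s) (Suc k) c'"
      unfolding A_def cell_norm_def by (simp only: diff_Suc_1) (rule L2_set_mult_ineq)
    finally show ?thesis .
  qed
  ultimately show "\<exists>A. summable (\<lambda>k. (A k)\<^sup>2) \<and> (\<forall>k c'.
      norm (wronskian (w c) (sol (\<i> * s) c') (r * Suc k) - wronskian (w c) (sol (\<i> * s) c') (r * k))
        \<le> A (Suc k) * cell_norm r (\<i> * s) (Suc k) c')" by blast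
qed (rule pos)

end

subsection \<open>Absolutely continuous functions on compact intervals\<close>

text \<open>Closed-interval counterpart of \<open>ac_derivative\<close>: boundary values belong to
  \<open>u\<close>, and the Henstock-Kurzweil integral gives access to its calculus.\<close>

definition ac_on :: "real \<Rightarrow> real \<Rightarrow> (real \<Rightarrow> 'a :: euclidean_space) \<Rightarrow> (real \<Rightarrow> 'a) \<Rightarrow> bool" where
  "ac_on a b u v \<longleftrightarrow> v absolutely_integrable_on {a..b} \<and> (\<forall>t\<in>{a..b}. u t = u a + integral {a..t} v)"

lemma ac_onI:
  assumes "v absolutely_integrable_on {a..b}"
    and "\<And>t. t \<in> {a..b} \<Longrightarrow> u t = u a + integral {a..t} v"
  shows "ac_on a b u v"
  using assms unfolding ac_on_def by blast

lemma ac_onD: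
  assumes "ac_on a b u v"
  shows "v absolutely_integrable_on {a..b}"
    and "t \<in> {a..b} \<Longrightarrow> u t = u a + integral {a..t} v"
  using assms unfolding ac_on_def by blast+

lemma ac_on_diff:
  assumes "ac_on a b u v" "a \<le> s" "s \<le> t" "t \<le> b"
  shows "u t - u s = integral {s..t} v" "v absolutely_integrable_on {s..t}"
proof -
  note i = ac_onD(1)[OF assms(1)]
  show "v absolutely_integrable_on {s..t}"
    by (rule absolutely_integrable_on_subinterval[OF i]) (use assms in auto)
  have "v integrable_on {a..t}"
    using absolutely_integrable_on_subinterval[OF i, of a t] assms
    by (intro set_lebesgue_integral_eq_integral(1)) auto
  then have "integral {a..s} v + integral {s..t} v = integral {a..t} v"
    using assms by (intro Henstock_Kurzweil_Integration.integral_combine)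
  then show "u t - u s = integral {s..t} v"
    using ac_onD(2)[OF assms(1), of s] ac_onD(2)[OF assms(1), of t] assms(2-4) by (simp add: algebra_simps)
qed

lemma ac_on_continuous:
  assumes "ac_on a b u v"
  shows "continuous_on {a..b} u"
proof -
  have "v integrable_on {a..b}"
    by (intro set_lebesgue_integral_eq_integral(1) ac_onD(1)[OF assms])
  then have "continuous_on {a..b} (\<lambda>t. u a + integral {a..t} v)"
    by (intro continuous_intros indefinite_integral_continuous_1)
  then show ?thesis
    by (rule continuous_on_eq) (rule ac_onD(2)[OF assms, symmetric])
qed

lemma ac_on_C1:
  assumes "a \<le> b" "continuous_on {a..b} v"
    and "\<And>t. t \<in> {a..b} \<Longrightarrow> (u has_vector_derivative v t) (at t within {a..b})"
  shows "ac_on a b u v"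
  unfolding ac_on_def
proof (intro conjI ballI)
  show "v absolutely_integrable_on {a..b}"
    by (rule absolutely_integrable_continuous_real) fact
  fix t assume t: "t \<in> {a..b}"
  have "(v has_integral (u t - u a)) {a..t}"
    by (rule fundamental_theorem_of_calculus)
      (use t in \<open>auto intro: has_vector_derivative_within_subset[OF assms(3)]\<close>)
  then show "u t = u a + integral {a..t} v"
    by (simp add: integral_unique)
qed

lemma absolutely_integrable_open_interval:
  fixes v :: "real \<Rightarrow> 'a :: euclidean_space"
  shows "v absolutely_integrable_on {a<..<b} \<longleftrightarrow> v absolutely_integrable_on {a..b}"
  by (rule absolutely_integrable_spike_set_eq; rule negligible_subset[of "{a, b}"]) auto

lemma ac_derivative_imp_ac_on:
  assumes "ac_derivative a b u v" and ab: "a < b"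
  shows "\<exists>U. ac_on a b U v \<and> (\<forall>t\<in>{a<..<b}. U t = u t)"
proof -
  have i: "v absolutely_integrable_on {a..b}"
    using assms(1) unfolding ac_derivative_def absolutely_integrable_open_interval[symmetric] by simp
  have diff: "u t - u s = integral {s..t} v" if "a < s" "s \<le> t" "t < b" for s t
    using assms(1) that absolutely_integrable_on_subinterval[OF i, of s t]
    by (auto simp: ac_derivative_def set_lebesgue_integral_eq_integral(2))
  have comb: "integral {a..s} v + integral {s..t} v = integral {a..t} v" if "a \<le> s" "s \<le> t" "t \<le> b" for s t
    using that absolutely_integrable_on_subinterval[OF i, of a t]
    by (intro Henstock_Kurzweil_Integration.integral_combine set_lebesgue_integral_eq_integral(1)) auto
  \<comment> \<open>\<open>u\<close> carries information only on the open interval, so the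
    continuous extension is anchored at an interior point.\<close>
  define m where "m = (a + b) / 2"
  define U where "U t = u m - integral {a..m} v + integral {a..t} v" for t
  have m: "a < m" "m < b" using ab by (auto simp: m_def)
  have "ac_on a b U v"
    using i by (simp add: ac_on_def U_def)
  moreover have "U t = u t" if "t \<in> {a<..<b}" for t
  proof (cases "m \<le> t")
    case True
    then show ?thesis using diff[of m t] comb[of m t] m that by (simp add: U_def algebra_simps)
  next
    case False
    then show ?thesis using diff[of t m] comb[of t m] m that by (simp add: U_def algebra_simps)
  qed
  ultimately show ?thesis by blast
qed

lemma ac_on_imp_ac_derivative:
  assumes ac: "ac_on a b U v" and eq: "\<And>t. a < t \<Longrightarrow> t < b \<Longrightarrow> u t = U t"
  shows "ac_derivative a b u v"
  unfolding ac_derivative_def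
proof (intro conjI allI impI)
  show "set_integrable lebesgue {a<..<b} v"
    using ac_onD(1)[OF ac] by (simp only: absolutely_integrable_open_interval)
  fix s t assume "a < s \<and> s \<le> t \<and> t < b"
  then show "u t - u s = set_lebesgue_integral lebesgue {s..t} v"
    using ac_on_diff[OF ac, of s t] by (simp add: eq set_lebesgue_integral_eq_integral(2))
qed

text \<open>Telescoping over a uniform partition finer than \<delta> bounds \<open>D t - D a\<close>
  by \<epsilon> times \<open>V t - V a\<close>, for every \<epsilon>. In the product rule below it
  takes the place of differentiation almost everywhere.\<close>

lemma constant_by_partition:
  fixes D :: "real \<Rightarrow> 'a :: real_normed_vector" and V :: "real \<Rightarrow> real"
  assumes small: "\<And>\<epsilon>. \<epsilon> > 0 \<Longrightarrow> \<exists>\<delta>>0. \<forall>s t. a \<le> s \<and> s \<le> t \<and> t \<le> b \<and> t - s < \<delta> \<longrightarrow>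
      norm (D t - D s) \<le> \<epsilon> * (V t - V s)"
    and t: "a \<le> t" "t \<le> b"
  shows "D t = D a"
proof -
  have le: "norm (D t - D a) \<le> \<epsilon> * (V t - V a)" if eps: "\<epsilon> > 0" for \<epsilon>
  proof -
    obtain \<delta> where \<delta>: "\<delta> > 0" "\<And>s r. a \<le> s \<Longrightarrow> s \<le> r \<Longrightarrow> r \<le> b \<Longrightarrow> r - s < \<delta> \<Longrightarrow>
        norm (D r - D s) \<le> \<epsilon> * (V r - V s)"
      using small[OF eps] by blast
    obtain n :: nat where n: "real n > (t - a) / \<delta>" using reals_Archimedean2 by blast
    have "n > 0" using n t \<delta>(1) by (cases n) (auto simp: divide_less_0_iff)
    define p where "p i = a + real i * ((t - a) / real n)" for i
    have p0: "p 0 = a" and pn: "p n = t" using \<open>n > 0\<close> by (auto simp: p_def)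
    have step: "norm (D (p (Suc i)) - D (p i)) \<le> \<epsilon> * (V (p (Suc i)) - V (p i))" if "i < n" for i
    proof (rule \<delta>(2))
      show "a \<le> p i" using t by (simp add: p_def)
      show "p i \<le> p (Suc i)" using t by (simp add: p_def divide_right_mono mult_right_mono)
      have "real (Suc i) * ((t - a) / real n) \<le> real n * ((t - a) / real n)"
        using that t by (intro mult_right_mono) auto
      then show "p (Suc i) \<le> b" using t \<open>n > 0\<close> by (simp add: p_def)
      have "p (Suc i) - p i = (t - a) / real n" by (simp add: p_def distrib_right add_divide_distrib)
      also have "\<dots> < \<delta>" using n \<open>n > 0\<close> \<delta>(1) by (simp add: field_simps)
      finally show "p (Suc i) - p i < \<delta>" .
    qed
    have "norm (D t - D a) = norm (\<Sum>i<n. D (p (Suc i)) - D (p i))"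
      using sum_lessThan_telescope[of "\<lambda>i. D (p i)" n] p0 pn by simp
    also have "\<dots> \<le> (\<Sum>i<n. \<epsilon> * (V (p (Suc i)) - V (p i)))"
      by (rule sum_norm_le) (use step in auto)
    also have "\<dots> = \<epsilon> * (V t - V a)"
      using sum_lessThan_telescope[of "\<lambda>i. V (p i)" n] p0 pn by (simp add: sum_distrib_left[symmetric])
    finally show ?thesis .
  qed
  have "norm (D t - D a) \<le> 0 + e" if "e > 0" for e
  proof -
    define K where "K = \<bar>V t - V a\<bar> + 1"
    have "norm (D t - D a) \<le> e / K * (V t - V a)"
      by (rule le) (use that in \<open>simp add: K_def add_nonneg_pos\<close>)
    also have "\<dots> \<le> e / K * K"
      using that by (intro mult_left_mono) (auto simp: K_def)
    also have "\<dots> = e" by (simp add: K_def add_nonneg_pos)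
    finally show ?thesis by simp
  qed
  then have "norm (D t - D a) \<le> 0" by (rule field_le_epsilon)
  then show ?thesis by simp
qed

text \<open>
  The defect of the product rule over a short interval is bounded by the oscillation of the
  factors times the integral of the derivatives.
\<close>

lemma ac_on_product:
  fixes u v :: "real \<Rightarrow> 'a :: euclidean_space" and u' v' :: "real \<Rightarrow> 'b :: euclidean_space"
    and prod :: "'a \<Rightarrow> 'b \<Rightarrow> 'c :: euclidean_space"
  assumes bil: "bounded_bilinear prod" and ac: "ac_on a b u v" and ac': "ac_on a b u' v'"
  shows "ac_on a b (\<lambda>t. prod (u t) (u' t)) (\<lambda>t. prod (u t) (v' t) + prod (v t) (u' t))"
proof (cases "a \<le> b")
  case True
  interpret bounded_bilinear prod by fact
  let ?W = "\<lambda>t. prod (u t) (v' t) + prod (v t) (u' t)"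
  have cont: "continuous_on {a..b} u" "continuous_on {a..b} u'"
    using ac ac' by (auto intro: ac_on_continuous)
  have bdd: "bounded (u ` {a..b})" "bounded (u' ` {a..b})"
    using cont by (auto intro!: compact_imp_bounded compact_continuous_image)
  have meas: "u \<in> borel_measurable (lebesgue_on {a..b})" "u' \<in> borel_measurable (lebesgue_on {a..b})"
    using cont by (auto intro!: continuous_imp_measurable_on_sets_lebesgue)
  have i: "v absolutely_integrable_on {a..b}" "v' absolutely_integrable_on {a..b}"
    by (rule ac_onD(1)[OF ac], rule ac_onD(1)[OF ac'])
  have bilin: "bilinear prod" "bilinear (\<lambda>x y. prod y x)"
    by (simp_all add: bilinear_conv_bounded_bilinear bil bounded_bilinear.flip)
  have iW: "?W absolutely_integrable_on {a..b}"
    by (intro set_integral_add absolutely_integrable_bounded_measurable_product[OF bilin(1)]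
        absolutely_integrable_bounded_measurable_product[OF bilin(2)] meas bdd i) auto
  have on: "f integrable_on {s..t}" if "f absolutely_integrable_on {a..b}" "a \<le> s" "t \<le> b"
    for f :: "real \<Rightarrow> 'z :: euclidean_space" and s t
    using absolutely_integrable_on_subinterval[OF that(1), of s t] that
    by (intro set_lebesgue_integral_eq_integral(1)) auto
  define h where "h t = norm (v t) + norm (v' t)" for t
  have ih: "h absolutely_integrable_on {a..b}"
    unfolding h_def[abs_def] by (intro set_integral_add absolutely_integrable_norm[unfolded o_def] i)
  obtain K where K: "K > 0" "\<And>x y. norm (prod x y) \<le> norm x * norm y * K"
    using pos_bounded by blast
  define D where "D t = prod (u t) (u' t) - integral {a..t} ?W" for t
  define V where "V t = integral {a..t} h" for t
  have comb: "integral {a..t} f - integral {a..s} f = integral {s..t} f"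
    if "f absolutely_integrable_on {a..b}" "a \<le> s" "s \<le> t" "t \<le> b"
    for f :: "real \<Rightarrow> 'z :: euclidean_space" and s t
    using Henstock_Kurzweil_Integration.integral_combine[OF that(2,3) on[OF that(1) _ that(4)]]
    by (simp add: algebra_simps)
  have "D t = D a" if "t \<in> {a..b}" for t
  proof (rule constant_by_partition[of a b D V])
    fix \<epsilon> :: real assume "\<epsilon> > 0"
    then have "\<epsilon> / K > 0" using K by simp
    have "uniformly_continuous_on {a..b} u" "uniformly_continuous_on {a..b} u'"
      using cont by (auto intro: compact_uniformly_continuous)
    note uc = this[unfolded uniformly_continuous_on_def, rule_format, OF \<open>\<epsilon> / K > 0\<close>]
    obtain \<delta> where \<delta>1: "\<delta> > 0"
      "\<And>x y. x \<in> {a..b} \<Longrightarrow> y \<in> {a..b} \<Longrightarrow> dist y x < \<delta> \<Longrightarrow> dist (u y) (u x) < \<epsilon> / K"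
      using uc(1) by auto
    obtain \<delta>' where \<delta>2: "\<delta>' > 0"
      "\<And>x y. x \<in> {a..b} \<Longrightarrow> y \<in> {a..b} \<Longrightarrow> dist y x < \<delta>' \<Longrightarrow> dist (u' y) (u' x) < \<epsilon> / K"
      using uc(2) by auto
    note \<delta> = \<delta>1(1) \<delta>2(1) \<delta>1(2) \<delta>2(2)
    have "norm (D t - D s) \<le> \<epsilon> * (V t - V s)"
      if st: "a \<le> s" "s \<le> t" "t \<le> b" "t - s < min \<delta> \<delta>'" for s t
    proof -
      note iv = on[OF i(1) st(1,3)] and iv' = on[OF i(2) st(1,3)] and isW = on[OF iW st(1,3)]
      have iL: "(\<lambda>r. prod (u t) (v' r)) integrable_on {s..t}" "(\<lambda>r. prod (v r) (u' s)) integrable_on {s..t}"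
        using integrable_linear[OF iv' bounded_linear_right] integrable_linear[OF iv bounded_linear_left]
        by (simp_all add: o_def)
      \<comment> \<open>Freezing the left factor at \<open>t\<close> and the right factor at
        \<open>s\<close> makes the discrete product rule exact, so the defect contains only
        oscillations of the factors.\<close>
      have "prod (u t) (u' t) - prod (u s) (u' s) = prod (u t) (u' t - u' s) + prod (u t - u s) (u' s)"
        by (simp add: diff_left diff_right)
      also have "\<dots> = prod (u t) (integral {s..t} v') + prod (integral {s..t} v) (u' s)"
        using ac_on_diff(1)[OF ac st(1-3)] ac_on_diff(1)[OF ac' st(1-3)] by simp
      also have "\<dots> = integral {s..t} (\<lambda>r. prod (u t) (v' r)) + integral {s..t} (\<lambda>r. prod (v r) (u' s))"
        using integral_linear[OF iv' bounded_linear_right, of "u t"]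
          integral_linear[OF iv bounded_linear_left, of "u' s"] by (simp add: o_def)
      finally have "D t - D s = integral {s..t} (\<lambda>r. prod (u t) (v' r) + prod (v r) (u' s)) - integral {s..t} ?W"
        using comb[OF iW st(1-3)] iL by (simp add: D_def Henstock_Kurzweil_Integration.integral_add algebra_simps)
      also have "\<dots> = integral {s..t} (\<lambda>r. prod (u t) (v' r) + prod (v r) (u' s) - ?W r)"
        by (rule Henstock_Kurzweil_Integration.integral_diff[symmetric, OF _ isW])
          (intro integrable_add iL)
      finally have eq: "D t - D s = integral {s..t} (\<lambda>r. prod (u t) (v' r) + prod (v r) (u' s) - ?W r)" .
      have "norm (D t - D s) \<le> integral {s..t} (\<lambda>r. \<epsilon> * h r)"
        unfolding eq
      proof (rule integral_norm_bound_integral)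
        show "(\<lambda>r. prod (u t) (v' r) + prod (v r) (u' s) - ?W r) integrable_on {s..t}"
          by (intro integrable_diff integrable_add iL isW)
        show "(\<lambda>r. \<epsilon> * h r) integrable_on {s..t}"
          using on[OF ih st(1,3)] by (rule integrable_on_mult_right)
        fix r assume r: "r \<in> {s..t}"
        have "dist t r < \<delta>" "dist s r < \<delta>'" using r st by (auto simp: dist_real_def)
        then have "norm (u t - u r) \<le> \<epsilon> / K" "norm (u' s - u' r) \<le> \<epsilon> / K"
          using \<delta>(3)[of r t] \<delta>(4)[of r s] r st by (auto simp: dist_norm)
        then have "norm (u t - u r) * norm (v' r) * K \<le> \<epsilon> / K * norm (v' r) * K"
            "norm (v r) * norm (u' s - u' r) * K \<le> norm (v r) * (\<epsilon> / K) * K"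
          using K(1) by (intro mult_right_mono mult_left_mono; simp)+
        then have "norm (prod (u t - u r) (v' r)) \<le> \<epsilon> / K * norm (v' r) * K"
            "norm (prod (v r) (u' s - u' r)) \<le> norm (v r) * (\<epsilon> / K) * K"
          by (blast intro: order.trans K(2))+
        moreover have "prod (u t) (v' r) + prod (v r) (u' s) - ?W r
            = prod (u t - u r) (v' r) + prod (v r) (u' s - u' r)"
          by (simp add: diff_left diff_right)
        ultimately have "norm (prod (u t) (v' r) + prod (v r) (u' s) - ?W r)
            \<le> \<epsilon> / K * norm (v' r) * K + norm (v r) * (\<epsilon> / K) * K"
          by (metis add_mono norm_triangle_ineq order.trans)
        then show "norm (prod (u t) (v' r) + prod (v r) (u' s) - ?W r) \<le> \<epsilon> * h r"
          using K by (simp add: h_def algebra_simps)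
      qed
      also have "\<dots> = \<epsilon> * (V t - V s)"
        using comb[OF ih st(1-3)] by (simp add: V_def)
      finally show ?thesis .
    qed
    then show "\<exists>\<delta>>0. \<forall>s t. a \<le> s \<and> s \<le> t \<and> t \<le> b \<and> t - s < \<delta> \<longrightarrow> norm (D t - D s) \<le> \<epsilon> * (V t - V s)"
      using \<delta>(1,2) by (intro exI[of _ "min \<delta> \<delta>'"]) auto
  qed (use that in auto)
  then have Da: "D t = D a" if "t \<in> {a..b}" for t using that by blast
  show ?thesis
  proof (rule ac_onI[OF iW])
    show "prod (u t) (u' t) = prod (u a) (u' a) + integral {a..t} ?W" if "t \<in> {a..b}" for t
      using Da[OF that] by (simp add: D_def algebra_simps)
  qed
next
  case False
  then show ?thesis by (simp add: ac_on_def)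
qed

lemma ac_on_add:
  assumes ac: "ac_on a b u v" "ac_on a b u' v'"
  shows "ac_on a b (\<lambda>t. u t + u' t) (\<lambda>t. v t + v' t)"
proof (rule ac_onI)
  show "(\<lambda>t. v t + v' t) absolutely_integrable_on {a..b}"
    by (intro set_integral_add ac[THEN ac_onD(1)])
  fix t assume t: "t \<in> {a..b}"
  have "v integrable_on {a..t}" "v' integrable_on {a..t}"
    using ac_on_diff(2)[OF ac(1), of a t] ac_on_diff(2)[OF ac(2), of a t] t
    by (auto intro: set_lebesgue_integral_eq_integral(1))
  then have "integral {a..t} (\<lambda>t. v t + v' t) = integral {a..t} v + integral {a..t} v'"
    by (rule Henstock_Kurzweil_Integration.integral_add)
  then show "u t + u' t = u a + u' a + integral {a..t} (\<lambda>t. v t + v' t)"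
    using ac_onD(2)[OF ac(1) t] ac_onD(2)[OF ac(2) t] by (simp only: ac_simps)
qed

lemma ac_on_minus:
  assumes ac: "ac_on a b u v"
  shows "ac_on a b (\<lambda>t. - u t) (\<lambda>t. - v t)"
proof (rule ac_onI)
  show "(\<lambda>t. - v t) absolutely_integrable_on {a..b}"
    using absolutely_integrable_scaleR_left[OF ac_onD(1)[OF ac], of "- 1"] by simp
  show "- u t = - u a + integral {a..t} (\<lambda>t. - v t)" if "t \<in> {a..b}" for t
    using ac_onD(2)[OF ac that] by simp
qed

lemma ac_on_diff': "ac_on a b u v \<Longrightarrow> ac_on a b u' v' \<Longrightarrow> ac_on a b (\<lambda>t. u t - u' t) (\<lambda>t. v t - v' t)"
  using ac_on_add[of a b u v "\<lambda>t. - u' t" "\<lambda>t. - v' t"] ac_on_minus[of a b u' v'] by simp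

lemma ac_on_cong:
  assumes ac: "ac_on a b u v" and u: "\<And>t. t \<in> {a..b} \<Longrightarrow> u t = u' t"
    and v: "\<And>t. t \<in> {a<..<b} \<Longrightarrow> v t = v' t"
  shows "ac_on a b u' v'"
proof (rule ac_onI)
  have "v absolutely_integrable_on {a<..<b}"
    using ac_onD(1)[OF ac] by (simp only: absolutely_integrable_open_interval)
  then have "v' absolutely_integrable_on {a<..<b}"
    by (rule set_integrable_cong[OF refl refl v, THEN iffD1, rotated])
  then show "v' absolutely_integrable_on {a..b}"
    by (simp only: absolutely_integrable_open_interval)
  show "u' t = u' a + integral {a..t} v'" if t: "t \<in> {a..b}" for t
  proof -
    have "integral {a..t} v = integral {a..t} v'"
      by (rule integral_spike[of "{a, b}"]) (use t in \<open>auto intro!: v[symmetric]\<close>)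
    moreover have "u a = u' a" by (rule u) (use t in simp)
    ultimately show ?thesis using ac_onD(2)[OF ac t] u[OF t] by simp
  qed
qed

lemma ac_on_imp_has_vector_derivative:
  assumes ac: "ac_on a b u v" and cont: "continuous_on {a..b} v" and t: "a < t" "t < b"
  shows "(u has_vector_derivative v t) (at t)"
proof -
  have "((\<lambda>t. integral {a..t} v) has_vector_derivative v t) (at t within {a..b})"
    by (rule integral_has_vector_derivative[OF cont]) (use t in auto)
  then have "((\<lambda>t. u a + integral {a..t} v) has_vector_derivative v t) (at t within {a..b})"
    using has_vector_derivative_add[OF has_vector_derivative_const] by fastforce
  then have "((\<lambda>t. u a + integral {a..t} v) has_vector_derivative v t) (at t)"
    using t by (simp add: at_within_Icc_at)
  then show ?thesis
    by (rule has_vector_derivative_transform_within_open[of _ _ _ "{a<..<b}"])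
      (use ac_onD(2)[OF ac, symmetric] t in auto)
qed

subsection \<open>The equation \<open>- y'' = z y\<close> on an interval\<close>

text \<open>\<open>cosz\<close> and \<open>sinz\<close> form the fundamental system with data (1, 0)
  and (0, 1) at 0. Both are even in the square root, so the branch chosen by \<open>csqrt\<close> is
  immaterial.\<close>

definition cosz :: "complex \<Rightarrow> real \<Rightarrow> complex" where "cosz z t = cos (csqrt z * of_real t)"

definition sinz :: "complex \<Rightarrow> real \<Rightarrow> complex" where "sinz z t = sin (csqrt z * of_real t) / csqrt z"

lemma cosz_sinz_0 [simp]: "cosz z 0 = 1" "sinz z 0 = 0"
  by (simp_all add: cosz_def sinz_def)

lemma cosz_sinz_wronskian:
  assumes "z \<noteq> 0"
  shows "cosz z t * cosz z t + z * sinz z t * sinz z t = 1"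
proof -
  have "(csqrt z)\<^sup>2 = z" "csqrt z \<noteq> 0" using assms by auto
  then have "cosz z t * cosz z t + z * sinz z t * sinz z t
      = (cos (csqrt z * of_real t))\<^sup>2 + (sin (csqrt z * of_real t))\<^sup>2"
    by (simp add: cosz_def sinz_def power2_eq_square)
  then show ?thesis by simp
qed

lemma cosz_sinz_derivative:
  assumes "z \<noteq> 0"
  shows "((\<lambda>t. cosz z (t - x)) has_vector_derivative - (z * sinz z (t - x))) (at t within S)"
    and "((\<lambda>t. sinz z (t - x)) has_vector_derivative cosz z (t - x)) (at t within S)"
proof -
  have z: "csqrt z * csqrt z = z" "csqrt z \<noteq> 0" using assms by (auto simp flip: power2_eq_square)
  have lin: "((\<lambda>t. csqrt z * of_real (t - x)) has_vector_derivative csqrt z) (at t within S)"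
    by (auto intro!: derivative_eq_intros)
  have "(cos \<circ> (\<lambda>t. csqrt z * of_real (t - x)) has_vector_derivative
      csqrt z * - sin (csqrt z * of_real (t - x))) (at t within S)"
    by (rule field_vector_diff_chain_within[OF lin]) (auto intro!: derivative_eq_intros)
  moreover have "csqrt z * - sin (csqrt z * of_real (t - x)) = - (z * sinz z (t - x))"
    using z by (simp add: sinz_def field_simps)
  ultimately show "((\<lambda>t. cosz z (t - x)) has_vector_derivative - (z * sinz z (t - x))) (at t within S)"
    by (simp add: cosz_def o_def)
  have "(sin \<circ> (\<lambda>t. csqrt z * of_real (t - x)) has_vector_derivative
      csqrt z * cos (csqrt z * of_real (t - x))) (at t within S)"
    by (rule field_vector_diff_chain_within[OF lin]) (auto intro!: derivative_eq_intros)
  from has_vector_derivative_divide[OF this, of "csqrt z"]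
  show "((\<lambda>t. sinz z (t - x)) has_vector_derivative cosz z (t - x)) (at t within S)"
    using z by (simp add: cosz_def sinz_def[abs_def] o_def)
qed

definition classical :: "complex \<Rightarrow> (real \<Rightarrow> complex ^ 'p) \<Rightarrow> (real \<Rightarrow> complex ^ 'p) \<Rightarrow> bool" where
  "classical z y y' \<longleftrightarrow> (\<forall>t S. (y has_vector_derivative y' t) (at t within S) \<and>
     (y' has_vector_derivative - (z *s y t)) (at t within S))"

definition piece :: "complex \<Rightarrow> real \<Rightarrow> complex ^ 'p \<Rightarrow> complex ^ 'p \<Rightarrow> real \<Rightarrow> complex ^ 'p" where
  "piece z x a b t = cosz z (t - x) *s a + sinz z (t - x) *s b"

definition dpiece :: "complex \<Rightarrow> real \<Rightarrow> complex ^ 'p \<Rightarrow> complex ^ 'p \<Rightarrow> real \<Rightarrow> complex ^ 'p" where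
  "dpiece z x a b t = (- (z * sinz z (t - x))) *s a + cosz z (t - x) *s b"

lemma piece_at [simp]: "piece z x a b x = a" "dpiece z x a b x = b"
  by (simp_all add: piece_def dpiece_def)

lemma clin_piece:
  assumes "clin f" "clin g"
  shows "clin (\<lambda>c. piece z x (f c) (g c) t)" "clin (\<lambda>c. dpiece z x (f c) (g c) t)"
  unfolding piece_def dpiece_def by (intro clin_intros assms)+

lemma vscale_derivative:
  assumes "(f has_vector_derivative f') (at t within S)"
  shows "((\<lambda>t. f t *s (a :: complex ^ 'p)) has_vector_derivative f' *s a) (at t within S)"
  by (rule bounded_linear.has_vector_derivative[OF
        bounded_bilinear.bounded_linear_left[OF bounded_bilinear_vscale] assms])

lemma classical_piece:
  assumes "z \<noteq> 0"
  shows "classical z (piece z x a b) (dpiece z x a b)"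
  unfolding classical_def
proof (intro allI conjI)
  fix t S
  note d = cosz_sinz_derivative[OF assms, of x t S]
  show "(piece z x a b has_vector_derivative dpiece z x a b t) (at t within S)"
    unfolding piece_def[abs_def] dpiece_def
    by (intro has_vector_derivative_add vscale_derivative d)
  have "((\<lambda>t. - (z * sinz z (t - x))) has_vector_derivative - (z * cosz z (t - x))) (at t within S)"
    by (intro has_vector_derivative_minus has_vector_derivative_mult_right d)
  then have "(dpiece z x a b has_vector_derivative
      (- (z * cosz z (t - x))) *s a + (- (z * sinz z (t - x))) *s b) (at t within S)"
    unfolding dpiece_def[abs_def] by (intro has_vector_derivative_add vscale_derivative d)
  then show "(dpiece z x a b has_vector_derivative - (z *s piece z x a b t)) (at t within S)"
    by (simp add: piece_def vec.scale_right_distrib)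
qed

lemma classicalD:
  assumes "classical z y y'"
  shows "(y has_vector_derivative y' t) (at t within S)"
    and "(y' has_vector_derivative - (z *s y t)) (at t within S)"
    and "continuous_on S y" "continuous_on S y'"
proof -
  show "(y has_vector_derivative y' t) (at t within S)"
    "(y' has_vector_derivative - (z *s y t)) (at t within S)" for t S
    using assms by (auto simp: classical_def)
  then show "continuous_on S y" "continuous_on S y'"
    by (auto intro!: continuous_at_imp_continuous_on has_vector_derivative_continuous)
qed

lemma classical_ac_on:
  assumes "classical z y y'" "p \<le> q"
  shows "ac_on p q y y'" "ac_on p q y' (\<lambda>t. - (z *s y t))"
proof -
  show "ac_on p q y y'"
    by (rule ac_on_C1) (use assms classicalD[OF assms(1)] in auto)
  have "continuous_on {p..q} (\<lambda>t. - (z *s y t))"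
    by (intro continuous_intros bounded_bilinear.continuous_on[OF bounded_bilinear_vscale]
        classicalD[OF assms(1)])
  then show "ac_on p q y' (\<lambda>t. - (z *s y t))"
    by (intro ac_on_C1) (use assms classicalD[OF assms(1)] in auto)
qed

text \<open>Green's identity: in the derivative of the bracket the products of first derivatives
  cancel, and moving \<zeta> across the Hermitian product conjugates it.\<close>

lemma green_ac:
  assumes w: "ac_on p q w w1" "ac_on p q w1 w2" and y: "classical \<zeta> y y'" and "p \<le> q"
  shows "(\<lambda>t. hdot (- w2 t - cnj \<zeta> *s w t) (y t)) absolutely_integrable_on {p..q}"
    and "omega (w q) (w1 q) (y q) (y' q) - omega (w p) (w1 p) (y p) (y' p)
      = integral {p..q} (\<lambda>t. hdot (- w2 t - cnj \<zeta> *s w t) (y t))"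
proof -
  note ac = classical_ac_on[OF y \<open>p \<le> q\<close>]
  have "ac_on p q (\<lambda>t. hdot (w t) (y' t) - hdot (w1 t) (y t))
      (\<lambda>t. (hdot (w t) (- (\<zeta> *s y t)) + hdot (w1 t) (y' t)) - (hdot (w1 t) (y' t) + hdot (w2 t) (y t)))"
    by (intro ac_on_diff' ac_on_product[OF bounded_bilinear_hdot] w ac)
  then have D: "ac_on p q (\<lambda>t. omega (w t) (w1 t) (y t) (y' t)) (\<lambda>t. hdot (- w2 t - cnj \<zeta> *s w t) (y t))"
    by (rule ac_on_cong) (simp_all add: omega_def hdot_diff hdot_minus hdot_scale)
  show "(\<lambda>t. hdot (- w2 t - cnj \<zeta> *s w t) (y t)) absolutely_integrable_on {p..q}"
    by (rule ac_onD(1)[OF D])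
  show "omega (w q) (w1 q) (y q) (y' q) - omega (w p) (w1 p) (y p) (y' p)
      = integral {p..q} (\<lambda>t. hdot (- w2 t - cnj \<zeta> *s w t) (y t))"
    by (rule ac_on_diff(1)[OF D]) (use \<open>p \<le> q\<close> in auto)
qed

text \<open>Cauchy-Schwarz against the constant 1, obtained from the nonnegative integral of the
  squared deviation from the mean \<open>m\<close>.\<close>

lemma integral_norm_le_sqrt:
  fixes y :: "real \<Rightarrow> 'a :: real_normed_vector"
  assumes "a < b" "continuous_on {a..b} y"
  shows "integral {a..b} (\<lambda>t. norm (y t)) \<le> sqrt (b - a) * sqrt (integral {a..b} (\<lambda>t. (norm (y t))\<^sup>2))"
proof -
  define I where "I = integral {a..b} (\<lambda>t. norm (y t))"
  define m where "m = I / (b - a)"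
  have int: "(\<lambda>t. norm (y t)) integrable_on {a..b}" "(\<lambda>t. (norm (y t))\<^sup>2) integrable_on {a..b}"
    by (intro integrable_continuous_real continuous_intros assms)+
  have "0 \<le> integral {a..b} (\<lambda>t. (norm (y t) - m)\<^sup>2)"
    by (intro Henstock_Kurzweil_Integration.integral_nonneg integrable_continuous_real continuous_intros assms) simp
  also have "(\<lambda>t. (norm (y t) - m)\<^sup>2) = (\<lambda>t. (norm (y t))\<^sup>2 - 2 * m * norm (y t) + m\<^sup>2)"
    by (auto simp: power2_eq_square algebra_simps)
  also have "integral {a..b} (\<lambda>t. (norm (y t))\<^sup>2 - 2 * m * norm (y t) + m\<^sup>2)
      = integral {a..b} (\<lambda>t. (norm (y t))\<^sup>2 - 2 * m * norm (y t)) + integral {a..b} (\<lambda>t. m\<^sup>2)"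
    by (intro Henstock_Kurzweil_Integration.integral_add integrable_diff int integrable_on_mult_right) auto
  also have "integral {a..b} (\<lambda>t. (norm (y t))\<^sup>2 - 2 * m * norm (y t))
      = integral {a..b} (\<lambda>t. (norm (y t))\<^sup>2) - integral {a..b} (\<lambda>t. 2 * m * norm (y t))"
    by (intro Henstock_Kurzweil_Integration.integral_diff int integrable_on_mult_right)
  finally have "0 \<le> integral {a..b} (\<lambda>t. (norm (y t))\<^sup>2) - 2 * m * I + m\<^sup>2 * (b - a)"
    using assms(1) by (simp add: I_def mult.commute)
  also have "\<dots> = integral {a..b} (\<lambda>t. (norm (y t))\<^sup>2) - I\<^sup>2 / (b - a)"
  proof -
    have "m * (b - a) = I" using assms(1) by (simp add: m_def)
    then have "m\<^sup>2 * (b - a) = m * I" by (simp add: power2_eq_square mult.assoc)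
    moreover have "m * I = I\<^sup>2 / (b - a)" by (simp add: m_def power2_eq_square)
    ultimately show ?thesis by simp
  qed
  finally have "I\<^sup>2 \<le> (b - a) * integral {a..b} (\<lambda>t. (norm (y t))\<^sup>2)"
    using assms(1) by (simp add: field_simps)
  then show ?thesis unfolding I_def real_sqrt_mult[symmetric] by (rule real_le_rsqrt)
qed

text \<open>Testing the equation against \<open>\<psi>\<close>; suitable cubic \<open>\<psi>\<close> isolate the boundary values.\<close>

lemma boundary_estimate:
  fixes y y' :: "real \<Rightarrow> complex ^ 'p"
  assumes y: "classical z y y'" and z: "norm z = 1" and ab: "a < b"
    and \<psi>: "\<And>t. (\<psi> has_real_derivative \<psi>1 t) (at t)" "\<And>t. (\<psi>1 has_real_derivative \<psi>2 t) (at t)"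
    and cont: "continuous_on UNIV \<psi>2"
    and M: "\<And>t. 0 \<le> t \<Longrightarrow> t \<le> b - a \<Longrightarrow> \<bar>\<psi>2 t\<bar> + \<bar>\<psi> t\<bar> \<le> M"
  shows "norm (\<psi>1 (b - a) *\<^sub>R y b - \<psi> (b - a) *\<^sub>R y' b - (\<psi>1 0 *\<^sub>R y a - \<psi> 0 *\<^sub>R y' a))
    \<le> M * (sqrt (b - a) * sqrt (integral {a..b} (\<lambda>t. (norm (y t))\<^sup>2)))"
proof -
  let ?F = "\<lambda>t. \<psi>1 (t - a) *\<^sub>R y t - \<psi> (t - a) *\<^sub>R y' t"
  let ?f = "\<lambda>t. \<psi>2 (t - a) *\<^sub>R y t + \<psi> (t - a) *\<^sub>R (z *s y t)"
  note d = classicalD[OF y]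
  have \<psi>': "((\<lambda>t. \<psi> (t - a)) has_real_derivative \<psi>1 (t - a)) (at t within S)"
    "((\<lambda>t. \<psi>1 (t - a)) has_real_derivative \<psi>2 (t - a)) (at t within S)" for t S
  proof -
    have "((\<lambda>t. t - a) has_real_derivative 1) (at t within S)"
      by (auto intro!: derivative_eq_intros)
    then show "((\<lambda>t. \<psi> (t - a)) has_real_derivative \<psi>1 (t - a)) (at t within S)"
      "((\<lambda>t. \<psi>1 (t - a)) has_real_derivative \<psi>2 (t - a)) (at t within S)"
      using DERIV_chain2[OF \<psi>(1), of "\<lambda>t. t - a" 1 t S] DERIV_chain2[OF \<psi>(2), of "\<lambda>t. t - a" 1 t S]
      by simp_all
  qed
  have "(?F has_vector_derivative (\<psi>1 (t - a) *\<^sub>R y' t + \<psi>2 (t - a) *\<^sub>R y t)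
      - (\<psi> (t - a) *\<^sub>R (- (z *s y t)) + \<psi>1 (t - a) *\<^sub>R y' t)) (at t within {a..b})" for t
    by (intro has_vector_derivative_diff has_vector_derivative_scaleR \<psi>' d)
  then have "(?F has_vector_derivative ?f t) (at t within {a..b})" for t
    by (simp add: algebra_simps)
  then have f: "(?f has_integral ?F b - ?F a) {a..b}"
    by (intro fundamental_theorem_of_calculus) (use ab in auto)
  have "norm (?F b - ?F a) \<le> integral {a..b} (\<lambda>t. M * norm (y t))"
    unfolding integral_unique[OF f, symmetric]
  proof (rule integral_norm_bound_integral)
    show "?f integrable_on {a..b}" using f by blast
    show "(\<lambda>t. M * norm (y t)) integrable_on {a..b}"
      by (intro integrable_continuous_real continuous_intros d)
    fix t assume t: "t \<in> {a..b}"
    have "norm (?f t) \<le> norm (\<psi>2 (t - a) *\<^sub>R y t) + norm (\<psi> (t - a) *\<^sub>R (z *s y t))"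
      by (rule norm_triangle_ineq)
    also have "\<dots> = (\<bar>\<psi>2 (t - a)\<bar> + \<bar>\<psi> (t - a)\<bar>) * norm (y t)"
      by (simp add: norm_vscale z algebra_simps)
    also have "\<dots> \<le> M * norm (y t)"
      by (intro mult_right_mono M) (use t in auto)
    finally show "norm (?f t) \<le> M * norm (y t)" .
  qed
  also have "\<dots> = M * integral {a..b} (\<lambda>t. norm (y t))" by simp
  also have "\<dots> \<le> M * (sqrt (b - a) * sqrt (integral {a..b} (\<lambda>t. (norm (y t))\<^sup>2)))"
  proof (rule mult_left_mono)
    show "0 \<le> M" using M[of 0] ab by linarith
  qed (rule integral_norm_le_sqrt[OF ab d(3)])
  finally show ?thesis by simp
qed

text \<open>The four quantities are the components of the boundary triplet on the interval. Each
  comes from one test function in \<open>boundary_estimate\<close>; the 6 covers the second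
  derivatives of the cubics after rescaling to unit length, and the square of \<open>D\<close>
  covers the term with \<open>z\<close>.\<close>

lemma interval_estimate:
  fixes y y' :: "real \<Rightarrow> complex ^ 'p"
  assumes y: "classical z y y'" and z: "norm z = 1" and ab: "a < b" and D: "b - a \<le> D"
  defines "d \<equiv> b - a" and "e \<equiv> sqrt (integral {a..b} (\<lambda>t. (norm (y t))\<^sup>2))"
  shows "norm (sqrt d *\<^sub>R y a) \<le> (6 + D\<^sup>2) * e"
    and "norm ((d * sqrt d) *\<^sub>R y' b) \<le> (6 + D\<^sup>2) * e"
    and "norm ((1 / sqrt d) *\<^sub>R (y' a - y' b)) \<le> (6 + D\<^sup>2) * e"
    and "norm ((1 / (d * sqrt d)) *\<^sub>R (y b - y a - d *\<^sub>R y' b)) \<le> (6 + D\<^sup>2) * e"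
proof -
  have d: "d > 0" "sqrt d > 0" using ab by (auto simp: d_def)
  have sq: "sqrt d * sqrt d = d" using d by simp
  have e: "e \<ge> 0" unfolding e_def by (intro real_sqrt_ge_zero Henstock_Kurzweil_Integration.integral_nonneg
        integrable_continuous_real) (auto intro!: continuous_intros classicalD[OF y])
  have dD: "d\<^sup>2 \<le> D\<^sup>2" using d D by (intro power_mono) (auto simp: d_def)
  have le: "x * e \<le> (6 + D\<^sup>2) * e" if "x \<le> 6 + d\<^sup>2" for x
    using that dD e by (intro mult_right_mono) auto
  note est = boundary_estimate[OF y z ab, folded d_def e_def]

  \<comment> \<open>Test function 1: it isolates the difference of the slopes.\<close>
  have "norm (0 *\<^sub>R y b - 1 *\<^sub>R y' b - (0 *\<^sub>R y a - 1 *\<^sub>R y' a)) \<le> 1 * (sqrt d * e)"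
    by (rule est[of "\<lambda>_. 1" "\<lambda>_. 0" "\<lambda>_. 0" 1]) (auto intro!: derivative_eq_intros continuous_intros)
  then have "norm (y' a - y' b) \<le> sqrt d * e" by simp
  then have "norm ((1 / sqrt d) *\<^sub>R (y' a - y' b)) \<le> 1 * e"
    unfolding norm_scaleR using d by (simp add: field_simps)
  also have "\<dots> \<le> (6 + D\<^sup>2) * e" by (rule le) simp
  finally show "norm ((1 / sqrt d) *\<^sub>R (y' a - y' b)) \<le> (6 + D\<^sup>2) * e" .

  \<comment> \<open>Test function t: it isolates the deviation of \<open>y\<close> from its tangent
    at \<open>b\<close>.\<close>
  have "norm (1 *\<^sub>R y b - d *\<^sub>R y' b - (1 *\<^sub>R y a - 0 *\<^sub>R y' a)) \<le> d * (sqrt d * e)"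
    by (rule est[of "\<lambda>t. t" "\<lambda>_. 1" "\<lambda>_. 0" d]) (auto intro!: derivative_eq_intros continuous_intros)
  then have "norm (y b - y a - d *\<^sub>R y' b) \<le> d * sqrt d * e" by (simp add: algebra_simps)
  then have "norm ((1 / (d * sqrt d)) *\<^sub>R (y b - y a - d *\<^sub>R y' b)) \<le> 1 * e"
    unfolding norm_scaleR using d by (simp add: field_simps)
  also have "\<dots> \<le> (6 + D\<^sup>2) * e" by (rule le) simp
  finally show "norm ((1 / (d * sqrt d)) *\<^sub>R (y b - y a - d *\<^sub>R y' b)) \<le> (6 + D\<^sup>2) * e" .

  \<comment> \<open>The Hermite cubic - t (1 - t/d)^2: value and slope vanish at d, and at 0 the
    value is 0 and the slope -1, so only \<open>y a\<close> survives.\<close>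
  define \<psi> where "\<psi> t = - t + 2 * t\<^sup>2 / d - t ^ 3 / d\<^sup>2" for t
  define \<psi>1 where "\<psi>1 t = - 1 + 4 * t / d - 3 * t\<^sup>2 / d\<^sup>2" for t
  define \<psi>2 where "\<psi>2 t = 4 / d - 6 * t / d\<^sup>2" for t
  have "norm (\<psi>1 d *\<^sub>R y b - \<psi> d *\<^sub>R y' b - (\<psi>1 0 *\<^sub>R y a - \<psi> 0 *\<^sub>R y' a)) \<le> (6 / d + d) * (sqrt d * e)"
  proof (rule est)
    show "(\<psi> has_real_derivative \<psi>1 t) (at t)" "(\<psi>1 has_real_derivative \<psi>2 t) (at t)" for t
      unfolding \<psi>_def[abs_def] \<psi>1_def[abs_def] \<psi>2_def using d
      by (auto intro!: derivative_eq_intros simp: field_simps power2_eq_square)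
    show "continuous_on UNIV \<psi>2"
      unfolding \<psi>2_def[abs_def] using d by (auto intro!: continuous_intros)
    fix t assume t: "0 \<le> t" "t \<le> d"
    have "\<psi>2 t = (4 - 6 * (t / d)) / d" using d by (simp add: \<psi>2_def field_simps power2_eq_square)
    moreover have "t / d \<le> 1" "0 \<le> t / d" using t d by auto
    then have "\<bar>4 - 6 * (t / d)\<bar> \<le> 6" by linarith
    ultimately have 1: "\<bar>\<psi>2 t\<bar> \<le> 6 / d" using d by (simp add: abs_divide divide_right_mono)
    have "\<psi> t = - t * (1 - t / d)\<^sup>2" using d by (simp add: \<psi>_def field_simps power2_eq_square power3_eq_cube)
    then have "\<bar>\<psi> t\<bar> = t * (1 - t / d)\<^sup>2" using t by (simp add: abs_mult)
    also have "\<dots> \<le> d * 1"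
      using t \<open>t / d \<le> 1\<close> \<open>0 \<le> t / d\<close> by (intro mult_mono power_le_one) auto
    finally show "\<bar>\<psi>2 t\<bar> + \<bar>\<psi> t\<bar> \<le> 6 / d + d" using 1 by simp
  qed
  moreover have "\<psi>1 d = 0" "\<psi> d = 0" "\<psi>1 0 = - 1" "\<psi> 0 = 0"
    using d by (simp_all add: \<psi>1_def \<psi>_def power2_eq_square power3_eq_cube)
  ultimately have "norm (y a) \<le> (6 / d + d) * (sqrt d * e)" by simp
  then have "norm (sqrt d *\<^sub>R y a) \<le> sqrt d * ((6 / d + d) * (sqrt d * e))"
    using d by (simp add: mult_left_mono)
  also have "\<dots> = (sqrt d * sqrt d) * (6 / d + d) * e" by (simp only: mult_ac)
  also have "\<dots> = (6 + d\<^sup>2) * e"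
    unfolding sq using d by (simp add: field_simps power2_eq_square)
  also have "\<dots> \<le> (6 + D\<^sup>2) * e" by (rule le) simp
  finally show "norm (sqrt d *\<^sub>R y a) \<le> (6 + D\<^sup>2) * e" .

  \<comment> \<open>The Hermite cubic with value -1 and slope 0 at d and with zero data at 0, so
    only \<open>y' b\<close> survives.\<close>
  define \<phi> where "\<phi> t = 2 * t ^ 3 / d ^ 3 - 3 * t\<^sup>2 / d\<^sup>2" for t
  define \<phi>1 where "\<phi>1 t = 6 * t\<^sup>2 / d ^ 3 - 6 * t / d\<^sup>2" for t
  define \<phi>2 where "\<phi>2 t = 12 * t / d ^ 3 - 6 / d\<^sup>2" for t
  have "norm (\<phi>1 d *\<^sub>R y b - \<phi> d *\<^sub>R y' b - (\<phi>1 0 *\<^sub>R y a - \<phi> 0 *\<^sub>R y' a)) \<le> (6 / d\<^sup>2 + 1) * (sqrt d * e)"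
  proof (rule est)
    show "(\<phi> has_real_derivative \<phi>1 t) (at t)" "(\<phi>1 has_real_derivative \<phi>2 t) (at t)" for t
      unfolding \<phi>_def[abs_def] \<phi>1_def[abs_def] \<phi>2_def using d
      by (auto intro!: derivative_eq_intros simp: field_simps power2_eq_square power3_eq_cube)
    show "continuous_on UNIV \<phi>2"
      unfolding \<phi>2_def[abs_def] using d by (auto intro!: continuous_intros)
    fix t assume t: "0 \<le> t" "t \<le> d"
    define \<tau> where "\<tau> = t / d"
    have \<tau>: "0 \<le> \<tau>" "\<tau> \<le> 1" "t = \<tau> * d" using t d by (auto simp: \<tau>_def)
    have "\<phi>2 t = (12 * \<tau> - 6) / d\<^sup>2"
      using d by (simp add: \<phi>2_def \<tau>(3) field_simps power2_eq_square power3_eq_cube)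
    moreover have "\<bar>12 * \<tau> - 6\<bar> \<le> 6" using \<tau> by linarith
    ultimately have 1: "\<bar>\<phi>2 t\<bar> \<le> 6 / d\<^sup>2" using d by (simp add: abs_divide divide_right_mono)
    have "\<phi> t = \<tau>\<^sup>2 * (2 * \<tau> - 3)"
      using d by (simp add: \<phi>_def \<tau>(3) field_simps power2_eq_square power3_eq_cube)
    moreover have "\<tau>\<^sup>2 * (3 - 2 * \<tau>) \<le> 1"
    proof -
      have "1 - \<tau>\<^sup>2 * (3 - 2 * \<tau>) = (1 - \<tau>)\<^sup>2 * (1 + 2 * \<tau>)"
        by (simp add: power2_eq_square algebra_simps)
      moreover have "0 \<le> (1 - \<tau>)\<^sup>2 * (1 + 2 * \<tau>)" using \<tau> by (intro mult_nonneg_nonneg) auto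
      ultimately show ?thesis by linarith
    qed
    moreover have "0 \<le> \<tau>\<^sup>2 * (3 - 2 * \<tau>)" using \<tau> by (intro mult_nonneg_nonneg) auto
    ultimately have "\<bar>\<phi> t\<bar> \<le> 1" by (simp add: algebra_simps)
    then show "\<bar>\<phi>2 t\<bar> + \<bar>\<phi> t\<bar> \<le> 6 / d\<^sup>2 + 1" using 1 by simp
  qed
  moreover have "\<phi>1 d = 0" "\<phi> d = - 1" "\<phi>1 0 = 0" "\<phi> 0 = 0"
    using d by (simp_all add: \<phi>1_def \<phi>_def power2_eq_square power3_eq_cube)
  ultimately have "norm (y' b) \<le> (6 / d\<^sup>2 + 1) * (sqrt d * e)" by simp
  then have "norm ((d * sqrt d) *\<^sub>R y' b) \<le> (d * sqrt d) * ((6 / d\<^sup>2 + 1) * (sqrt d * e))"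
    using d by (simp add: abs_mult mult_left_mono)
  also have "\<dots> = (sqrt d * sqrt d) * d * (6 / d\<^sup>2 + 1) * e" by (simp only: mult_ac)
  also have "\<dots> = (6 + d\<^sup>2) * e"
    unfolding sq using d by (simp add: field_simps power2_eq_square)
  also have "\<dots> \<le> (6 + D\<^sup>2) * e" by (rule le) simp
  finally show "norm ((d * sqrt d) *\<^sub>R y' b) \<le> (6 + D\<^sup>2) * e" .
qed

subsection \<open>Integrals over the half-line\<close>

lemma spike_0:
  fixes f :: "real \<Rightarrow> 'a :: euclidean_space"
  shows "f absolutely_integrable_on {0<..} \<longleftrightarrow> f absolutely_integrable_on {0..}"
    and "integral {0<..} f = integral {0..} f"
proof -
  have sub: "{x \<in> {0<..} - {0..}. f x \<noteq> 0} \<subseteq> {0}" "{x \<in> {0..} - {0<..}. f x \<noteq> 0} \<subseteq> {0}"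
    by auto
  show "f absolutely_integrable_on {0<..} \<longleftrightarrow> f absolutely_integrable_on {0..}"
    by (rule absolutely_integrable_spike_set_eq; rule negligible_subset[OF _ sub(1)] negligible_subset[OF _ sub(2)]) auto
  show "integral {0<..} f = integral {0..} f"
    by (rule integral_spike_set; rule negligible_subset[OF _ sub(1)] negligible_subset[OF _ sub(2)]) auto
qed

lemma integrable_half_line:
  fixes f :: "real \<Rightarrow> 'a :: euclidean_space"
  shows "integrable half_line f \<longleftrightarrow> f absolutely_integrable_on {0..}"
  unfolding spike_0(1)[symmetric] unfolding set_integrable_def by (rule integrable_restrict_space) simp

lemma integral_half_line:
  fixes f :: "real \<Rightarrow> 'a :: euclidean_space"
  assumes "integrable half_line f"
  shows "(\<integral>t. f t \<partial>half_line) = integral {0..} f"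
proof -
  have "(\<integral>t. f t \<partial>half_line) = set_lebesgue_integral lebesgue {0<..} f"
    unfolding set_lebesgue_integral_def by (rule integral_restrict_space) simp
  also have "\<dots> = integral {0<..} f"
    using assms by (intro set_lebesgue_integral_eq_integral(2)) (simp add: integrable_half_line spike_0)
  finally show ?thesis by (simp add: spike_0)
qed

lemma integral_half_line_limit:
  fixes f :: "real \<Rightarrow> 'a :: euclidean_space"
  assumes f: "integrable half_line f" and X: "filterlim X at_top F"
  shows "((\<lambda>N. integral {0..X N} f) \<longlongrightarrow> (\<integral>t. f t \<partial>half_line)) F"
proof -
  have abs: "f absolutely_integrable_on {0..}" using f by (simp add: integrable_half_line)
  have "((\<lambda>b. set_lebesgue_integral lebesgue {0..b} f) \<longlongrightarrow> set_lebesgue_integral lebesgue {0..} f) at_top"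
    by (rule tendsto_set_lebesgue_integral_at_top) (use abs in auto)
  moreover have "set_lebesgue_integral lebesgue {0..b} f = integral {0..b} f" for b
    by (rule set_lebesgue_integral_eq_integral(2)) (rule set_integrable_subset[OF abs], auto)
  moreover have "set_lebesgue_integral lebesgue {0..} f = (\<integral>t. f t \<partial>half_line)"
    using abs by (simp add: integral_half_line[OF f] set_lebesgue_integral_eq_integral(2))
  ultimately have "((\<lambda>b. integral {0..b} f) \<longlongrightarrow> (\<integral>t. f t \<partial>half_line)) at_top" by simp
  then show ?thesis by (rule filterlim_compose[OF _ X])
qed

lemma integral_sq_hdot:
  fixes y :: "real \<Rightarrow> complex ^ 'p"
  assumes "(\<lambda>t. (norm (y t))\<^sup>2) integrable_on S"
  shows "integral S (\<lambda>t. hdot (y t) (y t)) = of_real (integral S (\<lambda>t. (norm (y t))\<^sup>2))"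
proof -
  have "integral S (of_real \<circ> (\<lambda>t. (norm (y t))\<^sup>2)) = (of_real (integral S (\<lambda>t. (norm (y t))\<^sup>2)) :: complex)"
    by (rule integral_linear[OF assms bounded_linear_of_real])
  then show ?thesis by (simp add: o_def hdot_self)
qed

subsection \<open>The Schroedinger operator with \<open>\<delta>\<close>-interactions\<close>

text \<open>The state (f(x), f'(x+)) at the nodes of the solution with f(0) = \<open>c\<close> and
  f'(0) = 0. The slope is the one to the right of the node, after the jump.\<close>

primrec hstate ::
    "(nat \<Rightarrow> real) \<Rightarrow> (nat \<Rightarrow> complex ^ 'p ^ 'p) \<Rightarrow> complex \<Rightarrow> complex ^ 'p \<Rightarrow> nat
      \<Rightarrow> (complex ^ 'p) \<times> (complex ^ 'p)" where
  "hstate X \<Lambda> z c 0 = (c, 0)"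
| "hstate X \<Lambda> z c (Suc k) =
     (let a = piece z (X k) (fst (hstate X \<Lambda> z c k)) (snd (hstate X \<Lambda> z c k)) (X (Suc k));
          b = dpiece z (X k) (fst (hstate X \<Lambda> z c k)) (snd (hstate X \<Lambda> z c k)) (X (Suc k))
      in (a, b + \<Lambda> (Suc k) *v a))"

lemma clin_hstate: "clin (\<lambda>c. fst (hstate X \<Lambda> z c k)) \<and> clin (\<lambda>c. snd (hstate X \<Lambda> z c k))"
  by (induction k) (auto simp: Let_def intro!: clin_intros clin_piece)

locale delta_interactions =
  fixes X :: "nat \<Rightarrow> real" and \<Lambda> :: "nat \<Rightarrow> complex ^ 'p ^ 'p"
  assumes mono: "strict_mono X" and X0: "X 0 = 0" and X_lim: "filterlim X at_top sequentially"
    and hermitian: "k \<ge> 1 \<Longrightarrow> \<Lambda> k = map_matrix cnj (transpose (\<Lambda> k))"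
begin

abbreviation "P z c k \<equiv> fst (hstate X \<Lambda> z c k)"

abbreviation "Q z c k \<equiv> snd (hstate X \<Lambda> z c k)"

abbreviation "pc z c k \<equiv> piece z (X k) (P z c k) (Q z c k)"

abbreviation "dpc z c k \<equiv> dpiece z (X k) (P z c k) (Q z c k)"

text \<open>Cells are taken half-open, closed on the right. Continuity at the nodes later removes
  this choice: \<open>usol_on\<close> holds on closed cells.\<close>

definition idx :: "real \<Rightarrow> nat" where "idx t = (LEAST k. t \<le> X (Suc k))"

definition usol :: "complex \<Rightarrow> complex ^ 'p \<Rightarrow> real \<Rightarrow> complex ^ 'p" where
  "usol z c t = pc z c (idx t) t"

text \<open>Indexed by the right end of the cell, to match the sums from 1 to \<open>N\<close> in
  \<open>weyl_system\<close>.\<close>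

definition cell :: "complex \<Rightarrow> nat \<Rightarrow> complex ^ 'p \<Rightarrow> real" where
  "cell z k c = sqrt (integral {X (k - 1)..X k} (\<lambda>t. (norm (pc z c (k - 1) t))\<^sup>2))"

lemma X_less: "X k < X (Suc k)"
  using mono by (simp add: strict_mono_Suc_iff)

lemma X_mono: "j \<le> k \<Longrightarrow> X j \<le> X k"
  using mono by (simp add: strict_mono_less_eq)

lemma X_nonneg: "0 \<le> X k"
  using X_mono[of 0 k] X0 by simp

lemma X_unbounded: "\<exists>N. t < X N"
  using filterlim_at_top_dense[THEN iffD1, OF X_lim, rule_format, of t]
  by (auto simp: eventually_sequentially)

lemma idx_eq:
  assumes "X k < t" "t \<le> X (Suc k)"
  shows "idx t = k"
  unfolding idx_def
proof (rule Least_equality)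
  fix j assume "t \<le> X (Suc j)"
  then have "X k < X (Suc j)" using assms by linarith
  then show "k \<le> j" using mono by (simp add: strict_mono_less)
qed fact

lemma idx_bounds:
  assumes "0 < t"
  shows "X (idx t) < t" "t \<le> X (Suc (idx t))"
proof -
  obtain N where "t < X N" using X_unbounded by blast
  then have "t \<le> X (Suc N)" using X_less[of N] by linarith
  then show "t \<le> X (Suc (idx t))" unfolding idx_def by (rule LeastI)
  show "X (idx t) < t"
  proof (cases "idx t")
    case (Suc j)
    then have "\<not> t \<le> X (Suc j)" using not_less_Least[of j "\<lambda>k. t \<le> X (Suc k)"] by (simp add: idx_def)
    then show ?thesis using Suc by simp
  qed (use assms X0 in simp)
qed

lemma clin_P: "clin (\<lambda>c. P z c k)" "clin (\<lambda>c. Q z c k)"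
  using clin_hstate by auto

lemma P_Suc: "P z c (Suc k) = pc z c k (X (Suc k))"
  "Q z c (Suc k) = dpc z c k (X (Suc k)) + \<Lambda> (Suc k) *v P z c (Suc k)"
  by (simp_all add: Let_def)

declare hstate.simps(2) [simp del]

lemma clin_usol: "clin (\<lambda>c. usol z c t)"
  unfolding usol_def by (intro clin_piece clin_P)

lemma usol_on:
  assumes "t \<in> {X k..X (Suc k)}"
  shows "usol z c t = pc z c k t"
proof (cases "X k < t")
  case True
  then show ?thesis using idx_eq[of k t] assms by (simp add: usol_def)
next
  case False
  then have t: "t = X k" using assms by simp
  show ?thesis
  proof (cases k)
    case 0
    have "idx t = 0" unfolding idx_def by (rule Least_eq_0) (use assms 0 in auto)
    then show ?thesis by (simp add: usol_def 0)
  next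
    case (Suc j)
    have "idx t = j" using idx_eq[of j t] t Suc X_less[of j] by simp
    then show ?thesis using P_Suc(1)[of z c j] by (simp add: usol_def t Suc)
  qed
qed

lemma continuous_on_mesh:
  fixes f :: "real \<Rightarrow> 'a :: topological_space"
  assumes "\<And>k. continuous_on {X k..X (Suc k)} f"
  shows "continuous_on {0..} f"
proof -
  have on: "continuous_on {0..X N} f" for N
  proof (induction N)
    case (Suc N)
    have "{0..X (Suc N)} = {0..X N} \<union> {X N..X (Suc N)}"
      using X_nonneg[of N] X_less[of N] by auto
    then show ?case using Suc assms[of N] by (simp add: continuous_on_closed_Un)
  qed (simp add: X0)
  show ?thesis
    unfolding continuous_on_eq_continuous_within
  proof
    fix t :: real assume t: "t \<in> {0..}"
    obtain N where N: "t < X N" using X_unbounded by blast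
    have "at t within {0..} = at t within {0..X N}"
      by (rule at_within_nhd[of _ "{..<X N}"]) (use N in auto)
    moreover have "continuous (at t within {0..X N}) f"
      using on[of N] t N by (simp add: continuous_on_eq_continuous_within)
    ultimately show "continuous (at t within {0..}) f" by simp
  qed
qed

lemma integral_mesh:
  fixes f :: "real \<Rightarrow> 'a :: banach"
  assumes "\<And>k. k < N \<Longrightarrow> f integrable_on {X k..X (Suc k)}"
  shows "f integrable_on {0..X N} \<and> integral {0..X N} f = (\<Sum>k<N. integral {X k..X (Suc k)} f)"
  using assms
proof (induction N)
  case (Suc N)
  then have IH: "f integrable_on {0..X N}" "integral {0..X N} f = (\<Sum>k<N. integral {X k..X (Suc k)} f)"
    by auto
  have last: "f integrable_on {X N..X (Suc N)}" using Suc.prems by simp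
  then have on: "f integrable_on {0..X (Suc N)}"
    using X_nonneg[of N] X_less[of N]
    by (intro Henstock_Kurzweil_Integration.integrable_combine[OF _ _ IH(1) last]) auto
  moreover have "integral {0..X N} f + integral {X N..X (Suc N)} f = integral {0..X (Suc N)} f"
    using X_nonneg[of N] X_less[of N] on by (intro Henstock_Kurzweil_Integration.integral_combine) auto
  ultimately show ?case using IH(2) by simp
qed (use integrable_on_refl[of f "0 :: real"] in \<open>simp add: X0\<close>)

lemma continuous_usol: "continuous_on {0..} (usol z c)" if "z \<noteq> 0"
proof (rule continuous_on_mesh)
  fix k
  show "continuous_on {X k..X (Suc k)} (usol z c)"
    by (rule continuous_on_eq[OF classicalD(3)[OF classical_piece[OF that]]]) (rule usol_on[symmetric])
qed

lemma measurable_half_line: "continuous_on {0..} f \<Longrightarrow> f \<in> borel_measurable half_line"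
  by (rule continuous_imp_measurable_on_sets_lebesgue) (auto elim: continuous_on_subset)

text \<open>Since \<open>\<Lambda> k\<close> is Hermitian, the jump preserves the bracket, so the
  nodes contribute nothing to Green's identity.\<close>

lemma omega_jump:
  assumes "k \<ge> 1"
  shows "omega a (b + \<Lambda> k *v a) a' (b' + \<Lambda> k *v a') = omega a b a' b'"
  using hdot_matrix[OF hermitian[OF assms], of a a'] by (simp add: omega_def hdot_add)

lemma omega_Suc:
  assumes "z \<noteq> 0" "\<zeta> \<noteq> 0"
  shows "omega (P z c (Suc k)) (Q z c (Suc k)) (P \<zeta> c' (Suc k)) (Q \<zeta> c' (Suc k))
      - omega (P z c k) (Q z c k) (P \<zeta> c' k) (Q \<zeta> c' k)
    = (z - cnj \<zeta>) * integral {X k..X (Suc k)} (\<lambda>t. hdot (pc z c k t) (pc \<zeta> c' k t))"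
proof -
  have le: "X k \<le> X (Suc k)" using X_less[of k] by simp
  have "omega (pc z c k (X (Suc k))) (dpc z c k (X (Suc k))) (pc \<zeta> c' k (X (Suc k))) (dpc \<zeta> c' k (X (Suc k)))
      - omega (pc z c k (X k)) (dpc z c k (X k)) (pc \<zeta> c' k (X k)) (dpc \<zeta> c' k (X k))
    = integral {X k..X (Suc k)} (\<lambda>t. hdot (- (- (z *s pc z c k t)) - cnj \<zeta> *s pc z c k t) (pc \<zeta> c' k t))"
    by (rule green_ac(2)[OF classical_ac_on[OF classical_piece[OF assms(1)] le]
          classical_piece[OF assms(2)] le])
  also have "(\<lambda>t. hdot (- (- (z *s pc z c k t)) - cnj \<zeta> *s pc z c k t) (pc \<zeta> c' k t))
      = (\<lambda>t. (z - cnj \<zeta>) * hdot (pc z c k t) (pc \<zeta> c' k t))"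
    by (simp add: hdot_diff hdot_scale algebra_simps)
  finally show ?thesis
    unfolding P_Suc(2) omega_jump[of "Suc k", simplified] by (simp add: P_Suc(1))
qed

text \<open>There is no contribution from 0, because both solutions have slope 0 there.\<close>

lemma omega_telescope:
  assumes "z \<noteq> 0" "\<zeta> \<noteq> 0"
  shows "omega (P z c N) (Q z c N) (P \<zeta> c' N) (Q \<zeta> c' N)
    = (z - cnj \<zeta>) * (\<Sum>k<N. integral {X k..X (Suc k)} (\<lambda>t. hdot (pc z c k t) (pc \<zeta> c' k t)))"
proof (induction N)
  case (Suc N)
  then show ?case
    using omega_Suc[OF assms, of c N c'] unfolding sum.lessThan_Suc distrib_left
    by (simp add: diff_eq_eq)
qed (simp add: omega_def)

lemma pc_sq_integrable: "(\<lambda>t. (norm (pc z c k t))\<^sup>2) integrable_on {a..b}" if "z \<noteq> 0"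
  by (intro integrable_continuous_real continuous_intros classicalD(3)[OF classical_piece[OF that]])

lemma cell_sq:
  assumes "z \<noteq> 0"
  shows "(cell z (Suc k) c)\<^sup>2 = integral {X k..X (Suc k)} (\<lambda>t. (norm (pc z c k t))\<^sup>2)"
  unfolding cell_def using pc_sq_integrable[OF assms]
  by (simp add: Henstock_Kurzweil_Integration.integral_nonneg)

lemma sum_cell: "(\<Sum>k\<in>{1..N}. (cell z k c)\<^sup>2) = (\<Sum>k<N. (cell z (Suc k) c)\<^sup>2)"
  by (simp add: sum.atLeast1_atMost_eq)

lemma omega_self_cell:
  assumes "z \<noteq> 0"
  shows "omega (P z c N) (Q z c N) (P z c N) (Q z c N) = (z - cnj z) * (\<Sum>k\<in>{1..N}. (cell z k c)\<^sup>2)"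
  unfolding omega_telescope[OF assms assms] sum_cell
  by (simp add: integral_sq_hdot pc_sq_integrable[OF assms] cell_sq[OF assms])

lemma cell_estimate:
  assumes z: "norm z = 1" and D: "X (Suc k) - X k \<le> D"
  defines "d \<equiv> X (Suc k) - X k"
  shows "norm (sqrt d *\<^sub>R P z c k) \<le> (6 + D\<^sup>2) * cell z (Suc k) c"
    and "norm ((d * sqrt d) *\<^sub>R dpc z c k (X (Suc k))) \<le> (6 + D\<^sup>2) * cell z (Suc k) c"
    and "norm ((1 / sqrt d) *\<^sub>R (Q z c k - dpc z c k (X (Suc k)))) \<le> (6 + D\<^sup>2) * cell z (Suc k) c"
    and "norm ((1 / (d * sqrt d)) *\<^sub>R (P z c (Suc k) - P z c k - d *\<^sub>R dpc z c k (X (Suc k))))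
      \<le> (6 + D\<^sup>2) * cell z (Suc k) c"
proof -
  have "z \<noteq> 0" using z by auto
  note est = interval_estimate[OF classical_piece[OF this] z X_less D, of "X k" "P z c k" "Q z c k", folded d_def]
  show "norm (sqrt d *\<^sub>R P z c k) \<le> (6 + D\<^sup>2) * cell z (Suc k) c"
    "norm ((d * sqrt d) *\<^sub>R dpc z c k (X (Suc k))) \<le> (6 + D\<^sup>2) * cell z (Suc k) c"
    "norm ((1 / sqrt d) *\<^sub>R (Q z c k - dpc z c k (X (Suc k)))) \<le> (6 + D\<^sup>2) * cell z (Suc k) c"
    "norm ((1 / (d * sqrt d)) *\<^sub>R (P z c (Suc k) - P z c k - d *\<^sub>R dpc z c k (X (Suc k))))
      \<le> (6 + D\<^sup>2) * cell z (Suc k) c"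
    using est by (simp_all add: cell_def P_Suc(1))
qed

text \<open>\<open>c\<close> is the value at the left end of the first cell, which the norm on that
  cell controls.\<close>

lemma cell_definite:
  assumes "norm z = 1" "cell z 1 c = 0"
  shows "c = 0"
  using cell_estimate(1)[OF assms(1), of 0 "X 1 - X 0" c] assms(2) X_less[of 0]
  by (simp add: mult_le_0_iff)

lemma weyl:
  fixes s :: real
  assumes s: "s = 1 \<or> s = - 1"
  shows "weyl_system s (\<lambda>N c. P (\<i> * s) c N) (\<lambda>N c. Q (\<i> * s) c N)
    (\<lambda>N c. P (- \<i> * s) c N) (\<lambda>N c. Q (- \<i> * s) c N) (cell (\<i> * s)) (cell (- \<i> * s))"
proof (rule weyl_system.intro)
  have nz: "\<i> * complex_of_real s \<noteq> 0" "- \<i> * complex_of_real s \<noteq> 0"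
    and norm: "norm (\<i> * complex_of_real s) = 1" "norm (- \<i> * complex_of_real s) = 1"
    using s by (auto simp: norm_mult)
  show "s = 1 \<or> s = - 1" by fact
  show "clin (\<lambda>c. P (\<i> * s) c N)" "clin (\<lambda>c. Q (\<i> * s) c N)"
    "clin (\<lambda>c. P (- \<i> * s) c N)" "clin (\<lambda>c. Q (- \<i> * s) c N)" for N
    by (rule clin_P)+
  show "omega (P (\<i> * s) c N) (Q (\<i> * s) c N) (P (\<i> * s) c N) (Q (\<i> * s) c N)
      = 2 * \<i> * s * (\<Sum>k\<in>{1..N}. (cell (\<i> * s) k c)\<^sup>2)" for N c
    unfolding omega_self_cell[OF nz(1)] by simp
  show "omega (P (- \<i> * s) c N) (Q (- \<i> * s) c N) (P (- \<i> * s) c N) (Q (- \<i> * s) c N)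
      = - 2 * \<i> * s * (\<Sum>k\<in>{1..N}. (cell (- \<i> * s) k c)\<^sup>2)" for N c
    unfolding omega_self_cell[OF nz(2)] by simp
  show "omega (P (\<i> * s) c N) (Q (\<i> * s) c N) (P (- \<i> * s) c' N) (Q (- \<i> * s) c' N) = 0" for N c c'
    unfolding omega_telescope[OF nz] by simp
  have nonneg: "cell z k c \<ge> 0" if "z \<noteq> 0" for z k c
    unfolding cell_def
    by (intro real_sqrt_ge_zero Henstock_Kurzweil_Integration.integral_nonneg pc_sq_integrable that) simp
  show "cell (\<i> * s) k c \<ge> 0" for k c by (rule nonneg[OF nz(1)])
  show "c = 0" if "cell (\<i> * s) 1 c = 0" for c by (rule cell_definite[OF norm(1) that])
  show "c = 0" if "cell (- \<i> * s) 1 c = 0" for c by (rule cell_definite[OF norm(2) that])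
qed

lemma usol_sq_integral:
  assumes "z \<noteq> 0"
  shows "integral {0..X N} (\<lambda>t. (norm (usol z c t))\<^sup>2) = (\<Sum>k\<in>{1..N}. (cell z k c)\<^sup>2)"
proof -
  have "(\<lambda>t. (norm (usol z c t))\<^sup>2) integrable_on {X k..X (Suc k)}" for k
    using X_nonneg[of k] by (intro integrable_continuous_real continuous_intros
        continuous_on_subset[OF continuous_usol[OF assms]]) auto
  then have "integral {0..X N} (\<lambda>t. (norm (usol z c t))\<^sup>2)
      = (\<Sum>k<N. integral {X k..X (Suc k)} (\<lambda>t. (norm (usol z c t))\<^sup>2))"
    using integral_mesh by blast
  also have "\<dots> = (\<Sum>k<N. (cell z (Suc k) c)\<^sup>2)"
    unfolding cell_sq[OF assms] by (intro sum.cong integral_cong refl) (simp add: usol_on)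
  finally show ?thesis unfolding sum_cell .
qed

text \<open>Monotone convergence along the mesh. It identifies square-integrability with the bounded
  energy in \<open>weyl_system.solutions\<close>.\<close>

lemma L2_half_line:
  assumes y: "continuous_on {0..} y"
  shows "y \<in> L2 half_line \<longleftrightarrow> (\<exists>C. \<forall>N. integral {0..X N} (\<lambda>t. (norm (y t))\<^sup>2) \<le> C)"
proof
  let ?f = "\<lambda>t. (norm (y t))\<^sup>2"
  have int: "?f integrable_on {0..X N}" for N
    by (intro integrable_continuous_real continuous_intros continuous_on_subset[OF y]) auto
  show "\<exists>C. \<forall>N. integral {0..X N} ?f \<le> C" if L2: "y \<in> L2 half_line"
  proof -
    have "integrable half_line ?f" using L2 by (simp add: L2_def)
    then have i: "?f integrable_on {0..}"
      by (auto simp: integrable_half_line intro: set_lebesgue_integral_eq_integral(1))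
    have "integral {0..X N} ?f \<le> integral {0..} ?f" for N
      by (rule integral_subset_le) (use int i in auto)
    then show ?thesis by blast
  qed
  show "y \<in> L2 half_line" if bdd: "\<exists>C. \<forall>N. integral {0..X N} ?f \<le> C"
  proof -
    obtain C where C: "\<And>N. integral {0..X N} ?f \<le> C" using bdd by blast
    let ?g = "\<lambda>N t. if t \<in> {0..X N} then ?f t else 0"
    have Int: "{0..} \<inter> {0..X N} = {0..X N}" "{0..X N} \<inter> {0..} = {0..X N}" for N by auto
    have "?f integrable_on {0..} \<and> ((\<lambda>N. integral {0..} (?g N)) \<longlonglongrightarrow> integral {0..} ?f)"
    proof (rule monotone_convergence_increasing)
      show "?g N integrable_on {0..}" for N
        using int[of N] by (simp only: integrable_restrict_Int Int)
      show "?g N t \<le> ?g (Suc N) t" for N t using X_less[of N] by auto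
      show "(\<lambda>N. ?g N t) \<longlonglongrightarrow> ?f t" if t: "t \<in> {0..}" for t
      proof (rule tendsto_eventually)
        have "\<forall>\<^sub>F N in sequentially. t < X N"
          using filterlim_at_top_dense[THEN iffD1, OF X_lim] by blast
        then show "\<forall>\<^sub>F N in sequentially. ?g N t = ?f t"
          by eventually_elim (use t in auto)
      qed
      have "integral {0..X N} ?f \<ge> 0" for N
        by (rule Henstock_Kurzweil_Integration.integral_nonneg[OF int]) simp
      then show "bounded (range (\<lambda>N. integral {0..} (?g N)))"
        unfolding integral_restrict_Int Int using C by (auto intro!: boundedI[of _ C])
    qed
    then have "?f absolutely_integrable_on {0..}"
      by (intro nonnegative_absolutely_integrable_1) auto
    then show ?thesis
      using measurable_half_line[OF y] by (simp add: L2_def integrable_half_line)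
  qed
qed

lemma solutions_eq:
  fixes s :: real
  assumes s: "s = 1 \<or> s = - 1"
  shows "weyl_system.solutions (cell (\<i> * s)) = {c. usol (\<i> * s) c \<in> L2 half_line}"
proof -
  interpret weyl_system s "\<lambda>N c. P (\<i> * s) c N" "\<lambda>N c. Q (\<i> * s) c N"
    "\<lambda>N c. P (- \<i> * s) c N" "\<lambda>N c. Q (- \<i> * s) c N" "cell (\<i> * s)" "cell (- \<i> * s)"
    by (rule weyl[OF s])
  have "\<i> * complex_of_real s \<noteq> 0" using s by auto
  then show ?thesis
    unfolding solutions_def E_def by (simp add: L2_half_line continuous_usol usol_sq_integral)
qed

lemma subspace_L2_solutions:
  fixes s :: real
  assumes "s = 1 \<or> s = - 1"
  shows "vec.subspace {c. usol (\<i> * s) c \<in> L2 half_line}"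
  using weyl_system.subspace_solutions[OF weyl[OF assms]] solutions_eq[OF assms] by simp

end

section \<open>Restriction to cells, variation of constants and one-sided limits\<close>

lemma L2_subset:
  fixes f :: "real \<Rightarrow> complex ^ 'p"
  assumes f: "f \<in> L2 half_line" and a: "0 \<le> a"
  shows "f \<in> L2 (lebesgue_on {a<..<b})"
proof -
  have sub: "{a<..<b} \<subseteq> {0<..}" using a by auto
  have "f \<in> borel_measurable (lebesgue_on {a<..<b})"
    using f by (intro measurable_restrict_mono[OF _ sub]) (simp add: L2_def)
  moreover have "integrable (lebesgue_on {a<..<b}) (\<lambda>t. (norm (f t))\<^sup>2)"
  proof -
    have "(\<lambda>t. (norm (f t))\<^sup>2) absolutely_integrable_on {0..}"
      using f by (simp add: L2_def integrable_half_line)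
    then have "(\<lambda>t. (norm (f t))\<^sup>2) absolutely_integrable_on {a<..<b}"
      by (rule set_integrable_subset) (use a in auto)
    then show ?thesis unfolding set_integrable_def by (subst integrable_restrict_space) auto
  qed
  ultimately show ?thesis by (simp add: L2_def)
qed

lemma L2_cong_half_line:
  assumes "f \<in> L2 half_line" "\<And>t. t > 0 \<Longrightarrow> f t = g t"
  shows "g \<in> L2 half_line"
proof -
  have "g \<in> borel_measurable half_line \<longleftrightarrow> f \<in> borel_measurable half_line"
    by (rule measurable_cong) (use assms(2) in simp)
  moreover have "integrable half_line (\<lambda>t. (norm (g t))\<^sup>2) \<longleftrightarrow> integrable half_line (\<lambda>t. (norm (f t))\<^sup>2)"
    by (rule Bochner_Integration.integrable_cong[OF refl]) (use assms(2) in simp)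
  ultimately show ?thesis using assms(1) by (simp add: L2_def)
qed

lemma absolutely_integrable_vscale:
  fixes h :: "real \<Rightarrow> complex ^ 'p"
  assumes "continuous_on {p..q} \<phi>" "h absolutely_integrable_on {p..q}"
  shows "(\<lambda>t. \<phi> t *s h t) absolutely_integrable_on {p..q}"
proof (rule absolutely_integrable_bounded_measurable_product[of "(*s)" \<phi> "{p..q}" h])
  show "bilinear ((*s) :: complex \<Rightarrow> complex ^ 'p \<Rightarrow> complex ^ 'p)"
    by (simp add: bilinear_conv_bounded_bilinear bounded_bilinear_vscale)
  show "\<phi> \<in> borel_measurable (lebesgue_on {p..q})"
    by (rule continuous_imp_measurable_on_sets_lebesgue[OF assms(1)]) simp
  show "bounded (\<phi> ` {p..q})"
    by (intro compact_imp_bounded compact_continuous_image assms) auto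
qed (use assms in auto)

lemma ac_on_antiderivative:
  assumes "v absolutely_integrable_on {p..q}"
  shows "ac_on p q (\<lambda>t. A - integral {p..q} v + integral {p..t} v) v"
  using assms by (simp add: ac_on_def)

text \<open>Variation of constants with data at the right end: the coefficients \<alpha> and \<beta>
  of the fundamental system centred at \<open>q\<close> have the derivatives \<open>S\<close> h and
  - \<open>C\<close> h.\<close>

lemma inhomogeneous_solution:
  fixes h :: "real \<Rightarrow> complex ^ 'p"
  assumes \<zeta>: "\<zeta> \<noteq> 0" and pq: "p \<le> q" and h: "h absolutely_integrable_on {p..q}"
  shows "\<exists>y y1. ac_on p q y y1 \<and> ac_on p q y1 (\<lambda>t. - (\<zeta> *s y t) - h t) \<and> y q = A \<and> y1 q = B"
proof -
  define C where "C t = cosz \<zeta> (t - q)" for t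
  define S where "S t = sinz \<zeta> (t - q)" for t
  note d = cosz_sinz_derivative[OF \<zeta>, of q]
  have cont: "continuous_on {p..q} C" "continuous_on {p..q} S"
    unfolding C_def[abs_def] S_def[abs_def]
    by (auto intro!: continuous_at_imp_continuous_on has_vector_derivative_continuous d)
  have acC: "ac_on p q C (\<lambda>t. - (\<zeta> * S t))" and acS: "ac_on p q S C"
    by (rule ac_on_C1; use pq cont d in \<open>auto simp: C_def[abs_def] S_def[abs_def] intro!: continuous_intros\<close>)+
  have acS': "ac_on p q (\<lambda>t. - (\<zeta> * S t)) (\<lambda>t. - (\<zeta> * C t))"
    unfolding C_def S_def
    by (rule ac_on_C1[OF pq])
      (use cont in \<open>auto simp: C_def[abs_def] intro!: continuous_intros has_vector_derivative_minus has_vector_derivative_mult_right d\<close>)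
  have "(\<lambda>t. S t *s h t) absolutely_integrable_on {p..q}" "(\<lambda>t. (- C t) *s h t) absolutely_integrable_on {p..q}"
    by (intro absolutely_integrable_vscale continuous_intros cont h)+
  note ac = ac_on_antiderivative[OF this(1), of A] ac_on_antiderivative[OF this(2), of B]
  define \<alpha> where "\<alpha> t = A - integral {p..q} (\<lambda>t. S t *s h t) + integral {p..t} (\<lambda>t. S t *s h t)" for t
  define \<beta> where "\<beta> t = B - integral {p..q} (\<lambda>t. (- C t) *s h t) + integral {p..t} (\<lambda>t. (- C t) *s h t)" for t
  note ac = ac[folded \<alpha>_def[abs_def] \<beta>_def[abs_def]]
  note prod = ac_on_product[OF bounded_bilinear_vscale]
  define y where "y t = C t *s \<alpha> t + S t *s \<beta> t" for t
  define y1 where "y1 t = (- (\<zeta> * S t)) *s \<alpha> t + C t *s \<beta> t" for t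
  have "ac_on p q y (\<lambda>t. (C t *s (S t *s h t) + (- (\<zeta> * S t)) *s \<alpha> t) + (S t *s ((- C t) *s h t) + C t *s \<beta> t))"
    unfolding y_def[abs_def] by (intro ac_on_add prod acC acS ac)
  then have 1: "ac_on p q y y1"
    by (rule ac_on_cong) (simp_all add: y1_def vec_eq_iff algebra_simps)
  have "ac_on p q y1 (\<lambda>t. ((- (\<zeta> * S t)) *s (S t *s h t) + (- (\<zeta> * C t)) *s \<alpha> t)
      + (C t *s ((- C t) *s h t) + (- (\<zeta> * S t)) *s \<beta> t))"
    unfolding y1_def[abs_def] by (intro ac_on_add prod acC acS' ac)
  then have 2: "ac_on p q y1 (\<lambda>t. - (\<zeta> *s y t) - h t)"
  proof (rule ac_on_cong)
    fix t
    \<comment> \<open>The Wronskian identity collects the terms with \<open>h\<close>; all others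
      recombine to - \<zeta> \<open>y\<close>.\<close>
    have w: "C t * C t + \<zeta> * S t * S t = 1"
      unfolding C_def S_def by (rule cosz_sinz_wronskian[OF \<zeta>])
    have "((- (\<zeta> * S t)) *s (S t *s h t) + (- (\<zeta> * C t)) *s \<alpha> t) + (C t *s ((- C t) *s h t) + (- (\<zeta> * S t)) *s \<beta> t)
        = - (\<zeta> *s y t) - (C t * C t + \<zeta> * S t * S t) *s h t"
      by (simp add: y_def vec_eq_iff algebra_simps)
    then show "((- (\<zeta> * S t)) *s (S t *s h t) + (- (\<zeta> * C t)) *s \<alpha> t)
        + (C t *s ((- C t) *s h t) + (- (\<zeta> * S t)) *s \<beta> t) = - (\<zeta> *s y t) - h t"
      unfolding w by simp
  qed simp
  have "y q = A" "y1 q = B"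
    by (simp_all add: y_def y1_def \<alpha>_def \<beta>_def C_def S_def)
  with 1 2 show ?thesis by blast
qed

lemma ac_on_limits:
  assumes ac: "ac_on a b u v" and "a < b" and eq: "\<And>t. t \<in> {a<..<b} \<Longrightarrow> f t = u t"
  shows "(f \<longlongrightarrow> u a) (at_right a)" "(f \<longlongrightarrow> u b) (at_left b)"
proof -
  note cont = ac_on_continuous[OF ac]
  have "\<forall>\<^sub>F t in at_right a. u t = f t"
    using \<open>a < b\<close> eq by (auto simp: eventually_at_right_field intro!: exI[of _ b])
  then show "(f \<longlongrightarrow> u a) (at_right a)"
    by (rule Lim_transform_eventually[OF continuous_on_Icc_at_rightD[OF cont \<open>a < b\<close>]])
  have "\<forall>\<^sub>F t in at_left b. u t = f t"
    using \<open>a < b\<close> eq by (auto simp: eventually_at_left_field intro!: exI[of _ a])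
  then show "(f \<longlongrightarrow> u b) (at_left b)"
    by (rule Lim_transform_eventually[OF continuous_on_Icc_at_leftD[OF cont \<open>a < b\<close>]])
qed

lemma ac_on_vderiv:
  assumes ac: "ac_on a b u v" and cont: "continuous_on {a..b} v" and t: "t \<in> {a<..<b}"
    and eq: "\<And>t. t \<in> {a<..<b} \<Longrightarrow> f t = u t"
  shows "vector_derivative f (at t) = v t"
proof -
  have "(u has_vector_derivative v t) (at t)"
    using ac_on_imp_has_vector_derivative[OF ac cont] t by auto
  then have "(f has_vector_derivative v t) (at t)"
    by (rule has_vector_derivative_transform_within_open[of _ _ _ "{a<..<b}"]) (use t eq in auto)
  then show ?thesis by (rule vector_derivative_at)
qed

section \<open>Functions described cell by cell, and the graph of \<open>H0\<close>\<close>

context delta_interactions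
begin

text \<open>A closed-cell description of \<open>f\<close> with - f'' = \<open>g\<close> and the
  interface conditions: \<open>p k\<close> and \<open>q k\<close> extend f and f' to the closed
  cell, \<open>a k\<close> is the value and \<open>b k\<close> the right slope at the node. Nothing
  is asked of the slope at 0 or of the support, so Green's identity can be used to find out whether
  the Neumann condition holds.\<close>

definition pieces ::
    "(real \<Rightarrow> complex ^ 'p) \<Rightarrow> (real \<Rightarrow> complex ^ 'p) \<Rightarrow> (nat \<Rightarrow> complex ^ 'p) \<Rightarrow> (nat \<Rightarrow> complex ^ 'p)
      \<Rightarrow> (nat \<Rightarrow> real \<Rightarrow> complex ^ 'p) \<Rightarrow> (nat \<Rightarrow> real \<Rightarrow> complex ^ 'p) \<Rightarrow> bool" where
  "pieces f g a b p q \<longleftrightarrow> (\<forall>k. ac_on (X k) (X (Suc k)) (p k) (q k) \<and>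
     ac_on (X k) (X (Suc k)) (q k) (\<lambda>t. - g t) \<and>
     (\<forall>t\<in>{X k<..<X (Suc k)}. f t = p k t) \<and> p k (X k) = a k \<and> q k (X k) = b k \<and>
     p k (X (Suc k)) = a (Suc k) \<and> q k (X (Suc k)) + \<Lambda> (Suc k) *v a (Suc k) = b (Suc k) \<and>
     f (X (Suc k)) = a (Suc k))"

lemma piecesD:
  assumes "pieces f g a b p q"
  shows "ac_on (X k) (X (Suc k)) (p k) (q k)" "ac_on (X k) (X (Suc k)) (q k) (\<lambda>t. - g t)"
    "t \<in> {X k<..<X (Suc k)} \<Longrightarrow> f t = p k t" "p k (X k) = a k" "q k (X k) = b k"
    "p k (X (Suc k)) = a (Suc k)" "q k (X (Suc k)) + \<Lambda> (Suc k) *v a (Suc k) = b (Suc k)"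
    "f (X (Suc k)) = a (Suc k)"
  using assms unfolding pieces_def by blast+

lemma pieces_vderiv:
  assumes "pieces f g a b p q" "t \<in> {X k<..<X (Suc k)}"
  shows "vderiv f t = q k t"
  by (rule ac_on_vderiv[OF piecesD(1)[OF assms(1)] ac_on_continuous[OF piecesD(2)[OF assms(1)]] assms(2)])
    (rule piecesD(3)[OF assms(1)])

lemma pieces_green:
  assumes pcs: "pieces f g a b p q" and z: "z \<noteq> 0"
  shows "(\<lambda>t. hdot (g t - cnj z *s f t) (usol z c t)) integrable_on {X k..X (Suc k)}"
    and "omega (a (Suc k)) (b (Suc k)) (P z c (Suc k)) (Q z c (Suc k))
      - omega (a k) (b k) (P z c k) (Q z c k)
    = integral {X k..X (Suc k)} (\<lambda>t. hdot (g t - cnj z *s f t) (usol z c t))"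
proof -
  note D = piecesD[OF pcs]
  have le: "X k \<le> X (Suc k)" using X_less[of k] by simp
  note green = green_ac[OF D(1,2) classical_piece[OF z] le, of "X k" "P z c k" "Q z c k"]
  have eq: "hdot (- (- g t) - cnj z *s p k t) (pc z c k t) = hdot (g t - cnj z *s f t) (usol z c t)"
    if "t \<in> {X k..X (Suc k)} - {X k, X (Suc k)}" for t
    using that D(3)[of t k] usol_on[of t k z c] by simp
  have int: "(\<lambda>t. hdot (- (- g t) - cnj z *s p k t) (pc z c k t)) integrable_on {X k..X (Suc k)}"
    by (rule set_lebesgue_integral_eq_integral(1)[OF green(1)])
  show "(\<lambda>t. hdot (g t - cnj z *s f t) (usol z c t)) integrable_on {X k..X (Suc k)}"
    by (rule integrable_spike[OF int, of "{X k, X (Suc k)}"]) (use eq in auto)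
  have "integral {X k..X (Suc k)} (\<lambda>t. hdot (- (- g t) - cnj z *s p k t) (pc z c k t))
      = integral {X k..X (Suc k)} (\<lambda>t. hdot (g t - cnj z *s f t) (usol z c t))"
    by (rule integral_spike[of "{X k, X (Suc k)}"]) (use eq in auto)
  then show "omega (a (Suc k)) (b (Suc k)) (P z c (Suc k)) (Q z c (Suc k))
      - omega (a k) (b k) (P z c k) (Q z c k)
    = integral {X k..X (Suc k)} (\<lambda>t. hdot (g t - cnj z *s f t) (usol z c t))"
    using green(2) unfolding D(7)[symmetric] P_Suc(2) omega_jump[of "Suc k", simplified]
    by (simp add: D(4,5,6) P_Suc(1))
qed

text \<open>The bracket at 0 is \<open>- hdot (b 0) c\<close>, so once the state at \<open>N\<close>
  is zero the integral reads off the slope of \<open>f\<close> at 0.\<close>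

lemma pieces_green_sum:
  assumes pcs: "pieces f g a b p q" and z: "z \<noteq> 0"
  shows "integral {0..X N} (\<lambda>t. hdot (g t - cnj z *s f t) (usol z c t))
    = omega (a N) (b N) (P z c N) (Q z c N) - omega (a 0) (b 0) c 0"
proof -
  have "integral {0..X N} (\<lambda>t. hdot (g t - cnj z *s f t) (usol z c t))
      = (\<Sum>k<N. integral {X k..X (Suc k)} (\<lambda>t. hdot (g t - cnj z *s f t) (usol z c t)))"
    using integral_mesh pieces_green(1)[OF assms] by blast
  also have "\<dots> = omega (a N) (b N) (P z c N) (Q z c N) - omega (a 0) (b 0) (P z c 0) (Q z c 0)"
    unfolding pieces_green(2)[OF assms, symmetric]
    by (rule sum_lessThan_telescope[of "\<lambda>k. omega (a k) (b k) (P z c k) (Q z c k)" N])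
  finally show ?thesis by simp
qed

lemma pieces_L2:
  assumes pcs: "pieces f g a b p q" and K: "\<And>t. t \<ge> X K \<Longrightarrow> f t = 0" and "K \<ge> 1"
  shows "f \<in> L2 half_line"
proof -
  note D = piecesD[OF pcs]
  \<comment> \<open>The value of \<open>f\<close> at 0 is arbitrary; replacing it by the limit makes
    the function continuous up to 0.\<close>
  define F where "F = f(0 := a 0)"
  have F: "F t = p k t" if "t \<in> {X k..X (Suc k)}" for t k
  proof -
    have "t = X k \<or> t = X (Suc k) \<or> t \<in> {X k<..<X (Suc k)}" using that by auto
    then consider "t = X k" | "t = X (Suc k)" | "t \<in> {X k<..<X (Suc k)}" by blast
    then show ?thesis
    proof cases
      case 1
      show ?thesis
      proof (cases k)
        case 0
        then show ?thesis using 1 D(4)[of 0] X0 by (simp add: F_def)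
      next
        case (Suc j)
        then show ?thesis using 1 D(4)[of k] D(8)[of j] X_nonneg[of j] X_less[of j] by (simp add: F_def)
      qed
    next
      case 2
      then show ?thesis using D(6)[of k] D(8)[of k] X_nonneg[of k] X_less[of k] by (simp add: F_def)
    next
      case 3
      then show ?thesis using D(3)[of t k] X_nonneg[of k] by (simp add: F_def)
    qed
  qed
  have cont: "continuous_on {0..} F"
  proof (rule continuous_on_mesh)
    show "continuous_on {X k..X (Suc k)} F" for k
      by (rule continuous_on_eq[OF ac_on_continuous[OF D(1)]]) (rule F[symmetric])
  qed
  let ?f = "\<lambda>t. (norm (F t))\<^sup>2"
  have int: "?f integrable_on {0..X N}" for N
    by (intro integrable_continuous_real continuous_intros continuous_on_subset[OF cont]) auto
  have "X K > 0" using X_less[of 0] X_mono[of 1 K] \<open>K \<ge> 1\<close> X0 by simp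
  have "integral {0..X N} ?f \<le> integral {0..X K} ?f" for N
  proof (cases "N \<le> K")
    case True
    then show ?thesis using X_mono[OF True] by (intro integral_subset_le int) auto
  next
    case False
    then have le: "X K \<le> X N" using X_mono[of K N] by simp
    have "integral {0..X N} ?f = integral {0..X K} ?f + integral {X K..X N} ?f"
      using Henstock_Kurzweil_Integration.integral_combine[OF X_nonneg le int] by simp
    also have "integral {X K..X N} ?f = integral {X K..X N} (\<lambda>t. 0)"
      by (rule integral_cong) (use K \<open>X K > 0\<close> in \<open>auto simp: F_def\<close>)
    finally show ?thesis by simp
  qed
  then have "F \<in> L2 half_line" unfolding L2_half_line[OF cont] by blast
  then show ?thesis by (rule L2_cong_half_line) (simp add: F_def)
qed

text \<open>The derivative of \<open>f\<close> occurs as a Sobolev derivative, as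
  \<open>vderiv f\<close> and as an antiderivative of \<open>- g\<close>. Their continuous
  representatives agree inside each cell, and one-sided limits give the data at the nodes.\<close>

lemma H0_pieces:
  assumes fg: "(f, g) \<in> H0 X \<Lambda>"
  obtains a b p q K where "pieces f g a b p q" "b 0 = 0" "g \<in> L2 half_line" "K \<ge> 1"
    "\<And>t. t \<ge> X K \<Longrightarrow> f t = 0" "\<And>k. k \<ge> K \<Longrightarrow> a k = 0 \<and> b k = 0"
proof -
  have dom: "compact (closure {t. 0 < t \<and> f t \<noteq> 0})"
    and W: "\<And>k. k \<ge> 1 \<Longrightarrow> f \<in> W22 (X (k - 1)) (X k)"
    and neumann: "Lim (at_right 0) (vderiv f) = 0"
    and cont: "\<And>k. k \<ge> 1 \<Longrightarrow> (f \<longlongrightarrow> f (X k)) (at_left (X k)) \<and> (f \<longlongrightarrow> f (X k)) (at_right (X k))"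
    and jump: "\<And>k. k \<ge> 1 \<Longrightarrow>
      Lim (at_right (X k)) (vderiv f) - Lim (at_left (X k)) (vderiv f) = \<Lambda> k *v f (X k)"
    and g: "g \<in> L2 half_line"
    and acg: "\<And>k. k \<ge> 1 \<Longrightarrow> ac_derivative (X (k - 1)) (X k) (vderiv f) (\<lambda>t. - g t)"
    using fg by (auto simp: H0_def dom_H0_def)
  have "\<exists>p q. ac_on (X k) (X (Suc k)) p q \<and> ac_on (X k) (X (Suc k)) q (\<lambda>t. - g t) \<and>
      (\<forall>t\<in>{X k<..<X (Suc k)}. f t = p t) \<and> (\<forall>t\<in>{X k<..<X (Suc k)}. vderiv f t = q t)" for k
  proof -
    obtain f1 f2 where f1: "ac_derivative (X k) (X (Suc k)) f f1" "ac_derivative (X k) (X (Suc k)) f1 f2"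
      using W[of "Suc k"] by (auto simp: W22_def)
    obtain p where p: "ac_on (X k) (X (Suc k)) p f1" "\<And>t. t \<in> {X k<..<X (Suc k)} \<Longrightarrow> p t = f t"
      using ac_derivative_imp_ac_on[OF f1(1) X_less] by blast
    obtain q' where q': "ac_on (X k) (X (Suc k)) q' f2" "\<And>t. t \<in> {X k<..<X (Suc k)} \<Longrightarrow> q' t = f1 t"
      using ac_derivative_imp_ac_on[OF f1(2) X_less] by blast
    have pq': "ac_on (X k) (X (Suc k)) p q'"
      by (rule ac_on_cong[OF p(1) refl]) (rule q'(2)[symmetric])
    have vd: "vderiv f t = q' t" if "t \<in> {X k<..<X (Suc k)}" for t
      by (rule ac_on_vderiv[OF pq' ac_on_continuous[OF q'(1)] that]) (rule p(2)[symmetric])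
    obtain q where q: "ac_on (X k) (X (Suc k)) q (\<lambda>t. - g t)"
        "\<And>t. t \<in> {X k<..<X (Suc k)} \<Longrightarrow> q t = vderiv f t"
      using ac_derivative_imp_ac_on[OF _ X_less, of k "vderiv f" "\<lambda>t. - g t"] acg[of "Suc k"] by auto
    have "ac_on (X k) (X (Suc k)) p q"
      by (rule ac_on_cong[OF pq' refl]) (use vd q(2) in simp)
    then show ?thesis using q p(2) by (intro exI[of _ p] exI[of _ q]) auto
  qed
  then obtain p q where p: "\<And>k. ac_on (X k) (X (Suc k)) (p k) (q k)"
      and q: "\<And>k. ac_on (X k) (X (Suc k)) (q k) (\<lambda>t. - g t)"
      and fp: "\<And>k t. t \<in> {X k<..<X (Suc k)} \<Longrightarrow> f t = p k t"
      and fq: "\<And>k t. t \<in> {X k<..<X (Suc k)} \<Longrightarrow> vderiv f t = q k t"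
    by metis
  define a where "a k = p k (X k)" for k
  define b where "b k = q k (X k)" for k
  note limp = ac_on_limits[OF p X_less, of _ f, OF fp]
  note limq = ac_on_limits[OF q X_less, of _ "vderiv f", OF fq]
  have Limq: "Lim (at_right (X k)) (vderiv f) = b k" "Lim (at_left (X (Suc k))) (vderiv f) = q k (X (Suc k))" for k
    using limq[of k] by (auto intro!: tendsto_Lim simp: b_def)
  have a_eq: "f (X (Suc k)) = a (Suc k)" for k
    using tendsto_unique[OF trivial_limit_at_right_real limp(1)[of "Suc k"]] cont[of "Suc k"] by (auto simp: a_def)
  have p_eq: "p k (X (Suc k)) = a (Suc k)" for k
    using tendsto_unique[OF trivial_limit_at_left_real limp(2)[of k]] cont[of "Suc k"] a_eq[of k] by auto
  have pcs: "pieces f g a b p q"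
    unfolding pieces_def
  proof (intro allI conjI ballI)
    fix k
    show "q k (X (Suc k)) + \<Lambda> (Suc k) *v a (Suc k) = b (Suc k)"
      using jump[of "Suc k"] Limq(1)[of "Suc k"] Limq(2)[of k] a_eq[of k] by (simp add: algebra_simps)
  qed (auto simp: p q fp a_def[symmetric] b_def[symmetric] p_eq a_eq)
  have b0: "b 0 = 0" using Limq(1)[of 0] neumann X0 by simp
  have "bounded {t. 0 < t \<and> f t \<noteq> 0}"
    using dom bounded_subset[OF compact_imp_bounded closure_subset] by blast
  then obtain R where R: "\<And>t. 0 < t \<Longrightarrow> f t \<noteq> 0 \<Longrightarrow> \<bar>t\<bar> \<le> R" by (auto simp: bounded_iff)
  obtain K0 where "R < X K0" using X_unbounded by blast
  define K where "K = Suc K0"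
  have "R < X K" using \<open>R < X K0\<close> X_less[of K0] by (simp add: K_def)
  have K: "f t = 0" if "t \<ge> X K" for t
    using R[of t] that \<open>R < X K\<close> X_less[of K0] X_nonneg[of K0] by (force simp: K_def)
  \<comment> \<open>Beyond the support \<open>f\<close> vanishes on the whole open cell to the right
    of the node, which forces both one-sided limits to be 0.\<close>
  have zero: "a k = 0 \<and> b k = 0" if k: "k \<ge> K" for k
  proof -
    have z: "f t = 0" if "t \<in> {X k<..<X (Suc k)}" for t
      using K[of t] X_mono[OF k] that by simp
    have "(f \<longlongrightarrow> 0) (at_right (X k))"
      by (rule tendsto_eventually) (use z X_less[of k] in \<open>auto simp: eventually_at_right_field intro!: exI[of _ "X (Suc k)"]\<close>)
    then have "a k = 0"
      using tendsto_unique[OF trivial_limit_at_right_real limp(1)[of k]] by (simp add: a_def)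
    moreover have "vderiv f t = 0" if "t \<in> {X k<..<X (Suc k)}" for t
    proof (rule vector_derivative_at)
      show "(f has_vector_derivative 0) (at t)"
        by (rule has_vector_derivative_transform_within_open[OF has_vector_derivative_const, of "{X k<..<X (Suc k)}"])
          (use that z in auto)
    qed
    then have "(vderiv f \<longlongrightarrow> 0) (at_right (X k))"
      by (intro tendsto_eventually) (use X_less[of k] in \<open>auto simp: eventually_at_right_field intro!: exI[of _ "X (Suc k)"]\<close>)
    then have "b k = 0"
      using tendsto_unique[OF trivial_limit_at_right_real limq(1)[of k]] by (simp add: b_def)
    ultimately show ?thesis by simp
  qed
  have "K \<ge> 1" by (simp add: K_def)
  show thesis by (rule that[OF pcs b0 g \<open>K \<ge> 1\<close> K zero])
qed

lemma pieces_H0: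
  assumes pcs: "pieces f g a b p q" and b0: "b 0 = 0" and g: "g \<in> L2 half_line"
    and K: "\<And>t. t \<ge> X K \<Longrightarrow> f t = 0"
  shows "(f, g) \<in> H0 X \<Lambda>"
proof -
  note D = piecesD[OF pcs] and vd = pieces_vderiv[OF pcs]
  note limp = ac_on_limits[OF D(1) X_less, of _ f, OF D(3)]
  note limq = ac_on_limits[OF D(2) X_less, of _ "vderiv f", OF vd]
  have Limq: "Lim (at_right (X k)) (vderiv f) = b k" "Lim (at_left (X (Suc k))) (vderiv f) = q k (X (Suc k))" for k
    using limq[of k] by (auto intro!: tendsto_Lim simp: D(5))
  have acf: "ac_derivative (X k) (X (Suc k)) f (q k)" for k
    by (rule ac_on_imp_ac_derivative[OF D(1)]) (use D(3) in auto)
  have acq: "ac_derivative (X k) (X (Suc k)) (q k) (\<lambda>t. - g t)" for k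
    by (rule ac_on_imp_ac_derivative[OF D(2)]) auto
  have acv: "ac_derivative (X k) (X (Suc k)) (vderiv f) (\<lambda>t. - g t)" for k
    by (rule ac_on_imp_ac_derivative[OF D(2)]) (use vd in auto)
  have mg: "(\<lambda>t. - g t) \<in> L2 (lebesgue_on {X k<..<X (Suc k)})" for k
    using L2_subset[OF L2_scale[OF g, of "- 1"] X_nonneg[of k]] by (simp add: vec.scale_minus_left)
  have W: "f \<in> W22 (X k) (X (Suc k))" for k
    unfolding W22_def using acf[of k] acq[of k] mg[of k] by blast
  have "t \<le> X K" if "f t \<noteq> 0" for t using K[of t] that by linarith
  then have "{t. 0 < t \<and> f t \<noteq> 0} \<subseteq> {0..X K}" by auto
  then have comp: "compact (closure {t. 0 < t \<and> f t \<noteq> 0})"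
    by (simp add: bounded_subset[OF bounded_closed_interval] compact_closure)
  have "(f \<longlongrightarrow> f (X (Suc k))) (at_left (X (Suc k))) \<and> (f \<longlongrightarrow> f (X (Suc k))) (at_right (X (Suc k))) \<and>
      Lim (at_right (X (Suc k))) (vderiv f) - Lim (at_left (X (Suc k))) (vderiv f) = \<Lambda> (Suc k) *v f (X (Suc k))" for k
    using limp(2)[of k] limp(1)[of "Suc k"] D(7)[of k, symmetric] by (simp add: D(4,6,8) Limq)
  then have bc: "(f \<longlongrightarrow> f (X k)) (at_left (X k)) \<and> (f \<longlongrightarrow> f (X k)) (at_right (X k)) \<and>
      Lim (at_right (X k)) (vderiv f) - Lim (at_left (X k)) (vderiv f) = \<Lambda> k *v f (X k)" if "k \<ge> 1" for k
    using that by (cases k) auto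
  have W': "f \<in> W22 (X (k - 1)) (X k)" and acv': "ac_derivative (X (k - 1)) (X k) (vderiv f) (\<lambda>t. - g t)"
    if "k \<ge> 1" for k
    using that W[of "k - 1"] acv[of "k - 1"] by auto
  have "Lim (at_right 0) (vderiv f) = 0" using Limq(1)[of 0] b0 X0 by simp
  then show ?thesis
    using comp bc W' acv' g by (simp add: H0_def dom_H0_def)
qed

end

section \<open>Null sets and local integrability on the half-line\<close>

lemma half_line_AE_negligible:
  assumes "AE t in half_line. R t"
  shows "\<exists>N. negligible N \<and> (\<forall>t\<in>{0..} - N. R t)"
proof -
  have "AE t in lebesgue. t \<in> {0<..} \<longrightarrow> R t"
    using assms by (simp add: AE_restrict_space_iff)
  then obtain N where "N \<in> null_sets lebesgue" "{t. \<not> (t \<in> {0<..} \<longrightarrow> R t)} \<subseteq> N"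
    by (auto simp: eventually_ae_filter)
  then have "negligible (insert 0 N) \<and> (\<forall>t\<in>{0..} - insert 0 N. R t)"
    by (auto simp: negligible_iff_null_sets order_le_less)
  then show ?thesis by blast
qed

lemma L2_locally_integrable:
  fixes u :: "real \<Rightarrow> complex ^ 'p"
  assumes "u \<in> L2 half_line"
  shows "u absolutely_integrable_on {0..b}"
proof -
  have L2: "u \<in> L2 (lebesgue_on {0<..<b})" using L2_subset[OF assms, of 0 b] by simp
  have "u absolutely_integrable_on {0<..<b}"
  proof (rule measurable_bounded_by_integrable_imp_absolutely_integrable)
    show "u \<in> borel_measurable (lebesgue_on {0<..<b})" using L2 by (simp add: L2_def)
    have "(\<lambda>t. (norm (u t))\<^sup>2) absolutely_integrable_on {0..}"
      using assms by (simp add: L2_def integrable_half_line)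
    then have "(\<lambda>t. (norm (u t))\<^sup>2) absolutely_integrable_on {0<..<b}"
      by (rule set_integrable_subset) auto
    then show "(\<lambda>t. 1 + (norm (u t))\<^sup>2) integrable_on {0<..<b}"
      by (intro integrable_add set_lebesgue_integral_eq_integral(1)) (auto intro: integrable_on_const)
    show "norm (u t) \<le> 1 + (norm (u t))\<^sup>2" for t
      using sum_squares_bound[of 1 "norm (u t)", simplified] norm_ge_zero[of "u t"] by linarith
  qed auto
  then show ?thesis by (simp only: absolutely_integrable_open_interval)
qed

lemma integrable_hdot_continuous:
  fixes u y :: "real \<Rightarrow> complex ^ 'p"
  assumes "u absolutely_integrable_on {a..b}" "continuous_on {a..b} y"
  shows "(\<lambda>t. hdot (u t) (y t)) integrable_on {a..b}"
proof -
  have "(\<lambda>t. (\<lambda>x y. hdot y x) (y t) (u t)) absolutely_integrable_on {a..b}"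
  proof (rule absolutely_integrable_bounded_measurable_product[of "\<lambda>x y. hdot y x" y "{a..b}" u])
    show "bilinear (\<lambda>x y :: complex ^ 'p. hdot y x)"
      by (simp add: bilinear_conv_bounded_bilinear bounded_bilinear.flip[OF bounded_bilinear_hdot])
    show "y \<in> borel_measurable (lebesgue_on {a..b})"
      by (rule continuous_imp_measurable_on_sets_lebesgue[OF assms(2)]) simp
    show "bounded (y ` {a..b})"
      by (intro compact_imp_bounded compact_continuous_image assms) auto
  qed (use assms in auto)
  then show ?thesis by (intro set_lebesgue_integral_eq_integral(1))
qed

lemma L2_truncate:
  fixes f :: "real \<Rightarrow> complex ^ 'p"
  assumes f: "f \<in> borel_measurable half_line" and int: "(\<lambda>t. (norm (f t))\<^sup>2) integrable_on {0..b}"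
  shows "(\<lambda>t. if t \<in> {0..b} then f t else 0) \<in> L2 half_line"
proof -
  have "{t \<in> space half_line. t \<in> {0..b}} = {0<..b}" by auto
  then have "(\<lambda>t. if t \<in> {0..b} then f t else 0) \<in> borel_measurable half_line"
    by (intro measurable_If f) (auto simp: sets_restrict_space_iff)
  moreover have "(\<lambda>t. (norm (if t \<in> {0..b} then f t else 0))\<^sup>2) absolutely_integrable_on {0..}"
  proof (rule nonnegative_absolutely_integrable_1)
    have Int: "{0..} \<inter> {0..b} = {0..b}" "{0..b} \<inter> {0..} = {0..b}" by auto
    have "(\<lambda>t. if t \<in> {0..b} then (norm (f t))\<^sup>2 else 0) integrable_on {0..}"
      using int by (simp only: integrable_restrict_Int Int)
    then show "(\<lambda>t. (norm (if t \<in> {0..b} then f t else 0))\<^sup>2) integrable_on {0..}"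
      by (rule integrable_eq) auto
  qed simp
  ultimately show ?thesis by (simp add: L2_def integrable_half_line)
qed

section \<open>The deficiency spaces of the operator with interactions\<close>

context delta_interactions
begin

lemma H0_subset: "H0 X \<Lambda> \<subseteq> L2 half_line \<times> L2 half_line"
proof clarify
  fix f g assume "(f, g) \<in> H0 X \<Lambda>"
  then show "f \<in> L2 half_line \<and> g \<in> L2 half_line"
    by (rule H0_pieces) (use pieces_L2 in blast)
qed

text \<open>Both sides of the adjoint relation are combined into one integral and exhausted along
  the mesh, where Green's identity applies.\<close>

lemma inner_difference_limit:
  assumes f: "f \<in> L2 half_line" and g: "g \<in> L2 half_line" and u: "u \<in> L2 half_line"
  shows "(\<lambda>N. integral {0..X N} (\<lambda>t. hdot (g t - cnj z *s f t) (u t)))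
    \<longlonglongrightarrow> L2_inner half_line g u - L2_inner half_line f (\<lambda>t. z *s u t)"
proof -
  have d: "(\<lambda>t. g t - cnj z *s f t) \<in> L2 half_line" by (intro L2_diff L2_scale f g)
  have "L2_inner half_line g u - L2_inner half_line f (\<lambda>t. z *s u t)
      = (\<integral>t. hdot (g t) (u t) - hdot (f t) (z *s u t) \<partial>half_line)"
    unfolding L2_inner_hdot
    by (rule Bochner_Integration.integral_diff[symmetric]) (intro L2_hdot_integrable L2_scale f g u)+
  also have "\<dots> = (\<integral>t. hdot (g t - cnj z *s f t) (u t) \<partial>half_line)"
    by (simp add: hdot_diff hdot_scale)
  finally show ?thesis
    using integral_half_line_limit[OF L2_hdot_integrable(2)[OF d u] X_lim] by simp
qed

lemma usol_eigenvector:
  assumes z: "z \<noteq> 0" and u: "u \<in> L2 half_line" and eq: "AE t in half_line. u t = usol z c t"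
    and fg: "(f, g) \<in> H0 X \<Lambda>"
  shows "L2_inner half_line g u = L2_inner half_line f (\<lambda>t. z *s u t)"
proof -
  obtain a b p q K where pcs: "pieces f g a b p q" "b 0 = 0" and K: "\<And>k. k \<ge> K \<Longrightarrow> a k = 0 \<and> b k = 0"
    by (rule H0_pieces[OF fg]) blast
  have fgL: "f \<in> L2 half_line" "g \<in> L2 half_line" using H0_subset fg by auto
  obtain S where S: "negligible S" "\<And>t. t \<in> {0..} - S \<Longrightarrow> u t = usol z c t"
    using half_line_AE_negligible[OF eq] by blast
  have "integral {0..X N} (\<lambda>t. hdot (g t - cnj z *s f t) (u t)) = 0" if N: "N \<ge> K" for N
  proof -
    have "integral {0..X N} (\<lambda>t. hdot (g t - cnj z *s f t) (u t))
        = integral {0..X N} (\<lambda>t. hdot (g t - cnj z *s f t) (usol z c t))"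
      by (rule integral_spike[OF S(1)]) (use S(2) in simp)
    also have "\<dots> = 0"
      unfolding pieces_green_sum[OF pcs(1) z] using K[OF N] pcs(2) by (simp add: omega_def)
    finally show ?thesis .
  qed
  then have "(\<lambda>N. integral {0..X N} (\<lambda>t. hdot (g t - cnj z *s f t) (u t))) \<longlonglongrightarrow> 0"
    by (intro tendsto_eventually) (auto simp: eventually_sequentially)
  from LIMSEQ_unique[OF inner_difference_limit[OF fgL u, of z] this] show ?thesis by simp
qed

lemma usol_definite:
  assumes z: "norm z = 1" and ae: "AE t in half_line. t \<le> X 1 \<longrightarrow> usol z c t = 0"
  shows "c = 0"
proof -
  have nz: "z \<noteq> 0" using z by auto
  obtain S where S: "negligible S" "\<And>t. t \<in> {0..} - S \<Longrightarrow> t \<le> X 1 \<longrightarrow> usol z c t = 0"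
    using half_line_AE_negligible[OF ae] by blast
  have "integral {0..X 1} (\<lambda>t. (norm (usol z c t))\<^sup>2) = integral {0..X 1} (\<lambda>t. 0)"
    by (rule integral_spike[OF S(1)]) (use S(2) in simp)
  then have "cell z 1 c = 0" using usol_sq_integral[OF nz, of 1 c] by simp
  then show ?thesis by (rule cell_definite[OF z])
qed

text \<open>Solved cell by cell from the right: at each node the jump is undone to get the slope on
  its left.\<close>

lemma backward_solution:
  assumes \<zeta>: "\<zeta> \<noteq> 0" and h: "\<And>k. k < N \<Longrightarrow> h absolutely_integrable_on {X k..X (Suc k)}"
  shows "\<exists>a b p q. a N = A \<and> b N = B \<and> (\<forall>k<N. ac_on (X k) (X (Suc k)) (p k) (q k) \<and>
     ac_on (X k) (X (Suc k)) (q k) (\<lambda>t. - (\<zeta> *s p k t) - h t) \<and>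
     p k (X k) = a k \<and> q k (X k) = b k \<and> p k (X (Suc k)) = a (Suc k) \<and>
     q k (X (Suc k)) + \<Lambda> (Suc k) *v a (Suc k) = b (Suc k))"
  using h
proof (induction N arbitrary: A B)
  case 0
  show ?case by (rule exI[of _ "\<lambda>_. A"], rule exI[of _ "\<lambda>_. B"]) simp
next
  case (Suc N)
  obtain y y1 where y: "ac_on (X N) (X (Suc N)) y y1"
      "ac_on (X N) (X (Suc N)) y1 (\<lambda>t. - (\<zeta> *s y t) - h t)"
      "y (X (Suc N)) = A" "y1 (X (Suc N)) = B - \<Lambda> (Suc N) *v A"
    using inhomogeneous_solution[OF \<zeta> less_imp_le[OF X_less] Suc.prems[OF lessI]] by metis
  have "\<exists>a b p q. a N = y (X N) \<and> b N = y1 (X N) \<and> (\<forall>k<N. ac_on (X k) (X (Suc k)) (p k) (q k) \<and>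
     ac_on (X k) (X (Suc k)) (q k) (\<lambda>t. - (\<zeta> *s p k t) - h t) \<and>
     p k (X k) = a k \<and> q k (X k) = b k \<and> p k (X (Suc k)) = a (Suc k) \<and>
     q k (X (Suc k)) + \<Lambda> (Suc k) *v a (Suc k) = b (Suc k))"
    by (rule Suc.IH) (use Suc.prems in simp)
  then obtain a b p q where ab: "a N = y (X N)" "b N = y1 (X N)"
    and pq: "\<And>k. k < N \<Longrightarrow> ac_on (X k) (X (Suc k)) (p k) (q k) \<and>
     ac_on (X k) (X (Suc k)) (q k) (\<lambda>t. - (\<zeta> *s p k t) - h t) \<and>
     p k (X k) = a k \<and> q k (X k) = b k \<and> p k (X (Suc k)) = a (Suc k) \<and>
     q k (X (Suc k)) + \<Lambda> (Suc k) *v a (Suc k) = b (Suc k)"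
    by blast
  show ?case
  proof (rule exI[of _ "a(Suc N := A)"], rule exI[of _ "b(Suc N := B)"],
      rule exI[of _ "p(N := y)"], rule exI[of _ "q(N := y1)"], intro conjI allI impI)
    show "(a(Suc N := A)) (Suc N) = A" "(b(Suc N := B)) (Suc N) = B" by simp_all
    fix k assume k: "k < Suc N"
    let ?p = "p(N := y)" and ?q = "q(N := y1)" and ?a = "a(Suc N := A)" and ?b = "b(Suc N := B)"
    have "ac_on (X k) (X (Suc k)) (?p k) (?q k) \<and>
        ac_on (X k) (X (Suc k)) (?q k) (\<lambda>t. - (\<zeta> *s ?p k t) - h t) \<and>
        ?p k (X k) = ?a k \<and> ?q k (X k) = ?b k \<and> ?p k (X (Suc k)) = ?a (Suc k) \<and>
        ?q k (X (Suc k)) + \<Lambda> (Suc k) *v ?a (Suc k) = ?b (Suc k)"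
    proof (cases "k = N")
      case True
      then show ?thesis using y ab by simp
    next
      case False
      then show ?thesis using pq[of k] k by simp
    qed
    then show "ac_on (X k) (X (Suc k)) (?p k) (?q k)"
      "ac_on (X k) (X (Suc k)) (?q k) (\<lambda>t. - (\<zeta> *s ?p k t) - h t)"
      "?p k (X k) = ?a k" "?q k (X k) = ?b k" "?p k (X (Suc k)) = ?a (Suc k)"
      "?q k (X (Suc k)) + \<Lambda> (Suc k) *v ?a (Suc k) = ?b (Suc k)" by blast+
  qed
qed

text \<open>
  \<open>h\<close> is orthogonal to all solutions with parameter \<open>z\<close> exactly when the solution of
  \<open>- f'' = cnj z f + h\<close> with zero data at \<open>X N\<close> satisfies the Neumann condition at \<open>0\<close>.
\<close>

lemma orthogonal_imp_range:
  assumes z: "z \<noteq> 0" and N: "N \<ge> 1" and h: "h \<in> L2 half_line" and h0: "\<And>t. t > X N \<Longrightarrow> h t = 0"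
    and orth: "\<And>c. integral {0..X N} (\<lambda>t. hdot (h t) (usol z c t)) = 0"
  obtains f where "(f, \<lambda>t. cnj z *s f t + h t) \<in> H0 X \<Lambda>"
proof -
  have \<zeta>: "cnj z \<noteq> 0" using z by simp
  have hX: "h absolutely_integrable_on {X k..X (Suc k)}" for k
    using X_nonneg[of k] by (intro absolutely_integrable_on_subinterval[OF L2_locally_integrable[OF h, of "X (Suc k)"]]) auto
  obtain a b p q where aN: "a N = 0" "b N = 0"
    and pq: "\<And>k. k < N \<Longrightarrow> ac_on (X k) (X (Suc k)) (p k) (q k) \<and>
     ac_on (X k) (X (Suc k)) (q k) (\<lambda>t. - (cnj z *s p k t) - h t) \<and>
     p k (X k) = a k \<and> q k (X k) = b k \<and> p k (X (Suc k)) = a (Suc k) \<and>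
     q k (X (Suc k)) + \<Lambda> (Suc k) *v a (Suc k) = b (Suc k)"
    using backward_solution[OF \<zeta> hX, of N 0 0] by blast
  define a' where "a' k = (if k < N then a k else 0)" for k
  define b' where "b' k = (if k < N then b k else 0)" for k
  define p' where "p' k = (if k < N then p k else (\<lambda>_. 0))" for k
  define q' where "q' k = (if k < N then q k else (\<lambda>_. 0))" for k
  define f where "f t = (if 0 < t \<and> t < X N then p (idx t) t else 0)" for t
  define g where "g t = cnj z *s f t + h t" for t
  have less: "X j < X k \<longleftrightarrow> j < k" for j k using mono by (simp add: strict_mono_less)
  have f_in: "f t = p k t" if "k < N" "t \<in> {X k<..<X (Suc k)}" for k t
    using that X_nonneg[of k] X_mono[of "Suc k" N] idx_eq[of k t] by (auto simp: f_def)
  have f_out: "f t = 0" if "t \<ge> X N" for t using that by (simp add: f_def)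
  have pcs: "pieces f g a' b' p' q'"
    unfolding pieces_def
  proof (rule allI)
    fix k
    show "ac_on (X k) (X (Suc k)) (p' k) (q' k) \<and>
     ac_on (X k) (X (Suc k)) (q' k) (\<lambda>t. - g t) \<and>
     (\<forall>t\<in>{X k<..<X (Suc k)}. f t = p' k t) \<and> p' k (X k) = a' k \<and> q' k (X k) = b' k \<and>
     p' k (X (Suc k)) = a' (Suc k) \<and> q' k (X (Suc k)) + \<Lambda> (Suc k) *v a' (Suc k) = b' (Suc k) \<and>
     f (X (Suc k)) = a' (Suc k)"
    proof (cases "k < N")
      case True
      have a'_Suc: "a' (Suc k) = a (Suc k)" "b' (Suc k) = b (Suc k)"
        using True aN by (cases "Suc k = N"; simp add: a'_def b'_def)+
      have "ac_on (X k) (X (Suc k)) (q k) (\<lambda>t. - g t)"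
        by (rule ac_on_cong[of _ _ "q k" "\<lambda>t. - (cnj z *s p k t) - h t"])
          (use pq[OF True] f_in[OF True] in \<open>auto simp: g_def\<close>)
      moreover have "f (X (Suc k)) = a (Suc k)"
      proof (cases "Suc k < N")
        case True
        have "0 < X (Suc k)" using X_less[of k] X_nonneg[of k] by linarith
        then show ?thesis
          using True pq[of k] idx_eq[of k "X (Suc k)"] X_less[of k] less by (simp add: f_def)
      next
        case False
        then have "Suc k = N" using \<open>k < N\<close> by simp
        then show ?thesis using aN f_out by simp
      qed
      ultimately show ?thesis
        using True pq[OF True] f_in[OF True] by (simp add: a'_Suc) (simp add: p'_def q'_def a'_def b'_def)
    next
      case False
      have le: "X N \<le> X k" using False X_mono[of N k] by simp
      have zero: "ac_on (X k) (X (Suc k)) (\<lambda>_. 0 :: complex ^ 'p) (\<lambda>_. 0)"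
        by (simp add: ac_on_def)
      then have "ac_on (X k) (X (Suc k)) (\<lambda>_. 0) (\<lambda>t. - g t)"
        by (rule ac_on_cong) (use f_out h0 le in \<open>auto simp: g_def\<close>)
      then show ?thesis
        using zero False f_out le X_less[of k] by (auto simp: p'_def q'_def a'_def b'_def)
    qed
  qed
  have fL: "f \<in> L2 half_line" by (rule pieces_L2[OF pcs f_out N])
  have "(\<lambda>t. cnj z *s f t - (- 1) *s h t) \<in> L2 half_line"
    by (intro L2_diff L2_scale fL h)
  then have gL: "g \<in> L2 half_line" by (simp add: g_def[abs_def] vec.scale_minus_left)
  \<comment> \<open>The initial values \<open>c\<close> of the solutions range over all vectors, so
    orthogonality to every solution annihilates the slope at 0.\<close>
  have "hdot (b' 0) c = 0" for c
  proof -
    have "omega (a' N) (b' N) (P z c N) (Q z c N) - omega (a' 0) (b' 0) c 0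
        = integral {0..X N} (\<lambda>t. hdot (h t) (usol z c t))"
      unfolding pieces_green_sum[OF pcs z, symmetric] by (simp add: g_def)
    then show ?thesis using orth[of c] by (simp add: omega_def a'_def b'_def)
  qed
  then have "b' 0 = 0" using hdot_self[of "b' 0"] by simp
  then have "(f, g) \<in> H0 X \<Lambda>" by (rule pieces_H0[OF pcs _ gL f_out])
  then show thesis using that by (simp add: g_def[abs_def])
qed

text \<open>Orthogonal projection of \<open>u\<close> onto the finite-dimensional space of solutions
  on the first \<open>N\<close> cells. The Gram map \<gamma> is injective, since a solution of zero
  norm has \<open>c = 0\<close>, and therefore onto.\<close>

lemma projection_exists:
  assumes z: "norm z = 1" and N: "N \<ge> 1" and u: "u \<in> L2 half_line"
  obtains c where "\<And>c'. integral {0..X N} (\<lambda>t. hdot (u t - usol z c t) (usol z c' t)) = 0"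
proof -
  have nz: "z \<noteq> 0" using z by auto
  have cont: "continuous_on {0..X N} (usol z c)" for c
    by (rule continuous_on_subset[OF continuous_usol[OF nz]]) auto
  have int_u: "(\<lambda>t. hdot (u t) (usol z c t)) integrable_on {0..X N}" for c
    by (intro integrable_hdot_continuous L2_locally_integrable u cont)
  have int_y: "(\<lambda>t. hdot (usol z c t) (usol z c' t)) integrable_on {0..X N}" for c c'
    by (intro integrable_hdot_continuous absolutely_integrable_continuous_real cont)
  define G where "G c c' = integral {0..X N} (\<lambda>t. hdot (usol z c t) (usol z c' t))" for c c'
  define \<gamma> where "\<gamma> c = (\<chi> i. G c (axis i 1))" for c
  have expand: "integral {0..X N} (\<lambda>t. hdot (v t) (usol z c' t))
      = (\<Sum>i\<in>UNIV. cnj (c' $ i) * integral {0..X N} (\<lambda>t. hdot (v t) (usol z (axis i 1) t)))"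
    if v: "\<And>c. (\<lambda>t. hdot (v t) (usol z c t)) integrable_on {0..X N}" for v c'
  proof -
    have "usol z c' t = (\<Sum>i\<in>UNIV. (c' $ i) *s usol z (axis i 1) t)" for t
      by (subst basis_expansion[of c', symmetric])
        (simp only: vec.linear_sum[OF clin_usol] vec.linear_scale[OF clin_usol])
    then have "hdot (v t) (usol z c' t) = (\<Sum>i\<in>UNIV. cnj (c' $ i) * hdot (v t) (usol z (axis i 1) t))" for t
      by (simp add: hdot_sum hdot_scale)
    then have "integral {0..X N} (\<lambda>t. hdot (v t) (usol z c' t))
        = integral {0..X N} (\<lambda>t. \<Sum>i\<in>UNIV. cnj (c' $ i) * hdot (v t) (usol z (axis i 1) t))" by simp
    also have "\<dots> = (\<Sum>i\<in>UNIV. integral {0..X N} (\<lambda>t. cnj (c' $ i) * hdot (v t) (usol z (axis i 1) t)))"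
      by (rule Henstock_Kurzweil_Integration.integral_sum) (auto intro!: integrable_on_mult_right v)
    finally show ?thesis by simp
  qed
  have G_add: "G (c1 + c2) c' = G c1 c' + G c2 c'" for c1 c2 c'
    unfolding G_def by (simp add: vec.linear_add[OF clin_usol] hdot_add Henstock_Kurzweil_Integration.integral_add int_y)
  have G_scaleR: "G (r *\<^sub>R c) c' = r *\<^sub>R G c c'" for r c c'
    unfolding G_def by (simp add: scaleR_eq_scale vec.linear_scale[OF clin_usol] hdot_scale scaleR_conv_of_real)
  have lin: "linear \<gamma>"
    by (rule linearI) (simp_all add: \<gamma>_def vec_eq_iff G_add G_scaleR)
  moreover have "inj \<gamma>"
    unfolding linear_injective_0[OF lin]
  proof (intro allI impI)
    fix c assume "\<gamma> c = 0"
    then have G0: "G c (axis i 1) = 0" for i by (simp add: \<gamma>_def vec_eq_iff)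
    have "G c c = 0"
      using expand[of "usol z c" c, OF int_y] G0 unfolding G_def by simp
    moreover have "G c c = of_real (integral {0..X N} (\<lambda>t. (norm (usol z c t))\<^sup>2))"
      unfolding G_def
      by (rule integral_sq_hdot) (intro integrable_continuous_real continuous_intros cont)
    ultimately have "integral {0..X N} (\<lambda>t. (norm (usol z c t))\<^sup>2) = 0" by (metis of_real_eq_0_iff)
    then have "(\<Sum>k\<in>{1..N}. (cell z k c)\<^sup>2) = 0" by (simp only: usol_sq_integral[OF nz])
    then have "(cell z 1 c)\<^sup>2 = 0" by (rule sum_nonneg_0[rotated 2]) (use N in auto)
    then show "c = 0" using cell_definite[OF z] by simp
  qed
  ultimately have "surj \<gamma>" by (intro linear_injective_imp_surjective refl)
  then have "\<exists>c. (\<chi> i. integral {0..X N} (\<lambda>t. hdot (u t) (usol z (axis i 1) t))) = \<gamma> c" by (rule surjD)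
  then obtain c where c: "(\<chi> i. integral {0..X N} (\<lambda>t. hdot (u t) (usol z (axis i 1) t))) = \<gamma> c" ..
  have int_d: "(\<lambda>t. hdot (u t - usol z c t) (usol z c' t)) integrable_on {0..X N}" for c'
    unfolding hdot_diff by (intro integrable_diff int_u int_y)
  have "integral {0..X N} (\<lambda>t. hdot (u t - usol z c t) (usol z (axis i 1) t)) = 0" for i
    using c unfolding hdot_diff
    by (simp add: Henstock_Kurzweil_Integration.integral_diff int_u int_y \<gamma>_def G_def vec_eq_iff)
  then have "integral {0..X N} (\<lambda>t. hdot (u t - usol z c t) (usol z c' t)) = 0" for c'
    using expand[of "\<lambda>t. u t - usol z c t" c', OF int_d] by simp
  then show thesis by (rule that)
qed

text \<open>Let \<open>h\<close> be \<open>u\<close> minus its projection. It is orthogonal to all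
  solutions, so it lies in the range of \<open>H0\<close> minus the conjugate of \<open>z\<close>,
  and the adjoint relation makes it orthogonal to \<open>u\<close>. Hence \<open>h\<close> is
  orthogonal to itself. In this way weak solutions are identified with \<open>usol\<close> by
  finite-dimensional linear algebra in place of a regularity theorem.\<close>

lemma eigenvector_local:
  assumes z: "norm z = 1" and N: "N \<ge> 1" and u: "u \<in> L2 half_line"
    and adj: "\<And>f g. (f, g) \<in> H0 X \<Lambda> \<Longrightarrow> L2_inner half_line g u = L2_inner half_line f (\<lambda>t. z *s u t)"
  shows "\<exists>c. AE t in half_line. t \<le> X N \<longrightarrow> u t = usol z c t"
proof -
  have nz: "z \<noteq> 0" using z by auto
  obtain c where c: "\<And>c'. integral {0..X N} (\<lambda>t. hdot (u t - usol z c t) (usol z c' t)) = 0"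
    by (rule projection_exists[OF z N u]) blast
  define h where "h t = (if t \<in> {0..X N} then u t - usol z c t else 0)" for t
  have cont: "continuous_on {0..X N} (usol z c)"
    by (rule continuous_on_subset[OF continuous_usol[OF nz]]) auto
  have "(\<lambda>t. (norm (u t))\<^sup>2) absolutely_integrable_on {0..}"
    using u by (simp add: L2_def integrable_half_line)
  then have "(\<lambda>t. (norm (u t))\<^sup>2) absolutely_integrable_on {0..X N}"
    by (rule set_integrable_subset) auto
  then have "(\<lambda>t. if t \<in> {0..X N} then u t else 0) \<in> L2 half_line"
    using u by (intro L2_truncate set_lebesgue_integral_eq_integral(1)) (auto simp: L2_def)
  moreover have "(\<lambda>t. if t \<in> {0..X N} then usol z c t else 0) \<in> L2 half_line"
    by (intro L2_truncate measurable_half_line continuous_usol nz integrable_continuous_real continuous_intros cont)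
  ultimately have "(\<lambda>t. (if t \<in> {0..X N} then u t else 0) - (if t \<in> {0..X N} then usol z c t else 0)) \<in> L2 half_line"
    by (rule L2_diff)
  then have hL: "h \<in> L2 half_line"
    by (rule L2_cong_half_line) (simp add: h_def)
  have hu: "integral {0..X N} (\<lambda>t. hdot (h t) (v t)) = integral {0..X N} (\<lambda>t. hdot (u t - usol z c t) (v t))" for v
    by (rule integral_cong) (simp add: h_def)
  obtain f where f: "(f, \<lambda>t. cnj z *s f t + h t) \<in> H0 X \<Lambda>"
  proof (rule orthogonal_imp_range[OF nz N hL])
    show "h t = 0" if "t > X N" for t using that by (simp add: h_def)
    show "integral {0..X N} (\<lambda>t. hdot (h t) (usol z c' t)) = 0" for c' by (simp only: hu c)
  qed blast
  have fL: "f \<in> L2 half_line" "(\<lambda>t. cnj z *s f t + h t) \<in> L2 half_line" using H0_subset f by auto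
  have tail: "integral {0..X M} (\<lambda>t. hdot (h t) (v t)) = integral {0..X N} (\<lambda>t. hdot (h t) (v t))"
    if "N \<le> M" "v \<in> L2 half_line" for M v
  proof -
    have "(\<lambda>t. hdot (h t) (v t)) absolutely_integrable_on {0..}"
      using L2_hdot_integrable(2)[OF hL that(2)] by (simp add: integrable_half_line)
    then have "(\<lambda>t. hdot (h t) (v t)) integrable_on {0..X M}"
      by (intro set_lebesgue_integral_eq_integral(1)) (rule set_integrable_subset, auto)
    then have "integral {0..X M} (\<lambda>t. hdot (h t) (v t))
        = integral {0..X N} (\<lambda>t. hdot (h t) (v t)) + integral {X N..X M} (\<lambda>t. hdot (h t) (v t))"
      using Henstock_Kurzweil_Integration.integral_combine[OF X_nonneg X_mono[OF that(1)]] by metis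
    also have "integral {X N..X M} (\<lambda>t. hdot (h t) (v t)) = integral {X N..X M} (\<lambda>t. 0)"
      by (rule integral_spike[of "{X N}"]) (auto simp: h_def)
    finally show ?thesis by simp
  qed
  have "(\<lambda>M. integral {0..X M} (\<lambda>t. hdot (h t) (u t))) \<longlonglongrightarrow> 0"
    using inner_difference_limit[OF fL u, of z] adj[OF f] by simp
  moreover have "(\<lambda>M. integral {0..X M} (\<lambda>t. hdot (h t) (u t))) \<longlonglongrightarrow> integral {0..X N} (\<lambda>t. hdot (h t) (u t))"
    by (intro tendsto_eventually eventually_sequentiallyI[of N] tail u)
  ultimately have 0: "integral {0..X N} (\<lambda>t. hdot (h t) (u t)) = 0" by (rule LIMSEQ_unique[rotated])
  have habs: "h absolutely_integrable_on {0..X N}" by (rule L2_locally_integrable[OF hL])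
  have "integral {0..X N} (\<lambda>t. hdot (h t) (h t))
      = integral {0..X N} (\<lambda>t. hdot (h t) (u t) - hdot (h t) (usol z c t))"
    by (rule integral_cong) (simp add: h_def hdot_diff)
  also have "\<dots> = integral {0..X N} (\<lambda>t. hdot (h t) (u t)) - integral {0..X N} (\<lambda>t. hdot (h t) (usol z c t))"
  proof (rule Henstock_Kurzweil_Integration.integral_diff)
    have "(\<lambda>t. hdot (h t) (u t)) absolutely_integrable_on {0..}"
      using L2_hdot_integrable(2)[OF hL u] by (simp add: integrable_half_line)
    then show "(\<lambda>t. hdot (h t) (u t)) integrable_on {0..X N}"
      by (intro set_lebesgue_integral_eq_integral(1)) (rule set_integrable_subset, auto)
    show "(\<lambda>t. hdot (h t) (usol z c t)) integrable_on {0..X N}"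
      by (rule integrable_hdot_continuous[OF habs cont])
  qed
  also have "\<dots> = 0" using 0 hu[of "usol z c"] c by simp
  finally have hh: "integral {0..X N} (\<lambda>t. hdot (h t) (h t)) = 0" .
  have "(\<lambda>M. integral {0..X M} (\<lambda>t. hdot (h t) (h t))) \<longlonglongrightarrow> integral {0..X N} (\<lambda>t. hdot (h t) (h t))"
    by (intro tendsto_eventually eventually_sequentiallyI[of N] tail hL)
  then have "(\<lambda>M. integral {0..X M} (\<lambda>t. hdot (h t) (h t))) \<longlonglongrightarrow> 0" by (simp only: hh)
  then have "(\<integral>t. hdot (h t) (h t) \<partial>half_line) = 0"
    using integral_half_line_limit[OF L2_hdot_integrable(2)[OF hL hL] X_lim] LIMSEQ_unique by blast
  then have "(\<integral>t. (norm (h t))\<^sup>2 \<partial>half_line) = 0"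
    by (simp add: hdot_self del: of_real_power)
  moreover have "integrable half_line (\<lambda>t. (norm (h t))\<^sup>2)" using hL by (simp add: L2_def)
  ultimately have "AE t in half_line. (norm (h t))\<^sup>2 = 0"
    by (subst (asm) integral_nonneg_eq_0_iff_AE) auto
  moreover have "AE t in half_line. t > 0" by (rule AE_I2) simp
  ultimately have "AE t in half_line. t \<le> X N \<longrightarrow> u t = usol z c t"
    by eventually_elim (auto simp: h_def)
  then show ?thesis by blast
qed

text \<open>The parameters found on the first \<open>N\<close> cells agree for all \<open>N\<close>,
  because the first cell already determines them.\<close>

lemma eigenspace_adjoint:
  assumes z: "norm z = 1"
  shows "op_eigenspace (op_adjoint half_line (H_op X \<Lambda>)) z
    = {u \<in> L2 half_line. \<exists>c. AE t in half_line. u t = usol z c t}" (is "?E = ?S")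
proof -
  have nz: "z \<noteq> 0" using z by auto
  have adj: "op_adjoint half_line (H_op X \<Lambda>) = op_adjoint half_line (H0 X \<Lambda>)"
    unfolding H_op_def by (rule op_adjoint_closure[OF H0_subset])
  have "u \<in> ?S" if "u \<in> ?E" for u
  proof -
    have u: "u \<in> L2 half_line" and inner: "\<And>f g. (f, g) \<in> H0 X \<Lambda> \<Longrightarrow>
        L2_inner half_line g u = L2_inner half_line f (\<lambda>t. z *s u t)"
      using that unfolding adj unfolding op_eigenspace_def op_adjoint_def by auto
    have "\<forall>N. \<exists>c. AE t in half_line. t \<le> X (Suc N) \<longrightarrow> u t = usol z c t"
      using eigenvector_local[OF z _ u inner] by simp
    then obtain c where c: "\<And>N. AE t in half_line. t \<le> X (Suc N) \<longrightarrow> u t = usol z (c N) t" by metis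
    have c_eq: "c N = c 0" for N
    proof -
      have "AE t in half_line. t \<le> X 1 \<longrightarrow> usol z (c N - c 0) t = 0"
        using c[of N] c[of 0]
      proof eventually_elim
        case (elim t)
        then show ?case using X_mono[of 1 "Suc N"] by (auto simp: vec.linear_diff[OF clin_usol])
      qed
      from usol_definite[OF z this] show ?thesis by simp
    qed
    have "AE t in half_line. \<forall>N. t \<le> X (Suc N) \<longrightarrow> u t = usol z (c 0) t"
      unfolding AE_all_countable using c c_eq by metis
    then have "AE t in half_line. u t = usol z (c 0) t"
    proof eventually_elim
      case (elim t)
      obtain N where "t < X N" using X_unbounded by blast
      then show ?case using elim X_less[of N] by (meson less_imp_le less_trans)
    qed
    then show ?thesis using u by blast
  qed
  moreover have "u \<in> ?E" if "u \<in> ?S" for u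
  proof -
    have u: "u \<in> L2 half_line" using that by simp
    have "L2_inner half_line g u = L2_inner half_line f (\<lambda>t. z *s u t)" if "(f, g) \<in> H0 X \<Lambda>" for f g
      using usol_eigenvector[OF nz u _ that] \<open>u \<in> ?S\<close> by blast
    then show ?thesis
      unfolding adj unfolding op_eigenspace_def op_adjoint_def using u L2_scale[OF u, of z] by auto
  qed
  ultimately show ?thesis by blast
qed

lemma L2_dim_eigenspace:
  assumes z: "norm z = 1"
  shows "L2_dim half_line (op_eigenspace (op_adjoint half_line (H_op X \<Lambda>)) z)
    = enat (vec.dim {c. usol z c \<in> L2 half_line})"
proof (rule L2_dim_solutions[OF clin_usol _ _ eigenspace_adjoint[OF z]])
  have "z \<noteq> 0" using z by auto
  then show "usol z c \<in> borel_measurable half_line" for c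
    by (intro measurable_half_line continuous_usol)
  show "c = 0" if "AE t in half_line. usol z c t = 0" for c
    by (rule usol_definite[OF z]) (use that in \<open>auto elim: eventually_mono\<close>)
qed

end

subsection \<open>Square-summable sequences\<close>

definition sq_summable :: "(nat \<Rightarrow> real) \<Rightarrow> bool" where
  "sq_summable b \<longleftrightarrow> summable (\<lambda>n. (b n)\<^sup>2)"

lemma sq_summable_dominated:
  assumes "sq_summable c" "\<And>n. n \<ge> n0 \<Longrightarrow> \<bar>b n\<bar> \<le> c n"
  shows "sq_summable b"
  unfolding sq_summable_def
proof (rule summable_comparison_test'[of _ n0])
  show "summable (\<lambda>n. (c n)\<^sup>2)" using assms(1) by (simp add: sq_summable_def)
  show "norm ((b n)\<^sup>2) \<le> (c n)\<^sup>2" if "n \<ge> n0" for n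
    using assms(2)[OF that] abs_le_square_iff[of "b n" "c n"] by simp
qed

lemma sq_summable_scale: "sq_summable b \<Longrightarrow> sq_summable (\<lambda>n. K * b n)"
  by (simp add: sq_summable_def power_mult_distrib)

lemma sq_summable_add:
  assumes "sq_summable b" "sq_summable c"
  shows "sq_summable (\<lambda>n. b n + c n)"
  unfolding sq_summable_def
proof (rule summable_comparison_test'[of _ 0])
  show "summable (\<lambda>n. 2 * (b n)\<^sup>2 + 2 * (c n)\<^sup>2)"
    using assms by (intro summable_add summable_mult) (auto simp: sq_summable_def)
  have "(b n + c n)\<^sup>2 \<le> 2 * (b n)\<^sup>2 + 2 * (c n)\<^sup>2" for n
    using sum_squares_bound[of "b n" "c n"] by (simp add: power2_sum)
  then show "norm ((b n + c n)\<^sup>2) \<le> 2 * (b n)\<^sup>2 + 2 * (c n)\<^sup>2" for n by simp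
qed

lemma sq_summable_reindex: "sq_summable b \<Longrightarrow> inj g \<Longrightarrow> sq_summable (\<lambda>n. b (g n))"
  using summable_reindex[of "\<lambda>n. (b n)\<^sup>2" g] by (simp add: sq_summable_def o_def)

lemma sq_summable_Suc: "sq_summable (\<lambda>n. b (Suc n)) \<longleftrightarrow> sq_summable b"
  unfolding sq_summable_def by (rule summable_Suc_iff)

lemma sq_summable_bounded: "sq_summable b \<longleftrightarrow> (\<exists>C. \<forall>N. (\<Sum>k<N. (b k)\<^sup>2) \<le> C)"
proof
  assume "sq_summable b"
  then have "(\<Sum>k<N. (b k)\<^sup>2) \<le> (\<Sum>k. (b k)\<^sup>2)" for N
    unfolding sq_summable_def by (rule sum_le_suminf) auto
  then show "\<exists>C. \<forall>N. (\<Sum>k<N. (b k)\<^sup>2) \<le> C" by blast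
next
  assume "\<exists>C. \<forall>N. (\<Sum>k<N. (b k)\<^sup>2) \<le> C"
  then show "sq_summable b"
    unfolding sq_summable_def by (auto intro: summableI_nonneg_bounded)
qed

lemma sq_summable_interleave:
  assumes "sq_summable (\<lambda>k. b (2 * k + 1))" "sq_summable (\<lambda>k. b (2 * k + 2))"
  shows "sq_summable b"
proof -
  obtain C D where C: "\<And>N. (\<Sum>k<N. (b (2 * k + 1))\<^sup>2) \<le> C" and D: "\<And>N. (\<Sum>k<N. (b (2 * k + 2))\<^sup>2) \<le> D"
    using assms unfolding sq_summable_bounded by blast
  have eq: "(\<Sum>n<2 * N. (b (Suc n))\<^sup>2) = (\<Sum>k<N. (b (2 * k + 1))\<^sup>2) + (\<Sum>k<N. (b (2 * k + 2))\<^sup>2)" for N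
    by (induction N) simp_all
  have "(\<Sum>n<N. (b (Suc n))\<^sup>2) \<le> C + D" for N
  proof -
    have "(\<Sum>n<N. (b (Suc n))\<^sup>2) \<le> (\<Sum>n<2 * N. (b (Suc n))\<^sup>2)" by (rule sum_mono2) auto
    then show ?thesis unfolding eq using C[of N] D[of N] by linarith
  qed
  then have "sq_summable (\<lambda>n. b (Suc n))" unfolding sq_summable_bounded by blast
  then show ?thesis by (simp only: sq_summable_Suc)
qed

lemma sq_summable_tendsto_0: "sq_summable b \<Longrightarrow> b \<longlonglongrightarrow> 0"
  unfolding sq_summable_def by (drule summable_LIMSEQ_zero) simp

lemma L2_pos_nats_sq_summable: "u \<in> L2 pos_nats \<longleftrightarrow> sq_summable (\<lambda>n. norm (u n))"
  unfolding L2_pos_nats sq_summable_Suc[of "\<lambda>n. norm (u n)", symmetric] sq_summable_bounded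
  by (simp add: sum.atLeast1_atMost_eq)

subsection \<open>The two Jacobi matrices\<close>

definition a1 :: "(nat \<Rightarrow> real) \<Rightarrow> (nat \<Rightarrow> complex ^ 'p ^ 'p) \<Rightarrow> nat \<Rightarrow> complex ^ 'p ^ 'p" where
  "a1 X \<Lambda> n = (let k = (n + 1) div 2 in
     if n = 1 then 0
     else if odd n then (1 / gap X k) *\<^sub>R \<Lambda> (k - 1)
     else (- 1 / (gap X k)\<^sup>2) *\<^sub>R mat 1)"

definition b1 :: "(nat \<Rightarrow> real) \<Rightarrow> nat \<Rightarrow> real" where
  "b1 X n = (let k = (n + 1) div 2 in
     if odd n then - 1 / (gap X k)\<^sup>2 else gap X k powr (- 3 / 2) * gap X (k + 1) powr (- 1 / 2))"

definition a2 :: "(nat \<Rightarrow> real) \<Rightarrow> (nat \<Rightarrow> complex ^ 'p ^ 'p) \<Rightarrow> nat \<Rightarrow> complex ^ 'p ^ 'p" where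
  "a2 X \<Lambda> k = (1 / (gap X k * gap X (k + 1))) *\<^sub>R mat 1 + (1 / (gap X k + gap X (k + 1))) *\<^sub>R \<Lambda> k"

definition b2 :: "(nat \<Rightarrow> real) \<Rightarrow> nat \<Rightarrow> real" where
  "b2 X k = - 1 / (rad X k * rad X (k + 1) * gap X (k + 1))"

lemma J1_eq: "J1 X \<Lambda> = block_jacobi (a1 X \<Lambda>) (\<lambda>n. b1 X n *\<^sub>R mat 1)"
proof -
  have "(\<lambda>n. let k = (n + 1) div 2 in if odd n then (- 1 / (gap X k)\<^sup>2) *\<^sub>R mat 1
      else (gap X k powr (- 3 / 2) * gap X (k + 1) powr (- 1 / 2)) *\<^sub>R mat 1)
    = (\<lambda>n. b1 X n *\<^sub>R mat 1 :: complex ^ 'a ^ 'a)"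
    by (auto simp: b1_def Let_def)
  then show ?thesis unfolding J1_def a1_def[abs_def] by simp
qed

lemma J2_eq: "J2 X \<Lambda> = block_jacobi (a2 X \<Lambda>) (\<lambda>n. b2 X n *\<^sub>R mat 1)"
  by (simp add: J2_def a2_def[abs_def] b2_def)

lemma hermitian_scaleR:
  fixes A :: "complex ^ 'p ^ 'p"
  assumes "A = map_matrix cnj (transpose A)"
  shows "r *\<^sub>R A = map_matrix cnj (transpose (r *\<^sub>R A))"
proof -
  have "map_matrix cnj (transpose (r *\<^sub>R A)) = r *\<^sub>R map_matrix cnj (transpose A)"
    by (simp add: vec_eq_iff map_matrix_def transpose_def)
  then show ?thesis using arg_cong[OF assms, of "(*\<^sub>R) r"] by (rule trans[OF _ sym, rotated])
qed

lemma hermitian_mat: "(mat 1 :: complex ^ 'p ^ 'p) = map_matrix cnj (transpose (mat 1))"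
  by (simp add: vec_eq_iff map_matrix_def transpose_def mat_def)

lemma hermitian_add:
  fixes A B :: "complex ^ 'p ^ 'p"
  assumes "A = map_matrix cnj (transpose A)" "B = map_matrix cnj (transpose B)"
  shows "A + B = map_matrix cnj (transpose (A + B))"
proof -
  have "map_matrix cnj (transpose (A + B)) = map_matrix cnj (transpose A) + map_matrix cnj (transpose B)"
    by (simp add: vec_eq_iff map_matrix_def transpose_def)
  then show ?thesis using arg_cong2[OF assms, of "(+)"] by (rule trans[OF _ sym, rotated])
qed

lemma scaled_matrix_mult: "(r *\<^sub>R A) *v x = r *\<^sub>R (A *v (x :: complex ^ 'p))"
  by (simp add: vec_eq_iff matrix_vector_mult_def scaleR_sum_right)

lemma matrix_mult_scaleR: "A *v (r *\<^sub>R x) = r *\<^sub>R (A *v (x :: complex ^ 'p))"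
  by (simp add: scaleR_eq_scale vec.scale)

lemma Im_hdot_scale_self: "Im (hdot x (A *v x)) = 0" if "A = map_matrix cnj (transpose A)"
  using hdot_matrix[OF that, of x x] hdot_commute[of "A *v x" x] by (simp add: complex_eq_iff)

text \<open>
  On the cell \<open>(X k, X (Suc k))\<close> of length \<open>p k ^ 2\<close> the boundary form is expressed through the
  boundary triplet of Kostenko and Malamud.
\<close>

lemma interval_form:
  fixes f0 f1 g1 t0 y0 y1 p0 q0 :: "complex ^ 'p" and p :: real
  assumes p: "p > 0"
  shows "omega f1 g1 y1 q1 - omega f0 t0 y0 q0
    = hdot ((1 / p) *\<^sub>R (t0 - g1)) (p *\<^sub>R y0)
      + hdot ((1 / p ^ 3) *\<^sub>R (f1 - f0 - p\<^sup>2 *\<^sub>R g1)) (p ^ 3 *\<^sub>R q1)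
      - hdot (p *\<^sub>R f0) ((1 / p) *\<^sub>R (q0 - q1))
      - hdot (p ^ 3 *\<^sub>R g1) ((1 / p ^ 3) *\<^sub>R (y1 - y0 - p\<^sup>2 *\<^sub>R q1))"
  using p by (simp add: omega_def hdot_scaleR) (simp add: hdot_add hdot_diff hdot_scaleR algebra_simps)

section \<open>Rescaled gaps and the rows of the two matrices\<close>

locale delta_bounded = delta_interactions X \<Lambda>
  for X :: "nat \<Rightarrow> real" and \<Lambda> :: "nat \<Rightarrow> complex ^ 'p ^ 'p" +
  fixes D :: real
  assumes gap_le: "gap X (Suc k) \<le> D"
begin

text \<open>With the square root of the gap as the unit, all half-integer powers of gaps become
  integer powers. The index is that of the left node of the cell.\<close>

definition p :: "nat \<Rightarrow> real" where "p k = sqrt (gap X (Suc k))"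

abbreviation "r \<equiv> rad X"

lemma gap_Suc: "gap X (Suc k) = (p k)\<^sup>2" "X (Suc k) - X k = (p k)\<^sup>2"
  using X_less[of k] by (simp_all add: p_def gap_def)

lemma p_pos: "p k > 0"
  using X_less[of k] by (simp add: p_def gap_def)

lemma p_nz: "p k \<noteq> 0"
  using p_pos[of k] by simp

lemma p_le: "(p k)\<^sup>2 \<le> D"
  using gap_le[of k] by (simp add: gap_Suc)

lemma r_sq: "(r (Suc k))\<^sup>2 = (p k)\<^sup>2 + (p (Suc k))\<^sup>2"
  by (simp add: rad_def gap_Suc)

lemma r_pos: "r (Suc k) > 0"
  using p_pos[of k] p_pos[of "Suc k"] by (simp add: rad_def gap_Suc add_pos_pos)

lemma r_nz: "r (Suc k) \<noteq> 0"
  using r_pos[of k] by simp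

lemma p_le_r: "p k \<le> r (Suc k)" "p (Suc k) \<le> r (Suc k)"
  by (rule power2_le_imp_le; simp add: r_sq r_pos less_imp_le)+

lemma b1_eq: "b1 X (2 * k + 1) = - 1 / (p k) ^ 4" "b1 X (2 * k + 2) = 1 / ((p k) ^ 3 * p (Suc k))"
proof -
  show "b1 X (2 * k + 1) = - 1 / (p k) ^ 4"
    by (simp add: b1_def Let_def gap_Suc power_mult[symmetric])
  have sq: "(x\<^sup>2) powr y = x powr (2 * y)" if "x > 0" for x y :: real
    using that powr_powr[of x 2 y] by (simp add: powr_numeral)
  have "((p k)\<^sup>2) powr (- 3 / 2) = 1 / (p k) ^ 3"
    using p_pos[of k] by (simp add: sq powr_minus_divide powr_numeral)
  moreover have "((p (Suc k))\<^sup>2) powr (- 1 / 2) = 1 / p (Suc k)"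
    using p_pos[of "Suc k"] by (simp add: sq powr_minus_divide)
  ultimately show "b1 X (2 * k + 2) = 1 / ((p k) ^ 3 * p (Suc k))"
    using gap_Suc(1)[of k] gap_Suc(1)[of "Suc k"] by (simp add: b1_def Let_def)
qed

lemma jacobi1: "jacobi (a1 X \<Lambda>) (b1 X)"
proof
  fix n :: nat assume n: "n \<ge> 1"
  let ?k = "(n + 1) div 2"
  consider "n = 1" | "odd n" "n \<noteq> 1" | "even n" by blast
  then show "a1 X \<Lambda> n = map_matrix cnj (transpose (a1 X \<Lambda> n))"
  proof cases
    case 1
    then show ?thesis by (simp add: a1_def vec_eq_iff map_matrix_def transpose_def)
  next
    case 2
    have "a1 X \<Lambda> n = (1 / gap X ?k) *\<^sub>R \<Lambda> (?k - 1)" using 2 by (simp add: a1_def Let_def)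
    moreover have "?k - 1 \<ge> 1" using n 2 by (auto elim!: oddE)
    ultimately show ?thesis by (metis hermitian hermitian_scaleR)
  next
    case 3
    have "a1 X \<Lambda> n = (- 1 / (gap X ?k)\<^sup>2) *\<^sub>R mat 1" using 3 by (auto simp: a1_def Let_def)
    then show ?thesis by (metis hermitian_mat hermitian_scaleR)
  qed
  show "b1 X n \<noteq> 0"
  proof (cases "odd n")
    case True
    then obtain k where "n = 2 * k + 1" by (auto elim: oddE)
    then show ?thesis using p_nz b1_eq(1)[of k] by simp
  next
    case False
    then obtain j where j: "n = 2 * j" by (auto elim: evenE)
    then obtain k where "j = Suc k" using n by (cases j) auto
    then show ?thesis using p_nz b1_eq(2)[of k] j by simp
  qed
qed

lemma jacobi2: "jacobi (a2 X \<Lambda>) (b2 X)"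
proof
  fix n :: nat assume n: "n \<ge> 1"
  show "a2 X \<Lambda> n = map_matrix cnj (transpose (a2 X \<Lambda> n))"
    unfolding a2_def by (intro hermitian_add hermitian_scaleR hermitian_mat hermitian n)
  obtain k where "n = Suc k" using n by (cases n) auto
  then show "b2 X n \<noteq> 0" using r_nz p_nz by (simp add: b2_def gap_Suc)
qed

lemma row1_odd:
  "jac_apply (a1 X \<Lambda>) (b1 X) u (2 * Suc k + 1) = (1 / ((p k) ^ 3 * p (Suc k))) *\<^sub>R u (2 * k + 2)
    + (1 / (p (Suc k))\<^sup>2) *\<^sub>R (\<Lambda> (Suc k) *v u (2 * k + 3)) - (1 / (p (Suc k)) ^ 4) *\<^sub>R u (2 * k + 4)"
proof -
  have idx: "2 * Suc k + 1 - 1 = 2 * k + 2" "Suc (2 * Suc k + 1) = 2 * k + 4" "2 * Suc k + 1 = 2 * k + 3"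
    by auto
  have a: "a1 X \<Lambda> (2 * k + 3) = (1 / (p (Suc k))\<^sup>2) *\<^sub>R \<Lambda> (Suc k)"
    using gap_Suc(1)[of "Suc k"] by (simp add: a1_def Let_def)
  have b: "b1 X (2 * k + 3) = - 1 / (p (Suc k)) ^ 4" using b1_eq(1)[of "Suc k"] unfolding idx(3) .
  show ?thesis
    unfolding jac_apply_def idx(1,2) b1_eq(2) unfolding idx(3) a b
    by (simp only: scaled_matrix_mult) simp
qed

lemma row1_1:
  assumes "u 0 = 0"
  shows "jac_apply (a1 X \<Lambda>) (b1 X) u 1 = - (1 / (p 0) ^ 4) *\<^sub>R u 2"
proof -
  have idx: "1 - 1 = (0 :: nat)" "Suc 1 = 2" by auto
  have "b1 X 1 = - 1 / (p 0) ^ 4" using b1_eq(1)[of 0] by simp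
  then show ?thesis unfolding jac_apply_def idx by (simp add: assms a1_def)
qed

lemma row1_even:
  "jac_apply (a1 X \<Lambda>) (b1 X) u (2 * k + 2) = - (1 / (p k) ^ 4) *\<^sub>R u (2 * k + 1)
    - (1 / (p k) ^ 4) *\<^sub>R u (2 * k + 2) + (1 / ((p k) ^ 3 * p (Suc k))) *\<^sub>R u (2 * k + 3)"
proof -
  have idx: "2 * k + 2 - 1 = 2 * k + 1" "Suc (2 * k + 2) = 2 * k + 3" by auto
  have a: "a1 X \<Lambda> (2 * k + 2) = (- 1 / (p k) ^ 4) *\<^sub>R mat 1"
    by (simp add: a1_def Let_def gap_Suc power_mult[symmetric])
  show ?thesis
    unfolding jac_apply_def idx a b1_eq by (simp only: scaled_matrix_mult) simp
qed

text \<open>After division by \<open>r\<close> the second matrix is the finite-difference form of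
  the interface condition: up to the factor 1 / \<open>r\<close>, a row is
  \<open>\<Lambda> f\<close> plus the left minus the right difference quotient.\<close>

lemma row2:
  assumes "u 0 = 0" and u: "\<And>n. n \<ge> 1 \<Longrightarrow> u n = r n *\<^sub>R f n" and "k = 0 \<Longrightarrow> f 0 = 0"
  shows "jac_apply (a2 X \<Lambda>) (b2 X) u (Suc k) = (1 / r (Suc k)) *\<^sub>R (\<Lambda> (Suc k) *v f (Suc k)
    + (1 / (p k)\<^sup>2) *\<^sub>R (f (Suc k) - f k) - (1 / (p (Suc k))\<^sup>2) *\<^sub>R (f (Suc (Suc k)) - f (Suc k)))"
proof -
  have b: "b2 X (Suc k) *\<^sub>R u (Suc (Suc k)) = - (1 / (r (Suc k) * (p (Suc k))\<^sup>2)) *\<^sub>R f (Suc (Suc k))"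
    using r_nz[of "Suc k"] u[of "Suc (Suc k)"] by (simp add: b2_def gap_Suc)
  have b': "b2 X k *\<^sub>R u k = - (1 / (r (Suc k) * (p k)\<^sup>2)) *\<^sub>R f k"
  proof (cases k)
    case 0
    then show ?thesis using assms by simp
  next
    case (Suc j)
    then show ?thesis using r_nz[of j] u[of k] by (simp add: b2_def gap_Suc)
  qed
  \<comment> \<open>The square of \<open>r\<close> is the sum of the two gaps, which splits the
    diagonal entry between the two difference quotients.\<close>
  have rr: "r (Suc k) / ((p k)\<^sup>2 * (p (Suc k))\<^sup>2) = 1 / (r (Suc k) * (p k)\<^sup>2) + 1 / (r (Suc k) * (p (Suc k))\<^sup>2)"
    using r_nz[of k] p_nz[of k] p_nz[of "Suc k"] r_sq[of k] by (simp add: divide_simps power2_eq_square)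
  have rL: "r (Suc k) / ((p k)\<^sup>2 + (p (Suc k))\<^sup>2) = 1 / r (Suc k)"
    unfolding r_sq[symmetric] using r_nz[of k] by (simp add: power2_eq_square)
  have "a2 X \<Lambda> (Suc k) *v u (Suc k) = (r (Suc k) / ((p k)\<^sup>2 * (p (Suc k))\<^sup>2)) *\<^sub>R f (Suc k)
      + (r (Suc k) / ((p k)\<^sup>2 + (p (Suc k))\<^sup>2)) *\<^sub>R (\<Lambda> (Suc k) *v f (Suc k))"
    using u[of "Suc k"]
    by (simp add: a2_def gap_Suc matrix_vector_mult_add_rdistrib scaled_matrix_mult matrix_mult_scaleR
        scaleR_add_right)
  then show ?thesis
    unfolding rr rL jac_apply_def b using b'
    by (simp add: scaleR_add_right scaleR_diff_right scaleR_add_left algebra_simps)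
qed

abbreviation "sol1 \<equiv> jac_sol (a1 X \<Lambda>) (b1 X)"

abbreviation "sol2 \<equiv> jac_sol (a2 X \<Lambda>) (b2 X)"

abbreviation "S_H z \<equiv> {c. usol z c \<in> L2 half_line}"

abbreviation "S_1 z \<equiv> {c. sol1 z c \<in> L2 pos_nats}"

abbreviation "S_2 z \<equiv> {c. sol2 z c \<in> L2 pos_nats}"

definition K :: real where "K = 6 + D\<^sup>2"

lemma cell_bounds:
  assumes z: "norm z = 1"
  shows "norm (p k *\<^sub>R P z c k) \<le> K * cell z (Suc k) c"
    and "norm ((p k) ^ 3 *\<^sub>R dpc z c k (X (Suc k))) \<le> K * cell z (Suc k) c"
    and "norm ((1 / p k) *\<^sub>R (Q z c k - dpc z c k (X (Suc k)))) \<le> K * cell z (Suc k) c"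
    and "norm ((1 / (p k) ^ 3) *\<^sub>R (P z c (Suc k) - P z c k - (p k)\<^sup>2 *\<^sub>R dpc z c k (X (Suc k))))
      \<le> K * cell z (Suc k) c"
proof -
  have D: "X (Suc k) - X k \<le> D" using gap_le[of k] by (simp add: gap_def)
  have sq: "sqrt ((p k)\<^sup>2) = p k" "(p k)\<^sup>2 * p k = (p k) ^ 3"
    using p_pos[of k] by (simp_all add: power2_eq_square power3_eq_cube)
  show "norm (p k *\<^sub>R P z c k) \<le> K * cell z (Suc k) c"
    "norm ((p k) ^ 3 *\<^sub>R dpc z c k (X (Suc k))) \<le> K * cell z (Suc k) c"
    "norm ((1 / p k) *\<^sub>R (Q z c k - dpc z c k (X (Suc k)))) \<le> K * cell z (Suc k) c"
    "norm ((1 / (p k) ^ 3) *\<^sub>R (P z c (Suc k) - P z c k - (p k)\<^sup>2 *\<^sub>R dpc z c k (X (Suc k))))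
      \<le> K * cell z (Suc k) c"
    using cell_estimate[OF z D, of c] unfolding gap_Suc(2) sq K_def by blast+
qed

lemma S_H_iff:
  assumes "z \<noteq> 0"
  shows "c \<in> S_H z \<longleftrightarrow> sq_summable (\<lambda>k. cell z (Suc k) c)"
  unfolding sq_summable_bounded sum_cell[symmetric] usol_sq_integral[OF assms, symmetric]
  using L2_half_line[OF continuous_usol[OF assms]] by simp

section \<open>From the differential operator to the first matrix\<close>

lemma H_energy:
  fixes s :: real
  assumes s: "s = 1 \<or> s = - 1"
  shows "s * Im (hdot (P (\<i> * s) c N) (Q (\<i> * s) c N)) = (\<Sum>k\<in>{1..N}. (cell (\<i> * s) k c)\<^sup>2)"
  using weyl_system.E_eq[OF weyl[OF s], of N c] unfolding weyl_system.E_def[OF weyl[OF s]] by simp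

text \<open>
  \<open>hw z c\<close> is \<open>\<Gamma>\<^sub>0\<close> of the solution with initial value \<open>c\<close>; the rows of the first matrix applied to it are \<open>\<Gamma>\<^sub>1\<close>.
\<close>

definition hw :: "complex \<Rightarrow> complex ^ 'p \<Rightarrow> nat \<Rightarrow> complex ^ 'p" where
  "hw z c n = (if n = 0 then 0 else let k = (n - 1) div 2 in
     if odd n then p k *\<^sub>R P z c k else (p k) ^ 3 *\<^sub>R dpc z c k (X (Suc k)))"

lemma hw_simps: "hw z c 0 = 0" "hw z c (2 * k + 1) = p k *\<^sub>R P z c k"
  "hw z c (2 * k + 2) = (p k) ^ 3 *\<^sub>R dpc z c k (X (Suc k))"
  by (simp_all add: hw_def Let_def)

lemma hw_rows:
  "jac_apply (a1 X \<Lambda>) (b1 X) (hw z c) (2 * k + 1) = (1 / p k) *\<^sub>R (Q z c k - dpc z c k (X (Suc k)))"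
  "jac_apply (a1 X \<Lambda>) (b1 X) (hw z c) (2 * k + 2)
    = (1 / (p k) ^ 3) *\<^sub>R (P z c (Suc k) - P z c k - (p k)\<^sup>2 *\<^sub>R dpc z c k (X (Suc k)))"
proof -
  show "jac_apply (a1 X \<Lambda>) (b1 X) (hw z c) (2 * k + 1) = (1 / p k) *\<^sub>R (Q z c k - dpc z c k (X (Suc k)))"
  proof (cases k)
    \<comment> \<open>Here \<open>Q z c 0 = 0\<close>: the zero block at (1, 1) encodes the Neumann
      condition.\<close>
    case 0
    have idx: "2 * 0 + 1 = (1 :: nat)" "hw z c 2 = (p 0) ^ 3 *\<^sub>R dpc z c 0 (X (Suc 0))"
      by (simp_all add: hw_def)
    show ?thesis
      unfolding 0 idx(1) row1_1[of "hw z c", OF hw_simps(1)] idx(2) using p_nz[of 0]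
      by (simp add: field_simps power_numeral_reduce)
  next
    case (Suc j)
    have idx: "hw z c (2 * j + 3) = p (Suc j) *\<^sub>R P z c (Suc j)"
      "hw z c (2 * j + 4) = (p (Suc j)) ^ 3 *\<^sub>R dpc z c (Suc j) (X (Suc (Suc j)))"
      by (simp_all add: hw_def Let_def)
    have c: "1 / ((p j) ^ 3 * p (Suc j)) * (p j) ^ 3 = 1 / p (Suc j)" "1 / (p (Suc j))\<^sup>2 * p (Suc j) = 1 / p (Suc j)"
      "1 / (p (Suc j)) ^ 4 * (p (Suc j)) ^ 3 = 1 / p (Suc j)"
      using p_nz[of j] p_nz[of "Suc j"] by (simp_all add: field_simps power_numeral_reduce)
    show ?thesis
      unfolding Suc row1_odd hw_simps idx matrix_mult_scaleR scaleR_scaleR c P_Suc(2)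
      by (simp add: scaleR_add_right scaleR_diff_right)
  qed
  have idx: "hw z c (2 * k + 3) = p (Suc k) *\<^sub>R P z c (Suc k)"
    by (simp add: hw_def Let_def)
  have c: "1 / (p k) ^ 4 * p k = 1 / (p k) ^ 3" "1 / (p k) ^ 4 * (p k) ^ 3 = 1 / (p k) ^ 3 * (p k)\<^sup>2"
    "1 / ((p k) ^ 3 * p (Suc k)) * p (Suc k) = 1 / (p k) ^ 3"
    using p_nz[of k] p_nz[of "Suc k"] by (simp_all add: field_simps power_numeral_reduce)
  show "jac_apply (a1 X \<Lambda>) (b1 X) (hw z c) (2 * k + 2)
    = (1 / (p k) ^ 3) *\<^sub>R (P z c (Suc k) - P z c k - (p k)\<^sup>2 *\<^sub>R dpc z c k (X (Suc k)))"
    unfolding row1_even hw_simps idx scaleR_minus_left scaleR_scaleR c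
    using c by (simp add: scaleR_diff_right)
qed

lemma clin_hw: "clin (\<lambda>c. hw z c n)"
proof -
  consider "n = 0" | k where "n = 2 * k + 1" | k where "n = 2 * k + 2"
    by (metis add_2_eq_Suc' evenE mult_Suc_right not0_implies_Suc oddE mult_0_right add.commute)
  then show ?thesis
  proof cases
    case 1
    show ?thesis unfolding 1 hw_simps by (rule clin_zero)
  next
    case 2
    show ?thesis unfolding 2 hw_simps by (intro clin_scaleR clin_P)
  next
    case 3
    show ?thesis unfolding 3 hw_simps by (intro clin_scaleR clin_piece clin_P)
  qed
qed

text \<open>The transported sequence and its image under the matrix consist of triplet components,
  each bounded by the norm on a cell. At \<open>2 * N\<close> the roles of value and slope are
  exchanged, and the form is exactly the energy of the solution up to node \<open>N\<close>, hence
  at least that of the first cell.\<close>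

theorem dim_H_le_J1:
  fixes s :: real
  assumes s: "s = 1 \<or> s = - 1"
  shows "vec.dim (S_H (\<i> * s)) \<le> vec.dim (S_1 (\<i> * s))"
proof (rule jacobi.dim_le[OF jacobi1 s _ subspace_L2_solutions[OF s] clin_hw, of 2])
  let ?z = "\<i> * complex_of_real s"
  have z: "norm ?z = 1" "?z \<noteq> 0" using s by (auto simp: norm_mult)
  show "(\<lambda>n. jac_apply (a1 X \<Lambda>) (b1 X) (hw ?z c) n + ?z *s hw ?z c n) \<in> L2 pos_nats" if c: "c \<in> S_H ?z" for c
  proof -
    let ?v = "\<lambda>n. jac_apply (a1 X \<Lambda>) (b1 X) (hw ?z c) n + ?z *s hw ?z c n"
    have cell: "sq_summable (\<lambda>k. (2 * K) * cell ?z (Suc k) c)"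
      using c S_H_iff[OF z(2)] by (intro sq_summable_scale) blast
    have odd: "norm (?v (2 * k + 1)) \<le> (2 * K) * cell ?z (Suc k) c" for k
      using norm_triangle_ineq[of "jac_apply (a1 X \<Lambda>) (b1 X) (hw ?z c) (2 * k + 1)" "?z *s hw ?z c (2 * k + 1)"]
        cell_bounds(1,3)[OF z(1), of k c]
      unfolding norm_vscale z(1) hw_rows(1) hw_simps(2) by linarith
    have even: "norm (?v (2 * k + 2)) \<le> (2 * K) * cell ?z (Suc k) c" for k
      using norm_triangle_ineq[of "jac_apply (a1 X \<Lambda>) (b1 X) (hw ?z c) (2 * k + 2)" "?z *s hw ?z c (2 * k + 2)"]
        cell_bounds(2,4)[OF z(1), of k c]
      unfolding norm_vscale z(1) hw_rows(2) hw_simps(3) by linarith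
    show ?thesis
      unfolding L2_pos_nats_sq_summable
    proof (rule sq_summable_interleave)
      show "sq_summable (\<lambda>k. norm (?v (2 * k + 1)))"
        by (rule sq_summable_dominated[OF cell]) (simp only: abs_norm_cancel odd)
      show "sq_summable (\<lambda>k. norm (?v (2 * k + 2)))"
        by (rule sq_summable_dominated[OF cell]) (simp only: abs_norm_cancel even)
    qed
  qed
  show "\<exists>L>0. \<forall>\<^sub>F N in sequentially.
      L \<le> s * Im (hdot (hw ?z c (2 * N)) (- (b1 X (2 * N) *\<^sub>R hw ?z c (Suc (2 * N)))))"
    if c: "c \<in> S_H ?z" "c \<noteq> 0" for c
  proof (intro exI[of _ "(cell ?z 1 c)\<^sup>2"] conjI eventually_sequentiallyI[of 1])
    show "(cell ?z 1 c)\<^sup>2 > 0" using cell_definite[OF z(1)] c(2) by auto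
    fix N :: nat assume "N \<ge> 1"
    then obtain j where N: "N = Suc j" by (cases N) auto
    have idx: "2 * Suc j = 2 * j + 2" "Suc (2 * j + 2) = 2 * Suc j + 1" by auto
    have "hdot (hw ?z c (2 * N)) (- (b1 X (2 * N) *\<^sub>R hw ?z c (Suc (2 * N))))
        = - hdot (dpc ?z c j (X (Suc j))) (P ?z c (Suc j))"
      unfolding N idx(1) hw_simps b1_eq unfolding idx(2) hw_simps hdot_minus hdot_scaleR scaleR_scaleR
      using p_nz[of j] p_nz[of "Suc j"] by simp
    \<comment> \<open>The slopes on the two sides of a node differ by \<Lambda> f, whose product
      with f is real.\<close>
    moreover have "Im (hdot (P ?z c (Suc j)) (dpc ?z c j (X (Suc j)))) = Im (hdot (P ?z c (Suc j)) (Q ?z c (Suc j)))"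
      unfolding P_Suc(2) hdot_add using Im_hdot_scale_self[OF hermitian[of "Suc j"], of "P ?z c (Suc j)"] by simp
    ultimately have "s * Im (hdot (hw ?z c (2 * N)) (- (b1 X (2 * N) *\<^sub>R hw ?z c (Suc (2 * N)))))
        = (\<Sum>k\<in>{1..N}. (cell ?z k c)\<^sup>2)"
      unfolding H_energy[OF s, symmetric] N
      by (subst (asm) hdot_commute) simp
    also have "\<dots> \<ge> (cell ?z 1 c)\<^sup>2"
      by (rule member_le_sum) (use \<open>N \<ge> 1\<close> in auto)
    finally show "(cell ?z 1 c)\<^sup>2 \<le> s * Im (hdot (hw ?z c (2 * N)) (- (b1 X (2 * N) *\<^sub>R hw ?z c (Suc (2 * N)))))" .
  qed
qed simp

end

subsection \<open>Comparison of the deficiency spaces\<close>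

lemma Im_phase_hdot:
  fixes s :: real
  assumes "s = 1 \<or> s = - 1"
  shows "s * Im (hdot a ((\<i> * s) *s b)) = - Re (hdot a b)"
  using assms by (auto simp: hdot_scale)

context delta_bounded
begin

section \<open>From the first matrix to the second\<close>

lemma inj_stride: "inj (\<lambda>k :: nat. 2 * k + i)"
  by (rule injI) simp

text \<open>Odd entries of \<open>v\<close> are scaled values f, even entries are scaled slopes. Up
  to terms p z v, the even rows say that a difference quotient of f is the slope on its cell, and
  the odd rows say that the slopes jump by \<Lambda> f.\<close>

lemma sol1_rows:
  assumes v: "v = sol1 z c" and f: "\<And>k. f k = (1 / p k) *\<^sub>R v (2 * k + 1)"
  shows "(1 / (p k)\<^sup>2) *\<^sub>R (f (Suc k) - f k) = (1 / (p k) ^ 3) *\<^sub>R v (2 * k + 2) + p k *\<^sub>R (z *s v (2 * k + 2))"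
    and "(1 / (p k) ^ 3) *\<^sub>R v (2 * k + 2) + \<Lambda> (Suc k) *v f (Suc k)
      - (1 / (p (Suc k)) ^ 3) *\<^sub>R v (2 * k + 4) = p (Suc k) *\<^sub>R (z *s v (2 * k + 3))"
proof -
  have row: "jac_apply (a1 X \<Lambda>) (b1 X) v n = z *s v n" if "n \<ge> 1" for n
    unfolding v by (rule jacobi.jac_apply_sol[OF jacobi1 that])
  have f': "f (Suc k) = (1 / p (Suc k)) *\<^sub>R v (2 * k + 3)" using f[of "Suc k"] by (simp add: numeral_3_eq_3)
  have c: "p k * (1 / (p k) ^ 4) = 1 / (p k) ^ 3" "1 / (p k) ^ 3 = 1 / (p k)\<^sup>2 * (1 / p k)"
    "p k * (1 / ((p k) ^ 3 * p (Suc k))) = 1 / (p k)\<^sup>2 * (1 / p (Suc k))"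
    "p (Suc k) * (1 / ((p k) ^ 3 * p (Suc k))) = 1 / (p k) ^ 3"
    "p (Suc k) * (1 / (p (Suc k))\<^sup>2) = 1 / p (Suc k)"
    "p (Suc k) * (1 / (p (Suc k)) ^ 4) = 1 / (p (Suc k)) ^ 3"
    using p_nz[of k] p_nz[of "Suc k"] by (simp_all add: field_simps power_numeral_reduce)
  have "p k *\<^sub>R (- (1 / (p k) ^ 4) *\<^sub>R v (2 * k + 1) - (1 / (p k) ^ 4) *\<^sub>R v (2 * k + 2)
      + (1 / ((p k) ^ 3 * p (Suc k))) *\<^sub>R v (2 * k + 3)) = p k *\<^sub>R (z *s v (2 * k + 2))"
    using row[of "2 * k + 2"] unfolding row1_even by simp
  then have "- (1 / (p k)\<^sup>2 * (1 / p k)) *\<^sub>R v (2 * k + 1) - (1 / (p k) ^ 3) *\<^sub>R v (2 * k + 2)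
      + (1 / (p k)\<^sup>2 * (1 / p (Suc k))) *\<^sub>R v (2 * k + 3) = p k *\<^sub>R (z *s v (2 * k + 2))"
    unfolding scaleR_add_right scaleR_diff_right scaleR_minus_left scaleR_minus_right scaleR_scaleR c(1,3)
    unfolding c(2)[symmetric] .
  then show "(1 / (p k)\<^sup>2) *\<^sub>R (f (Suc k) - f k) = (1 / (p k) ^ 3) *\<^sub>R v (2 * k + 2) + p k *\<^sub>R (z *s v (2 * k + 2))"
    unfolding f' f[of k] scaleR_diff_right scaleR_scaleR by (simp add: algebra_simps)
  have "p (Suc k) *\<^sub>R ((1 / ((p k) ^ 3 * p (Suc k))) *\<^sub>R v (2 * k + 2)
      + (1 / (p (Suc k))\<^sup>2) *\<^sub>R (\<Lambda> (Suc k) *v v (2 * k + 3)) - (1 / (p (Suc k)) ^ 4) *\<^sub>R v (2 * k + 4))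
      = p (Suc k) *\<^sub>R (z *s v (2 * k + 3))"
    using row[of "2 * Suc k + 1"] unfolding row1_odd by (simp add: numeral_3_eq_3)
  then show "(1 / (p k) ^ 3) *\<^sub>R v (2 * k + 2) + \<Lambda> (Suc k) *v f (Suc k)
      - (1 / (p (Suc k)) ^ 3) *\<^sub>R v (2 * k + 4) = p (Suc k) *\<^sub>R (z *s v (2 * k + 3))"
    unfolding scaleR_add_right scaleR_diff_right scaleR_scaleR c(4,5,6) f' matrix_mult_scaleR .
qed

text \<open>Reads a solution for the first matrix as \<open>\<Gamma>\<^sub>0 f\<close> and returns the sequence \<open>r\<^sub>k f(x\<^sub>k)\<close>.\<close>

definition jw :: "complex \<Rightarrow> complex ^ 'p \<Rightarrow> nat \<Rightarrow> complex ^ 'p" where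
  "jw z c n = (if n = 0 then 0 else r n *\<^sub>R ((1 / p n) *\<^sub>R sol1 z c (2 * n + 1)))"

lemma clin_jw: "clin (\<lambda>c. jw z c n)"
proof (cases n)
  case 0
  then show ?thesis by (simp add: jw_def clin_zero)
next
  case (Suc k)
  have "clin (\<lambda>c. r n *\<^sub>R ((1 / p n) *\<^sub>R sol1 z c (2 * n + 1)))"
    by (intro clin_scaleR clin_jac_sol)
  then show ?thesis unfolding jw_def Suc by simp
qed

lemma scale_le:
  fixes x :: "complex ^ 'p"
  assumes "0 \<le> t" "t \<le> 1"
  shows "norm (t *\<^sub>R x) \<le> norm x"
  using assms mult_right_mono[of t 1 "norm x"] by simp

lemma p_div_r: "0 \<le> p k / r (Suc k)" "p k / r (Suc k) \<le> 1"
    "0 \<le> p (Suc k) / r (Suc k)" "p (Suc k) / r (Suc k) \<le> 1"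
  using p_le_r[of k] r_pos[of k] p_pos[of k] p_pos[of "Suc k"] by (simp_all add: less_imp_le)

lemma p4_le: "(p k) ^ 4 \<le> D\<^sup>2"
proof -
  have "((p k)\<^sup>2)\<^sup>2 \<le> D\<^sup>2" by (rule power_mono[OF p_le]) simp
  then show ?thesis by (simp flip: power_mult)
qed

text \<open>In the rows of the second matrix the singular slopes \<open>v / p ^ 3\<close> cancel
  through the odd rows of the first. What remains carries factors p / r, which are at most
  1.\<close>

theorem dim_J1_le_J2:
  fixes s :: real
  assumes s: "s = 1 \<or> s = - 1"
  shows "vec.dim (S_1 (\<i> * s)) \<le> vec.dim (S_2 (\<i> * s))"
proof (rule jacobi.dim_le[OF jacobi2 s _ jacobi.subspace_L2_solutions[OF jacobi1 s] clin_jw, of 1])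
  let ?z = "\<i> * complex_of_real s"
  have z: "norm ?z = 1" using s by (auto simp: norm_mult)
  fix c assume c: "c \<in> S_1 ?z"
  define v where "v = sol1 ?z c"
  define f where "f k = (1 / p k) *\<^sub>R v (2 * k + 1)" for k
  note rows = sol1_rows[OF v_def f_def]
  have w: "jw ?z c 0 = 0" "jw ?z c n = r n *\<^sub>R f n" if "n \<ge> 1" for n
    using that by (auto simp: jw_def f_def v_def)
  have vsum: "sq_summable (\<lambda>n. norm (v n))"
    using c unfolding L2_pos_nats_sq_summable[symmetric] v_def by simp
  have f': "f (Suc k) = (1 / p (Suc k)) *\<^sub>R v (2 * k + 3)" for k
    using f_def[of "Suc k"] by (simp add: numeral_3_eq_3)
  define B where "B k = norm (v (2 * k + 1)) + norm (v (2 * k + 2)) + norm (v (2 * k + 3)) + norm (v (2 * k + 4))" for k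
  have Bsum: "sq_summable B"
    unfolding B_def[abs_def] by (intro sq_summable_add sq_summable_reindex[OF vsum inj_stride])
  \<comment> \<open>The row with \<open>k = 0\<close> is left out: \<open>row2\<close> wants
    \<open>f 0 = 0\<close> there, while here \<open>f 0\<close> is \<open>v 1\<close> divided by
    \<open>p 0\<close>. A single row does not affect square-summability.\<close>
  have row_bound: "norm (jac_apply (a2 X \<Lambda>) (b2 X) (jw ?z c) (Suc k)) \<le> B k" if k: "k \<ge> 1" for k
  proof -
    have "jac_apply (a2 X \<Lambda>) (b2 X) (jw ?z c) (Suc k) = (1 / r (Suc k)) *\<^sub>R (\<Lambda> (Suc k) *v f (Suc k)
        + ((1 / (p k) ^ 3) *\<^sub>R v (2 * k + 2) + p k *\<^sub>R (?z *s v (2 * k + 2)))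
        - ((1 / (p (Suc k)) ^ 3) *\<^sub>R v (2 * Suc k + 2) + p (Suc k) *\<^sub>R (?z *s v (2 * Suc k + 2))))"
      unfolding rows(1)[symmetric] by (rule row2) (use w k in auto)
    also have "2 * Suc k + 2 = 2 * k + 4" by simp
    also have "(1 / r (Suc k)) *\<^sub>R (\<Lambda> (Suc k) *v f (Suc k)
        + ((1 / (p k) ^ 3) *\<^sub>R v (2 * k + 2) + p k *\<^sub>R (?z *s v (2 * k + 2)))
        - ((1 / (p (Suc k)) ^ 3) *\<^sub>R v (2 * k + 4) + p (Suc k) *\<^sub>R (?z *s v (2 * k + 4))))
      = (1 / r (Suc k)) *\<^sub>R (p (Suc k) *\<^sub>R (?z *s v (2 * k + 3))
        + p k *\<^sub>R (?z *s v (2 * k + 2)) - p (Suc k) *\<^sub>R (?z *s v (2 * k + 4)))"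
      unfolding rows(2)[symmetric] by (simp add: algebra_simps)
    also have "\<dots> = (p (Suc k) / r (Suc k)) *\<^sub>R (?z *s v (2 * k + 3))
        + (p k / r (Suc k)) *\<^sub>R (?z *s v (2 * k + 2)) - (p (Suc k) / r (Suc k)) *\<^sub>R (?z *s v (2 * k + 4))"
      by (simp add: scaleR_add_right scaleR_diff_right)
    finally have eq: "jac_apply (a2 X \<Lambda>) (b2 X) (jw ?z c) (Suc k) = \<dots>" .
    have "norm \<dots> \<le> norm (v (2 * k + 3)) + norm (v (2 * k + 2)) + norm (v (2 * k + 4))"
      using scale_le[OF p_div_r(3,4), of k "?z *s v (2 * k + 3)"] scale_le[OF p_div_r(1,2), of k "?z *s v (2 * k + 2)"]
        scale_le[OF p_div_r(3,4), of k "?z *s v (2 * k + 4)"] unfolding norm_vscale z mult_1_left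
      by (intro order.trans[OF norm_triangle_ineq4] add_mono order.trans[OF norm_triangle_ineq])
    then show ?thesis unfolding eq B_def using norm_ge_zero[of "v (2 * k + 1)"] by linarith
  qed
  \<comment> \<open>The weight \<open>r (Suc k)\<close> is at most \<open>p k + p (Suc k)\<close>.
    The right cell gives an entry of \<open>v\<close> directly; on the left cell the even row
    expresses the value through entries of \<open>v\<close>.\<close>
  have w_bound: "norm (jw ?z c (Suc k)) \<le> (2 + D\<^sup>2) * B k" for k
  proof -
    have "norm (jw ?z c (Suc k)) = r (Suc k) * norm (f (Suc k))"
      using w(2)[of "Suc k"] r_pos[of k] by simp
    also have "\<dots> \<le> (p k + p (Suc k)) * norm (f (Suc k))"
    proof (rule mult_right_mono)
      show "r (Suc k) \<le> p k + p (Suc k)"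
        using p_pos[of k] p_pos[of "Suc k"] by - (rule power2_le_imp_le; simp add: r_sq power2_sum)
    qed simp
    also have "\<dots> = norm (p k *\<^sub>R f (Suc k)) + norm (p (Suc k) *\<^sub>R f (Suc k))"
      using p_pos[of k] p_pos[of "Suc k"] by (simp add: distrib_right)
    also have "p (Suc k) *\<^sub>R f (Suc k) = v (2 * k + 3)" using p_nz[of "Suc k"] by (simp add: f')
    also have "p k *\<^sub>R f (Suc k) = v (2 * k + 1) + v (2 * k + 2) + (p k) ^ 4 *\<^sub>R (?z *s v (2 * k + 2))"
    proof -
      have c: "(p k) ^ 3 * (1 / (p k)\<^sup>2) = p k" "(p k) ^ 3 * (1 / (p k) ^ 3) = 1" "(p k) ^ 3 * p k = (p k) ^ 4"
        using p_nz[of k] by (simp_all add: field_simps power_numeral_reduce)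
      have "(p k) ^ 3 *\<^sub>R ((1 / (p k)\<^sup>2) *\<^sub>R (f (Suc k) - f k))
          = v (2 * k + 2) + (p k) ^ 4 *\<^sub>R (?z *s v (2 * k + 2))"
        unfolding rows(1) scaleR_add_right scaleR_scaleR c by simp
      then have "p k *\<^sub>R f (Suc k) - p k *\<^sub>R f k = v (2 * k + 2) + (p k) ^ 4 *\<^sub>R (?z *s v (2 * k + 2))"
        unfolding scaleR_scaleR c scaleR_diff_right .
      moreover have "p k *\<^sub>R f k = v (2 * k + 1)" using p_nz[of k] by (simp add: f_def)
      ultimately show ?thesis by (simp add: algebra_simps)
    qed
    also have "norm (v (2 * k + 1) + v (2 * k + 2) + (p k) ^ 4 *\<^sub>R (?z *s v (2 * k + 2)))
        \<le> norm (v (2 * k + 1)) + norm (v (2 * k + 2)) + D\<^sup>2 * norm (v (2 * k + 2))"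
      using mult_right_mono[OF p4_le, of "norm (v (2 * k + 2))" k]
      by (intro order.trans[OF norm_triangle_ineq] add_mono norm_triangle_ineq) (simp add: norm_vscale z)
    finally have "norm (jw ?z c (Suc k)) \<le> norm (v (2 * k + 1)) + norm (v (2 * k + 2))
        + D\<^sup>2 * norm (v (2 * k + 2)) + norm (v (2 * k + 3))" by simp
    also have "\<dots> \<le> 2 * B k + D\<^sup>2 * B k"
    proof -
      have "D\<^sup>2 * norm (v (2 * k + 2)) \<le> D\<^sup>2 * B k"
        by (rule mult_left_mono) (simp_all add: B_def)
      moreover have "norm (v (2 * k + 1)) + norm (v (2 * k + 2)) + norm (v (2 * k + 3)) \<le> B k" "0 \<le> B k"
        by (simp_all add: B_def)
      ultimately show ?thesis by linarith
    qed
    finally show ?thesis by (simp add: algebra_simps)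
  qed
  show "(\<lambda>n. jac_apply (a2 X \<Lambda>) (b2 X) (jw ?z c) n + ?z *s jw ?z c n) \<in> L2 pos_nats"
    unfolding L2_pos_nats_sq_summable
  proof (subst sq_summable_Suc[symmetric], rule sq_summable_dominated[OF sq_summable_scale[OF Bsum, of "3 + D\<^sup>2"], of 1])
    fix k :: nat assume k: "k \<ge> 1"
    have "norm (jac_apply (a2 X \<Lambda>) (b2 X) (jw ?z c) (Suc k) + ?z *s jw ?z c (Suc k))
        \<le> B k + (2 + D\<^sup>2) * B k"
      using row_bound[OF k] w_bound[of k]
      by (intro order.trans[OF norm_triangle_ineq] add_mono) (simp_all only: norm_vscale z mult_1_left)
    then show "\<bar>norm (jac_apply (a2 X \<Lambda>) (b2 X) (jw ?z c) (Suc k) + ?z *s jw ?z c (Suc k))\<bar> \<le> (3 + D\<^sup>2) * B k"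
      by (simp add: algebra_simps)
  qed
  assume "c \<noteq> 0"
  have v1: "v 1 = c" by (simp add: v_def)
  have energy: "s * Im (hdot (v (2 * N + 1)) (v (2 * N + 2))) / (p N) ^ 4 = (\<Sum>n\<in>{1..2 * N + 1}. (norm (v n))\<^sup>2)" for N
  proof -
    note W = jacobi.weyl[OF jacobi1 s, of 1, simplified mult_1_left, OF order.refl]
    have "(\<Sum>n\<in>{1..2 * N + 1}. (norm (v n))\<^sup>2)
        = s * Im (hdot (v (2 * N + 1)) (- (b1 X (2 * N + 1) *\<^sub>R v (Suc (2 * N + 1)))))"
      unfolding v_def using weyl_system.E_eq[OF W, of "2 * N + 1" c]
      unfolding weyl_system.E_def[OF W] jacobi.sum_cell_norm[OF jacobi1] by simp
    then show ?thesis unfolding b1_eq by (simp add: hdot_scaleR)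
  qed
  \<comment> \<open>The difference quotient exceeds the slope by p z v; this correction is the only
    deviation of the form from the energy.\<close>
  have main: "s * Im (hdot (jw ?z c (1 * N)) (- (b2 X (1 * N) *\<^sub>R jw ?z c (Suc (1 * N)))))
      = (\<Sum>n\<in>{1..2 * N + 1}. (norm (v n))\<^sup>2) - Re (hdot (v (2 * N + 1)) (v (2 * N + 2)))" if N: "N \<ge> 1" for N
  proof -
    obtain j where j: "N = Suc j" using N by (cases N) auto
    have c: "r N * (1 / (r N * r (Suc N) * (p N)\<^sup>2) * r (Suc N)) = 1 / (p N)\<^sup>2"
      using r_nz[of j] r_nz[of N] p_nz[of N] by (simp add: j)
    have "hdot (jw ?z c (1 * N)) (- (b2 X (1 * N) *\<^sub>R jw ?z c (Suc (1 * N)))) = (1 / (p N)\<^sup>2) *\<^sub>R hdot (f N) (f (Suc N))"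
      using N by (simp add: w b2_def gap_Suc hdot_scaleR c[symmetric] mult.assoc)
    also have "\<dots> = hdot (f N) ((1 / (p N)\<^sup>2) *\<^sub>R (f (Suc N) - f N)) + (1 / (p N)\<^sup>2) *\<^sub>R hdot (f N) (f N)"
      by (simp add: hdot_scaleR hdot_diff scaleR_diff_right)
    also have "hdot (f N) ((1 / (p N)\<^sup>2) *\<^sub>R (f (Suc N) - f N))
        = (1 / (p N) ^ 4) *\<^sub>R hdot (v (2 * N + 1)) (v (2 * N + 2)) + hdot (v (2 * N + 1)) (?z *s v (2 * N + 2))"
      unfolding rows(1) unfolding hdot_add hdot_scaleR f_def scaleR_scaleR using p_nz[of N] by (simp add: power_numeral_reduce)
    finally have "hdot (jw ?z c (1 * N)) (- (b2 X (1 * N) *\<^sub>R jw ?z c (Suc (1 * N))))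
        = (1 / (p N) ^ 4) *\<^sub>R hdot (v (2 * N + 1)) (v (2 * N + 2)) + hdot (v (2 * N + 1)) (?z *s v (2 * N + 2))
          + (1 / (p N)\<^sup>2) *\<^sub>R hdot (f N) (f N)" .
    then have "s * Im (hdot (jw ?z c (1 * N)) (- (b2 X (1 * N) *\<^sub>R jw ?z c (Suc (1 * N)))))
        = s * Im (hdot (v (2 * N + 1)) (v (2 * N + 2))) / (p N) ^ 4 + s * Im (hdot (v (2 * N + 1)) (?z *s v (2 * N + 2)))"
      by (simp only: plus_complex.sel scaleR_complex.sel hdot_self Im_complex_of_real) (simp add: algebra_simps)
    then show ?thesis unfolding energy Im_phase_hdot[OF s] by simp
  qed
  \<comment> \<open>Write a and b for the entries at \<open>2 * N + 1\<close> and
    \<open>2 * N + 2\<close>. The energy contains |c|^2 + |a|^2, since the sites 1 and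
    \<open>2 * N + 1\<close> differ, and the correction is at most (|a|^2 + |b|^2) / 2. Once |b|
    \<le> |c|, at least |c|^2 / 2 is left.\<close>
  have "(\<lambda>N. norm (v (2 * N + 2))) \<longlonglongrightarrow> 0"
    by (rule sq_summable_tendsto_0[OF sq_summable_reindex[OF vsum inj_stride]])
  then have "\<forall>\<^sub>F N in sequentially. norm (v (2 * N + 2)) < norm c"
    using \<open>c \<noteq> 0\<close> by (intro order_tendstoD) auto
  then have ev: "\<forall>\<^sub>F N in sequentially. N \<ge> 1 \<and> norm (v (2 * N + 2)) < norm c"
    using eventually_ge_at_top[of 1] by eventually_elim auto
  have "\<forall>\<^sub>F N in sequentially. (norm c)\<^sup>2 / 2
      \<le> s * Im (hdot (jw ?z c (1 * N)) (- (b2 X (1 * N) *\<^sub>R jw ?z c (Suc (1 * N)))))"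
    using ev
  proof eventually_elim
    case (elim N)
    let ?a = "v (2 * N + 1)" and ?b = "v (2 * N + 2)"
    have "Re (hdot ?a ?b) \<le> norm ?a * norm ?b"
      using norm_hdot_le[of ?a ?b] complex_Re_le_cmod[of "hdot ?a ?b"] by linarith
    then have "2 * Re (hdot ?a ?b) \<le> (norm ?a)\<^sup>2 + (norm ?b)\<^sup>2"
      using sum_squares_bound[of "norm ?a" "norm ?b"] by simp
    moreover have "(norm ?b)\<^sup>2 \<le> (norm c)\<^sup>2" using elim by (intro power_mono) auto
    moreover have "(norm (v 1))\<^sup>2 + (norm ?a)\<^sup>2 \<le> (\<Sum>n\<in>{1..2 * N + 1}. (norm (v n))\<^sup>2)"
    proof -
      have "(\<Sum>n\<in>{1, 2 * N + 1}. (norm (v n))\<^sup>2) \<le> (\<Sum>n\<in>{1..2 * N + 1}. (norm (v n))\<^sup>2)"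
        by (rule sum_mono2) auto
      then show ?thesis using elim by simp
    qed
    moreover have "(norm ?a)\<^sup>2 \<ge> 0" by simp
    ultimately show ?case unfolding v1 main[OF conjunct1[OF elim]] by linarith
  qed
  then show "\<exists>L>0. \<forall>\<^sub>F N in sequentially.
      L \<le> s * Im (hdot (jw ?z c (1 * N)) (- (b2 X (1 * N) *\<^sub>R jw ?z c (Suc (1 * N)))))"
    using \<open>c \<noteq> 0\<close> by (intro exI[of _ "(norm c)\<^sup>2 / 2"]) auto
qed simp

end

section \<open>From the second matrix back to the differential operator\<close>

context delta_bounded
begin

text \<open>
  From a solution \<open>u\<close> for the second matrix, \<open>uf\<close>, \<open>ug\<close> and \<open>ut\<close> are the values \<open>f(x\<^sub>k) = u\<^sub>k / r\<^sub>k\<close>,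
  \<open>f'(x\<^sub>k\<^sub>+\<^sub>1-)\<close> and \<open>f'(x\<^sub>k+)\<close> of an element of the maximal domain.  The second matrix corresponds to
  \<open>f(0) = 0\<close> instead of \<open>f'(0) = 0\<close>, which does not affect the boundary form at infinity.
\<close>

definition uf :: "complex \<Rightarrow> complex ^ 'p \<Rightarrow> nat \<Rightarrow> complex ^ 'p" where
  "uf z c n = (if n = 0 then 0 else (1 / r n) *\<^sub>R sol2 z c n)"

definition slope :: "complex \<Rightarrow> complex ^ 'p \<Rightarrow> nat \<Rightarrow> complex ^ 'p" where
  "slope z c k = (1 / (p k)\<^sup>2) *\<^sub>R (uf z c (Suc k) - uf z c k)"

text \<open>The source term r z u of node \<open>Suc k\<close> is shared between the two adjacent
  cells in proportion to their lengths; this is the share of the left cell.\<close>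

definition ug :: "complex \<Rightarrow> complex ^ 'p \<Rightarrow> nat \<Rightarrow> complex ^ 'p" where
  "ug z c k = slope z c k - ((p k)\<^sup>2 / r (Suc k)) *\<^sub>R (z *s sol2 z c (Suc k))"

text \<open>At later nodes the correction is the share of the right cell. At 0 the choice gives the
  first cell equal slopes at both ends, so its slope difference contributes nothing to the
  estimates.\<close>

definition ut :: "complex \<Rightarrow> complex ^ 'p \<Rightarrow> nat \<Rightarrow> complex ^ 'p" where
  "ut z c n = (case n of 0 \<Rightarrow> ug z c 0
     | Suc k \<Rightarrow> slope z c n + ((p n)\<^sup>2 / r n) *\<^sub>R (z *s sol2 z c n))"

lemma clin_uf: "clin (\<lambda>c. uf z c n)"
proof (cases n)
  case 0
  then show ?thesis by (simp add: uf_def clin_zero)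
next
  case (Suc k)
  have "clin (\<lambda>c. (1 / r n) *\<^sub>R sol2 z c n)" by (intro clin_scaleR clin_jac_sol)
  then show ?thesis unfolding uf_def Suc by simp
qed

lemma clin_slope: "clin (\<lambda>c. slope z c k)"
  unfolding slope_def by (intro clin_scaleR clin_diff clin_uf)

lemma clin_ut: "clin (\<lambda>c. ut z c n)"
proof (cases n)
  case 0
  show ?thesis unfolding ut_def 0 nat.case ug_def by (intro clin_intros clin_slope clin_jac_sol)
next
  case (Suc k)
  show ?thesis unfolding ut_def Suc nat.case by (intro clin_intros clin_slope clin_jac_sol)
qed

lemma sol2_eq: "sol2 z c n = r n *\<^sub>R uf z c n" if "n \<ge> 1"
  using that r_nz[of "n - 1"] by (simp add: uf_def)

lemma sol2_row: "z *s sol2 z c (Suc k)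
    = (1 / r (Suc k)) *\<^sub>R (\<Lambda> (Suc k) *v uf z c (Suc k) + slope z c k - slope z c (Suc k))"
  unfolding slope_def
  by (subst jacobi.jac_apply_sol[OF jacobi2, symmetric], simp, rule row2) (use sol2_eq in \<open>auto simp: uf_def\<close>)

text \<open>The interface condition. It holds exactly because the two shares of the source term add
  up to r z u.\<close>

lemma ut_Suc: "ut z c (Suc k) = ug z c k + \<Lambda> (Suc k) *v uf z c (Suc k)"
proof -
  have "\<Lambda> (Suc k) *v uf z c (Suc k) = r (Suc k) *\<^sub>R (z *s sol2 z c (Suc k)) - slope z c k + slope z c (Suc k)"
    using r_nz[of k] unfolding sol2_row[of z c k] by simp
  moreover have "(p (Suc k))\<^sup>2 / r (Suc k) = r (Suc k) - (p k)\<^sup>2 / r (Suc k)"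
    using r_sq[of k] r_nz[of k] by (simp add: field_simps power2_eq_square)
  ultimately show ?thesis by (simp add: ut_def ug_def scaleR_diff_left)
qed

lemma uf_bounds:
  assumes z: "norm z = 1"
  shows "norm (p k *\<^sub>R uf z c k) \<le> norm (sol2 z c k)" "norm (p k *\<^sub>R uf z c (Suc k)) \<le> norm (sol2 z c (Suc k))"
    "norm (((p k)\<^sup>2 / r (Suc k)) *\<^sub>R (z *s sol2 z c (Suc k))) \<le> p k * norm (sol2 z c (Suc k))"
proof -
  have le: "norm (t *\<^sub>R uf z c (Suc j)) \<le> norm (sol2 z c (Suc j))" if "0 \<le> t" "t \<le> r (Suc j)" for t j
    using that r_pos[of j] sol2_eq[of "Suc j" z c] by (simp add: mult_right_mono)
  show "norm (p k *\<^sub>R uf z c (Suc k)) \<le> norm (sol2 z c (Suc k))"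
    using le[of "p k" k] p_pos[of k] p_le_r(1)[of k] by simp
  show "norm (p k *\<^sub>R uf z c k) \<le> norm (sol2 z c k)"
  proof (cases k)
    case (Suc j)
    then show ?thesis using le[of "p k" j] p_pos[of k] p_le_r(2)[of j] by simp
  qed (simp add: uf_def)
  have "norm (((p k)\<^sup>2 / r (Suc k)) *\<^sub>R (z *s sol2 z c (Suc k))) = p k * norm ((p k / r (Suc k)) *\<^sub>R (z *s sol2 z c (Suc k)))"
    using p_pos[of k] by (simp add: power2_eq_square abs_mult)
  also have "\<dots> \<le> p k * norm (z *s sol2 z c (Suc k))"
    using p_pos[of k] by (intro mult_left_mono scale_le p_div_r) simp
  finally show "norm (((p k)\<^sup>2 / r (Suc k)) *\<^sub>R (z *s sol2 z c (Suc k))) \<le> p k * norm (sol2 z c (Suc k))"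
    by (simp add: norm_vscale z)
qed

text \<open>The four triplet components on a cell. A share of the source term costs
  \<open>p k\<close> times an entry of the solution, which is just what the weights allow.\<close>

lemma ut_bounds:
  assumes z: "norm z = 1"
  defines "b \<equiv> \<lambda>k c. norm (sol2 z c k) + norm (sol2 z c (Suc k))"
  shows "norm ((1 / p k) *\<^sub>R (ut z c k - ug z c k)) \<le> b k c"
    and "norm ((1 / (p k) ^ 3) *\<^sub>R (uf z c (Suc k) - uf z c k - (p k)\<^sup>2 *\<^sub>R ug z c k)) \<le> b k c"
    and "norm (p k *\<^sub>R uf z c k) \<le> b k c"
    and "norm ((p k) ^ 3 *\<^sub>R ug z c k) \<le> (1 + D\<^sup>2) * b k c"
proof -
  note bd = uf_bounds[OF z, where c = c]
  have nonneg: "norm (sol2 z c k) \<ge> 0" "norm (sol2 z c (Suc k)) \<ge> 0" by simp_all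
  show "norm (p k *\<^sub>R uf z c k) \<le> b k c"
    using bd(1)[of k] nonneg unfolding b_def by linarith
  let ?w = "((p k)\<^sup>2 / r (Suc k)) *\<^sub>R (z *s sol2 z c (Suc k))"
  have "norm (ut z c k - ug z c k) \<le> p k * b k c"
  proof (cases k)
    case 0
    then show ?thesis using p_pos[of 0] by (simp add: ut_def b_def)
  next
    case (Suc j)
    have "ut z c k - ug z c k = ((p k)\<^sup>2 / r k) *\<^sub>R (z *s sol2 z c k) + ?w"
      by (simp add: ut_def ug_def Suc)
    moreover have "norm (((p k)\<^sup>2 / r k) *\<^sub>R (z *s sol2 z c k)) \<le> p k * norm (sol2 z c k)"
    proof -
      have "norm (((p k)\<^sup>2 / r k) *\<^sub>R (z *s sol2 z c k)) = p k * norm ((p k / r k) *\<^sub>R (z *s sol2 z c k))"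
        using p_pos[of k] by (simp add: power2_eq_square abs_mult)
      also have "\<dots> \<le> p k * norm (z *s sol2 z c k)"
        using p_pos[of k] p_div_r(3,4)[of j] unfolding Suc by (intro mult_left_mono scale_le) simp_all
      finally show ?thesis by (simp add: norm_vscale z)
    qed
    ultimately have "norm (ut z c k - ug z c k) \<le> p k * norm (sol2 z c k) + p k * norm (sol2 z c (Suc k))"
      using norm_triangle_ineq[of "((p k)\<^sup>2 / r k) *\<^sub>R (z *s sol2 z c k)" ?w] bd(3)[of k] by simp
    then show ?thesis by (simp add: b_def distrib_left)
  qed
  then show "norm ((1 / p k) *\<^sub>R (ut z c k - ug z c k)) \<le> b k c"
    using p_pos[of k] unfolding norm_scaleR by (simp add: field_simps)
  have c: "(p k)\<^sup>2 * (1 / (p k)\<^sup>2) = 1" "(p k) ^ 3 * (1 / (p k)\<^sup>2) = p k" "(p k) ^ 3 = (p k)\<^sup>2 * p k"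
    using p_nz[of k] by (simp_all add: field_simps power_numeral_reduce)
  have "uf z c (Suc k) - uf z c k - (p k)\<^sup>2 *\<^sub>R ug z c k = (p k)\<^sup>2 *\<^sub>R ?w"
    unfolding ug_def slope_def scaleR_diff_right[of "(p k)\<^sup>2"] scaleR_scaleR[of "(p k)\<^sup>2" "1 / (p k)\<^sup>2"] c by simp
  then have "norm (uf z c (Suc k) - uf z c k - (p k)\<^sup>2 *\<^sub>R ug z c k) = (p k)\<^sup>2 * norm ?w" by simp
  also have "\<dots> \<le> (p k)\<^sup>2 * (p k * norm (sol2 z c (Suc k)))"
    by (rule mult_left_mono[OF bd(3)]) simp
  also have "\<dots> \<le> (p k) ^ 3 * b k c"
    unfolding c(3) mult.assoc b_def using p_pos[of k] by (intro mult_left_mono) simp_all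
  finally show "norm ((1 / (p k) ^ 3) *\<^sub>R (uf z c (Suc k) - uf z c k - (p k)\<^sup>2 *\<^sub>R ug z c k)) \<le> b k c"
    using p_pos[of k] unfolding norm_scaleR by (simp add: field_simps)
  have "(p k) ^ 3 *\<^sub>R ug z c k = p k *\<^sub>R uf z c (Suc k) - p k *\<^sub>R uf z c k - (p k) ^ 3 *\<^sub>R ?w"
    unfolding ug_def slope_def scaleR_diff_right[of "(p k) ^ 3"] scaleR_scaleR[of "(p k) ^ 3" "1 / (p k)\<^sup>2"] c(2)
    by (simp add: scaleR_diff_right)
  also have "norm \<dots> \<le> norm (sol2 z c (Suc k)) + norm (sol2 z c k) + D\<^sup>2 * norm (sol2 z c (Suc k))"
  proof (intro order.trans[OF norm_triangle_ineq4] add_mono bd)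
    have "norm ((p k) ^ 3 *\<^sub>R ?w) = (p k) ^ 3 * norm ?w" using p_pos[of k] by simp
    also have "\<dots> \<le> (p k) ^ 3 * (p k * norm (sol2 z c (Suc k)))"
      by (rule mult_left_mono[OF bd(3)]) (use p_pos[of k] in simp)
    also have "\<dots> = (p k) ^ 4 * norm (sol2 z c (Suc k))"
      by (simp add: power_numeral_reduce)
    also have "\<dots> \<le> D\<^sup>2 * norm (sol2 z c (Suc k))" by (intro mult_right_mono p4_le) simp
    finally show "norm ((p k) ^ 3 *\<^sub>R ?w) \<le> D\<^sup>2 * norm (sol2 z c (Suc k))" .
  qed
  also have "\<dots> \<le> (1 + D\<^sup>2) * b k c"
    by (simp add: b_def algebra_simps)
  finally show "norm ((p k) ^ 3 *\<^sub>R ug z c k) \<le> (1 + D\<^sup>2) * b k c" .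
qed

text \<open>Only data at the nodes are transported: by \<open>interval_form\<close> the increments
  of the bracket depend on the triplet components alone, so no function on the half-line has to be
  interpolated.\<close>

theorem dim_J2_le_H:
  fixes s :: real
  assumes s: "s = 1 \<or> s = - 1"
  shows "vec.dim (S_2 (\<i> * s)) \<le> vec.dim (S_H (\<i> * s))"
  unfolding solutions_eq[OF s, symmetric]
proof (rule weyl_system.dim_le_dim_solutions[OF weyl[OF s] jacobi.subspace_L2_solutions[OF jacobi2 s],
      of "\<lambda>N c. uf (\<i> * s) c N" "\<lambda>N c. ut (\<i> * s) c N"])
  let ?z = "\<i> * complex_of_real s"
  have z: "norm ?z = 1" using s by (auto simp: norm_mult)
  show "clin (\<lambda>c. uf ?z c N)" "clin (\<lambda>c. ut ?z c N)" for N by (rule clin_uf clin_ut)+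
  fix c assume c: "c \<in> S_2 ?z"
  let ?u = "sol2 ?z c"
  \<comment> \<open>\<open>interval_form\<close> has four products: in three the transported factor
    is bounded by the sum of two neighbouring norms, in the fourth by 1 + \<open>D\<^sup>2\<close>
    times that sum, and each solution factor costs \<open>K\<close> times the cell norm.\<close>
  define A where "A k = (4 + D\<^sup>2) * K * (norm (?u (k - 1)) + norm (?u k))" for k
  have usum: "sq_summable (\<lambda>n. norm (?u n))"
    using c unfolding L2_pos_nats_sq_summable[symmetric] by simp
  have "sq_summable (\<lambda>k. (4 + D\<^sup>2) * K * (norm (?u k) + norm (?u (Suc k))))"
    by (intro sq_summable_scale sq_summable_add usum sq_summable_Suc[THEN iffD2, OF usum])
  then have "sq_summable A"
    unfolding sq_summable_Suc[of A, symmetric] by (simp add: A_def)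
  moreover have "norm (omega (uf ?z c (Suc k)) (ut ?z c (Suc k)) (P ?z c' (Suc k)) (Q ?z c' (Suc k))
      - omega (uf ?z c k) (ut ?z c k) (P ?z c' k) (Q ?z c' k)) \<le> A (Suc k) * cell ?z (Suc k) c'" for k c'
  proof -
    define b where "b = norm (?u k) + norm (?u (Suc k))"
    define C where "C = K * cell ?z (Suc k) c'"
    note ub = ut_bounds[OF z, of k c, folded b_def] and cb = cell_bounds[OF z, of k c', folded C_def]
    have "b \<ge> 0" by (simp add: b_def)
    have "C \<ge> 0" using cb(1) norm_ge_zero order.trans by blast
    have prod: "norm (hdot x y) \<le> B * C" "norm (hdot x y) \<le> B * C"
      if "norm x \<le> B" "norm y \<le> C" for x y B
      using that by (meson mult_mono norm_ge_zero norm_hdot_le order.trans)+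
    have "norm (omega (uf ?z c (Suc k)) (ut ?z c (Suc k)) (P ?z c' (Suc k)) (Q ?z c' (Suc k))
        - omega (uf ?z c k) (ut ?z c k) (P ?z c' k) (Q ?z c' k)) \<le> b * C + b * C + b * C + (1 + D\<^sup>2) * b * C"
      unfolding ut_Suc P_Suc(2) omega_jump[of "Suc k", simplified] interval_form[OF p_pos[of k]]
      by (intro order.trans[OF norm_triangle_ineq4] order.trans[OF norm_triangle_ineq] add_mono prod ub cb)
    also have "\<dots> = A (Suc k) * cell ?z (Suc k) c'"
      by (simp add: A_def C_def b_def algebra_simps)
    finally show ?thesis .
  qed
  ultimately show "\<exists>A. summable (\<lambda>k. (A k)\<^sup>2) \<and> (\<forall>k c'.
      norm (omega (uf ?z c (Suc k)) (ut ?z c (Suc k)) (P ?z c' (Suc k)) (Q ?z c' (Suc k))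
        - omega (uf ?z c k) (ut ?z c k) (P ?z c' k) (Q ?z c' k)) \<le> A (Suc k) * cell ?z (Suc k) c')"
    unfolding sq_summable_def by blast
  assume "c \<noteq> 0"
  \<comment> \<open>The difference quotient reproduces the energy up to \<open>N\<close>, and the
    share of the source term in \<open>ut\<close> takes away at most the term at \<open>N\<close>.
    For \<open>N \<ge> 2\<close> that term is not the first one, so the square of the norm of
    \<open>c\<close> remains.\<close>
  have "(norm c)\<^sup>2 \<le> s * Im (hdot (uf ?z c N) (ut ?z c N))" if N: "N \<ge> 2" for N
  proof -
    obtain j where j: "N = Suc j" "j \<ge> 1" using N by (cases N) auto
    note W = jacobi.weyl[OF jacobi2 s, of 1, simplified mult_1_left, OF order.refl]
    have energy: "(\<Sum>n\<in>{1..N}. (norm (?u n))\<^sup>2) = s * Im (hdot (?u N) (- (b2 X N *\<^sub>R ?u (Suc N))))"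
      using weyl_system.E_eq[OF W, of N c]
      unfolding weyl_system.E_def[OF W] jacobi.sum_cell_norm[OF jacobi2] by simp
    have uN: "?u N = r N *\<^sub>R uf ?z c N" "?u (Suc N) = r (Suc N) *\<^sub>R uf ?z c (Suc N)"
      using sol2_eq[of N ?z c] sol2_eq[of "Suc N" ?z c] N by simp_all
    have nz: "r N \<noteq> 0" "r (Suc N) \<noteq> 0" "p N \<noteq> 0" using r_nz[of j] r_nz[of N] p_nz[of N] j by auto
    have "hdot (?u N) (- (b2 X N *\<^sub>R ?u (Suc N))) = (1 / (p N)\<^sup>2) *\<^sub>R hdot (uf ?z c N) (uf ?z c (Suc N))"
      using nz unfolding uN by (simp add: b2_def gap_Suc hdot_scaleR)
    also have "\<dots> = hdot (uf ?z c N) (slope ?z c N) + (1 / (p N)\<^sup>2) *\<^sub>R hdot (uf ?z c N) (uf ?z c N)"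
      by (simp add: slope_def hdot_scaleR hdot_diff scaleR_diff_right)
    finally have "s * Im (hdot (?u N) (- (b2 X N *\<^sub>R ?u (Suc N)))) = s * Im (hdot (uf ?z c N) (slope ?z c N))"
      by (simp only: plus_complex.sel scaleR_complex.sel hdot_self Im_complex_of_real) simp
    then have slope: "s * Im (hdot (uf ?z c N) (slope ?z c N)) = (\<Sum>n\<in>{1..N}. (norm (?u n))\<^sup>2)"
      unfolding energy by (rule sym)
    have "s * Im (hdot (uf ?z c N) (((p N)\<^sup>2 / r N) *\<^sub>R (?z *s ?u N)))
        = ((p N)\<^sup>2 / r N) * - Re (hdot (uf ?z c N) (?u N))"
      unfolding hdot_scaleR Im_phase_hdot[OF s, symmetric] by simp
    also have "Re (hdot (uf ?z c N) (?u N)) = (norm (?u N))\<^sup>2 / r N"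
    proof -
      have "uf ?z c N = (1 / r N) *\<^sub>R ?u N" using j by (simp add: uf_def)
      then show ?thesis by (simp add: hdot_scaleR hdot_self del: of_real_power)
    qed
    finally have "s * Im (hdot (uf ?z c N) (((p N)\<^sup>2 / r N) *\<^sub>R (?z *s ?u N)))
        = - ((p N / r N)\<^sup>2 * (norm (?u N))\<^sup>2)"
      by (simp add: power2_eq_square)
    moreover have "(p N / r N)\<^sup>2 * (norm (?u N))\<^sup>2 \<le> 1 * (norm (?u N))\<^sup>2"
      using p_div_r(3,4)[of j] unfolding j by (intro mult_right_mono power_le_one) auto
    moreover have "ut ?z c N = slope ?z c N + ((p N)\<^sup>2 / r N) *\<^sub>R (?z *s ?u N)"
      by (simp add: ut_def j)
    ultimately have "(\<Sum>n\<in>{1..N}. (norm (?u n))\<^sup>2) - (norm (?u N))\<^sup>2 \<le> s * Im (hdot (uf ?z c N) (ut ?z c N))"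
      using slope by (simp add: hdot_add distrib_left)
    moreover have "(norm c)\<^sup>2 + (norm (?u N))\<^sup>2 \<le> (\<Sum>n\<in>{1..N}. (norm (?u n))\<^sup>2)"
    proof -
      have "(\<Sum>n\<in>{1, N}. (norm (?u n))\<^sup>2) \<le> (\<Sum>n\<in>{1..N}. (norm (?u n))\<^sup>2)"
        by (rule sum_mono2) (use N in auto)
      then show ?thesis using N by simp
    qed
    ultimately show ?thesis by linarith
  qed
  then show "\<exists>L>0. \<forall>\<^sub>F N in sequentially. L \<le> s * Im (hdot (uf ?z c N) (ut ?z c N))"
    using \<open>c \<noteq> 0\<close>
    by (intro exI[of _ "(norm c)\<^sup>2"] conjI eventually_sequentiallyI[of 2]) auto
qed

lemma deficiency_dims:
  fixes s :: real
  assumes s: "s = 1 \<or> s = - 1"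
  shows "L2_dim half_line (op_eigenspace (op_adjoint half_line (H_op X \<Lambda>)) (\<i> * s)) = enat (vec.dim (S_1 (\<i> * s)))"
    and "L2_dim pos_nats (op_eigenspace (op_adjoint pos_nats (B1 X \<Lambda>)) (\<i> * s)) = enat (vec.dim (S_1 (\<i> * s)))"
    and "L2_dim pos_nats (op_eigenspace (op_adjoint pos_nats (B2 X \<Lambda>)) (\<i> * s)) = enat (vec.dim (S_1 (\<i> * s)))"
proof -
  have "norm (\<i> * complex_of_real s) = 1" using s by (auto simp: norm_mult)
  then show "L2_dim half_line (op_eigenspace (op_adjoint half_line (H_op X \<Lambda>)) (\<i> * s)) = enat (vec.dim (S_1 (\<i> * s)))"
    using L2_dim_eigenspace dim_H_le_J1[OF s] dim_J1_le_J2[OF s] dim_J2_le_H[OF s] by simp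
  show "L2_dim pos_nats (op_eigenspace (op_adjoint pos_nats (B1 X \<Lambda>)) (\<i> * s)) = enat (vec.dim (S_1 (\<i> * s)))"
    unfolding B1_def J1_eq by (rule jacobi.L2_dim_eigenspace[OF jacobi1])
  show "L2_dim pos_nats (op_eigenspace (op_adjoint pos_nats (B2 X \<Lambda>)) (\<i> * s)) = enat (vec.dim (S_1 (\<i> * s)))"
    unfolding B2_def J2_eq jacobi.L2_dim_eigenspace[OF jacobi2]
    using dim_H_le_J1[OF s] dim_J1_le_J2[OF s] dim_J2_le_H[OF s] by simp
qed

end

theorem mainTheorem1:
  fixes X :: "nat \<Rightarrow> real" and \<Lambda> :: "nat \<Rightarrow> complex ^ 'p ^ 'p"
  assumes "strict_mono X" and "X 0 = 0" and "filterlim X at_top sequentially"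
    and "bdd_above (gap X ` {1..})"
    and "\<And>k. k \<ge> 1 \<Longrightarrow> \<Lambda> k = map_matrix cnj (transpose (\<Lambda> k))"
  shows "(\<forall>B\<in>{B1 X \<Lambda>, B2 X \<Lambda>}.
            n_plus half_line (H_op X \<Lambda>) = n_plus pos_nats B \<and>
            n_minus half_line (H_op X \<Lambda>) = n_minus pos_nats B \<and>
            n_plus pos_nats B \<le> enat CARD('p) \<and>
            n_minus pos_nats B \<le> enat CARD('p)) \<and>
         n_plus pos_nats (B1 X \<Lambda>) = n_plus pos_nats (B2 X \<Lambda>) \<and>
         n_minus pos_nats (B1 X \<Lambda>) = n_minus pos_nats (B2 X \<Lambda>)"
proof -
  obtain D where D: "\<And>k. k \<in> {1..} \<Longrightarrow> gap X k \<le> D"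
    using assms(4) by (auto simp: bdd_above_def)
  interpret delta_bounded X \<Lambda> D
  proof
    show "gap X (Suc k) \<le> D" for k by (rule D) simp
  qed (fact assms(1) | fact assms(2) | fact assms(3) | erule assms(5))+
  \<comment> \<open>By \<open>deficiency_dims\<close> all indices are dimensions of subspaces of
    initial values.\<close>
  have "vec.dim S \<le> CARD('p)" for S :: "(complex ^ 'p) set"
    by (rule dim_subset_UNIV_cart_gen)
  then show ?thesis
    using deficiency_dims[of 1] deficiency_dims[of "- 1"] by (simp add: n_plus_def n_minus_def)
qed

end
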